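(* Let $\mathfrak{A}$ be a dual subalgebra of $\mathfrak{M}(A^2(\mathbb{D}))\simeq H^\infty$. Let $E=\{z_1,\dots,z_n\}$ be points in $\mathbb{D}$ which are separated by $\mathfrak{A}$, and let $W_1,\dots,W_n$ be $r\times r$ complex matrices. There is an element $F\in\mathcal{M}_r(\mathfrak{A})$ with $F(z_i)=W_i$ for $1\le i\le n$ and $\|F\|\le1$ if and only if, setting $N_{z_i}=L\ominus\mathfrak{J}_{z_i}L$ for $1\le i\le n$ for each $L$, \[ \Big[(I_r-W_iW_j^* )\otimes P_{N_{z_i}}P_{N_{z_j}}\Big]_{n\times n}\ \ge\ 0\qquad\text{for all } L\in\operatorname{Lat}\mathfrak{A}. \]
   Context: $\mathbb{D}$ is the open unit disk; $A^2(\mathbb{D})$ is the Bergman space of analytic functions on $\mathbb{D}$ square integrable with respect to area measure; its multiplier algebra $\mathfrak{M}(A^2(\mathbb{D}))$ is the algebra $H^\infty$ of bounded analytic functions acting by multiplication operators $M_f$ on $A^2(\mathbb{D})$. A dual subalgebra is a subalgebra containing $I$ and closed in the weak-$*$ topology of $\mathcal{B}(A^2(\mathbb{D}))$. $\mathcal{M}_r(\mathfrak{A})$ is the algebra of $r\times r$ matrices over $\mathfrak{A}$ with the operator norm on $A^2(\mathbb{D})\otimes\mathbb{C}^r$. $\mathfrak{A}$ separates $E$ if for distinct $z,w\in E$ some $f\in\mathfrak{A}$ has $f(z)\neq f(w)$. $\mathfrak{J}_z=\{f\in\mathfrak{A}:f(z)=0\}$. $\operatorname{Lat}\mathfrak{A}$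 is the lattice of closed $\mathfrak{A}$-invariant subspaces of $A^2(\mathbb{D})$, $L\ominus\mathfrak{J}_zL$ is the set of vectors of $L$ orthogonal to all $gx$ with $g\in\mathfrak{J}_z$, $x\in L$, and $P_N$ is the orthogonal projection of $A^2(\mathbb{D})$ onto $N$. The displayed $n\times n$ operator matrix acts on the direct sum of $n$ copies of $\mathbb{C}^r\otimes A^2(\mathbb{D})$, and $\ge0$ means positive semidefinite. *)

theory Defs
  imports "HOL-Analysis.Analysis"
begin

section \<open>The Bergman space of the unit disk\<close>

abbreviation disk :: "complex set"
  where "disk \<equiv> ball 0 1"

text \<open>
  An analytic function on the disk is represented by its extension by zero, so that two functions
  that agree on the disk are equal. The area measure is not normalized; a normalization only
  multiplies the inner product by a constant and affects none of the notions below.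
\<close>

definition bergman_functions :: "(complex \<Rightarrow> complex) set"
  where "bergman_functions =
    {f. f holomorphic_on disk \<and> (\<forall>z. z \<notin> disk \<longrightarrow> f z = 0) \<and>
        set_integrable lborel disk (\<lambda>z. (cmod (f z))\<^sup>2)}"

lemma holomorphic_disk_measurable:
  assumes "f holomorphic_on disk" "\<forall>z. z \<notin> disk \<longrightarrow> f z = 0"
  shows "f \<in> borel_measurable borel"
proof -
  have "(\<lambda>z. indicator disk z *\<^sub>R f z) \<in> borel_measurable borel"
    using assms(1) by (intro borel_measurable_continuous_on_indicator holomorphic_on_imp_continuous_on) auto
  moreover have "(\<lambda>z. indicator disk z *\<^sub>R f z) = f"
    using assms(2) by (auto simp: fun_eq_iff indicator_def)
  ultimately show ?thesis by simp
qed

lemma bergman_functions_measurable: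
  "f \<in> bergman_functions \<Longrightarrow> f \<in> borel_measurable borel"
  by (auto simp: bergman_functions_def intro: holomorphic_disk_measurable)

lemma bergman_functions_product_integrable:
  assumes f: "f \<in> bergman_functions" and g: "g \<in> bergman_functions"
  shows "set_integrable lborel disk (\<lambda>z. f z * cnj (g z))"
  unfolding set_integrable_def
proof (rule Bochner_Integration.integrable_bound)
  show "integrable lborel (\<lambda>z. indicator disk z *\<^sub>R (cmod (f z))\<^sup>2 + indicator disk z *\<^sub>R (cmod (g z))\<^sup>2)"
    using f g by (intro Bochner_Integration.integrable_add) (auto simp: bergman_functions_def set_integrable_def)
  have mf: "f \<in> borel_measurable borel" and mg: "g \<in> borel_measurable borel"
    using f g by (auto intro: bergman_functions_measurable)
  have "(\<lambda>z. cnj (g z)) \<in> borel_measurable borel"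
    by (rule measurable_compose[OF mg]) (intro borel_measurable_continuous_onI continuous_intros)
  then show "(\<lambda>z. indicator disk z *\<^sub>R (f z * cnj (g z))) \<in> borel_measurable lborel"
    using mf by (intro borel_measurable_scaleR borel_measurable_times borel_measurable_indicator) auto
  have "a * b \<le> a\<^sup>2 + b\<^sup>2" if "0 \<le> a" "0 \<le> b" for a b :: real
    using sum_squares_bound[of a b] mult_nonneg_nonneg[OF that] by linarith
  then show "AE z in lborel. norm (indicator disk z *\<^sub>R (f z * cnj (g z)))
     \<le> norm (indicator disk z *\<^sub>R (cmod (f z))\<^sup>2 + indicator disk z *\<^sub>R (cmod (g z))\<^sup>2)"
    by (intro AE_I2) (auto simp: indicator_def norm_mult)
qed

lemma bergman_functions_zero: "(\<lambda>_. 0) \<in> bergman_functions"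
  by (simp add: bergman_functions_def set_integrable_def)

lemma bergman_functions_add:
  assumes f: "f \<in> bergman_functions" and g: "g \<in> bergman_functions"
  shows "(\<lambda>z. f z + g z) \<in> bergman_functions"
proof -
  have m: "(\<lambda>z. f z + g z) \<in> borel_measurable borel"
    using f g by (intro borel_measurable_add bergman_functions_measurable)
  have le: "(cmod (a + b))\<^sup>2 \<le> 2 * (cmod a)\<^sup>2 + 2 * (cmod b)\<^sup>2" for a b
  proof -
    have "(cmod (a + b))\<^sup>2 \<le> (cmod a + cmod b)\<^sup>2"
      by (intro power_mono norm_triangle_ineq) auto
    also have "\<dots> \<le> 2 * (cmod a)\<^sup>2 + 2 * (cmod b)\<^sup>2"
      using sum_squares_bound[of "cmod a" "cmod b"] by (simp add: power2_sum)
    finally show ?thesis .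
  qed
  have "set_integrable lborel disk (\<lambda>z. (cmod (f z + g z))\<^sup>2)"
    unfolding set_integrable_def
  proof (rule Bochner_Integration.integrable_bound)
    show "integrable lborel (\<lambda>z. 2 * (indicator disk z *\<^sub>R (cmod (f z))\<^sup>2)
        + 2 * (indicator disk z *\<^sub>R (cmod (g z))\<^sup>2))"
      using f g by (intro Bochner_Integration.integrable_add integrable_mult_right)
        (auto simp: bergman_functions_def set_integrable_def)
    show "(\<lambda>z. indicator disk z *\<^sub>R (cmod (f z + g z))\<^sup>2) \<in> borel_measurable lborel"
      using m by (intro borel_measurable_scaleR borel_measurable_power borel_measurable_norm
          borel_measurable_indicator) auto
    show "AE z in lborel. norm (indicator disk z *\<^sub>R (cmod (f z + g z))\<^sup>2)
      \<le> norm (2 * (indicator disk z *\<^sub>R (cmod (f z))\<^sup>2) + 2 * (indicator disk z *\<^sub>R (cmod (g z))\<^sup>2))"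
      using le by (intro AE_I2) (auto simp: indicator_def)
  qed
  then show ?thesis
    using f g by (auto simp: bergman_functions_def intro: holomorphic_intros)
qed

lemma bergman_functions_bounded_mult:
  assumes f: "f holomorphic_on disk" "bounded (f ` disk)" and h: "h \<in> bergman_functions"
  shows "(\<lambda>z. f z * h z) \<in> bergman_functions"
proof -
  obtain B where B: "\<And>z. z \<in> disk \<Longrightarrow> cmod (f z) \<le> B"
    using f(2) unfolding bounded_iff by blast
  have hol: "(\<lambda>z. f z * h z) holomorphic_on disk" and ext: "\<forall>z. z \<notin> disk \<longrightarrow> f z * h z = 0"
    using f(1) h by (auto simp: bergman_functions_def intro: holomorphic_intros)
  have m: "(\<lambda>z. f z * h z) \<in> borel_measurable borel"
    using hol ext by (rule holomorphic_disk_measurable)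
  have "set_integrable lborel disk (\<lambda>z. (cmod (f z * h z))\<^sup>2)"
    unfolding set_integrable_def
  proof (rule Bochner_Integration.integrable_bound)
    show "integrable lborel (\<lambda>z. B\<^sup>2 * (indicator disk z *\<^sub>R (cmod (h z))\<^sup>2))"
      using h by (intro integrable_mult_right) (auto simp: bergman_functions_def set_integrable_def)
    show "(\<lambda>z. indicator disk z *\<^sub>R (cmod (f z * h z))\<^sup>2) \<in> borel_measurable lborel"
      using m by (intro borel_measurable_scaleR borel_measurable_power borel_measurable_norm
          borel_measurable_indicator) auto
    show "AE z in lborel. norm (indicator disk z *\<^sub>R (cmod (f z * h z))\<^sup>2)
      \<le> norm (B\<^sup>2 * (indicator disk z *\<^sub>R (cmod (h z))\<^sup>2))"
      using B by (intro AE_I2)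
        (auto simp: indicator_def norm_mult power_mult_distrib intro!: mult_right_mono power_mono)
  qed
  with hol ext show ?thesis by (auto simp: bergman_functions_def)
qed

lemma bergman_functions_cmult: "f \<in> bergman_functions \<Longrightarrow> (\<lambda>z. c * f z) \<in> bergman_functions"
  by (rule bergman_functions_bounded_mult) (auto intro: finite_imp_bounded finite_subset[of _ "{c}"])

lemma bergman_functions_norm_eq_0:
  assumes f: "f \<in> bergman_functions" and 0: "(LINT z:disk|lborel. (cmod (f z))\<^sup>2) = 0"
  shows "f = (\<lambda>_. 0)"
proof -
  have ae: "AE z in lborel. indicator disk z *\<^sub>R (cmod (f z))\<^sup>2 = 0"
    using f 0 integral_nonneg_eq_0_iff_AE[of lborel "\<lambda>z. indicator disk z *\<^sub>R (cmod (f z))\<^sup>2"]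
    by (auto simp: bergman_functions_def set_integrable_def set_lebesgue_integral_def)
  define U where "U = {z \<in> disk. f z \<noteq> 0}"
  have "continuous_on disk f"
    using f by (auto simp: bergman_functions_def intro: holomorphic_on_imp_continuous_on)
  then have "open (disk \<inter> f -` (- {0}))"
    by (rule continuous_open_preimage) auto
  moreover have "disk \<inter> f -` (- {0}) = U"
    by (auto simp: U_def)
  ultimately have "open U" by simp
  have "AE z in lborel. z \<notin> U"
    using ae by eventually_elim (auto simp: U_def indicator_def split: if_splits)
  then have "U \<in> null_sets lborel"
    using \<open>open U\<close> by (subst AE_iff_null_sets) auto
  then have "negligible U"
    by (simp add: negligible_iff_null_sets null_sets_completionI)
  with \<open>open U\<close> have "U = {}"
    using open_not_negligible by blast
  with f show ?thesis
    by (auto simp: U_def bergman_functions_def fun_eq_iff)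
qed

typedef bergman = bergman_functions
  using bergman_functions_zero by blast

setup_lifting type_definition_bergman

instantiation bergman :: ab_group_add
begin
lift_definition zero_bergman :: bergman is "\<lambda>_. 0"
  by (rule bergman_functions_zero)
lift_definition plus_bergman :: "bergman \<Rightarrow> bergman \<Rightarrow> bergman" is "\<lambda>f g z. f z + g z"
  by (rule bergman_functions_add)
lift_definition uminus_bergman :: "bergman \<Rightarrow> bergman" is "\<lambda>f z. - f z"
  using bergman_functions_cmult[where c = "-1"] by simp
lift_definition minus_bergman :: "bergman \<Rightarrow> bergman \<Rightarrow> bergman" is "\<lambda>f g z. f z - g z"
  using bergman_functions_add bergman_functions_cmult[where c = "-1"] by fastforce
instance
  by standard (transfer; simp add: fun_eq_iff)+
end

lift_definition cscale :: "complex \<Rightarrow> bergman \<Rightarrow> bergman" is "\<lambda>c f z. c * f z"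
  by (rule bergman_functions_cmult)

global_interpretation bergman: vector_space cscale
  by unfold_locales (transfer; simp add: fun_eq_iff algebra_simps)+

lift_definition cinner :: "bergman \<Rightarrow> bergman \<Rightarrow> complex"
  is "\<lambda>f g. LINT z:disk|lborel. f z * cnj (g z)" .

lemma cinner_commute: "cinner f g = cnj (cinner g f)"
proof transfer
  fix f g :: "complex \<Rightarrow> complex"
  have "cnj (LINT z:disk|lborel. g z * cnj (f z)) = (LINT z:disk|lborel. cnj (g z * cnj (f z)))"
    unfolding set_lebesgue_integral_def by (subst Bochner_Integration.integral_cnj[symmetric]) simp
  then show "(LINT z:disk|lborel. f z * cnj (g z)) = cnj (LINT z:disk|lborel. g z * cnj (f z))"
    by (simp add: mult.commute)
qed

lemma cinner_add_left: "cinner (f + g) h = cinner f h + cinner g h"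
proof transfer
  fix f g h
  assume "f \<in> bergman_functions" "g \<in> bergman_functions" "h \<in> bergman_functions"
  then show "(LINT z:disk|lborel. (f z + g z) * cnj (h z)) =
      (LINT z:disk|lborel. f z * cnj (h z)) + (LINT z:disk|lborel. g z * cnj (h z))"
    by (subst set_integral_add(2)[symmetric])
      (auto simp: bergman_functions_product_integrable distrib_right)
qed

lemma cinner_cscale_left: "cinner (cscale c f) g = c * cinner f g"
  by transfer (simp add: mult.assoc)

lemma cinner_self: "cinner f f = of_real (LINT z:disk|lborel. (cmod (Rep_bergman f z))\<^sup>2)"
proof -
  have "cinner f f = (LINT z:disk|lborel. of_real ((cmod (Rep_bergman f z))\<^sup>2))"
    by (simp only: cinner.rep_eq complex_norm_square)
  then show ?thesis
    by (simp only: set_integral_complex_of_real)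
qed

text \<open>
  The real Hilbert space structure underlying the complex one; \<open>norm\<close>, the topology and, through
  the instance for \<^type>\<open>vec\<close>, the Hilbert space direct sums are derived from it.
\<close>

instantiation bergman :: real_vector
begin
definition scaleR_bergman :: "real \<Rightarrow> bergman \<Rightarrow> bergman"
  where "scaleR_bergman c f = cscale (of_real c) f"
instance
  by standard
    (simp_all add: scaleR_bergman_def bergman.scale_left_distrib bergman.scale_right_distrib)
end

instantiation bergman :: real_inner
begin
definition inner_bergman :: "bergman \<Rightarrow> bergman \<Rightarrow> real"
  where "inner_bergman f g = Re (cinner f g)"
definition norm_bergman :: "bergman \<Rightarrow> real"
  where "norm_bergman f = sqrt (inner f f)"
definition sgn_bergman :: "bergman \<Rightarrow> bergman"
  where "sgn_bergman f = f /\<^sub>R norm f"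
definition dist_bergman :: "bergman \<Rightarrow> bergman \<Rightarrow> real"
  where "dist_bergman f g = norm (f - g)"
definition uniformity_bergman :: "(bergman \<times> bergman) filter"
  where "uniformity_bergman = (INF e\<in>{0<..}. principal {(f, g). dist f g < e})"
definition open_bergman :: "bergman set \<Rightarrow> bool"
  where "open_bergman U \<longleftrightarrow> (\<forall>f\<in>U. eventually (\<lambda>(f', g). f' = f \<longrightarrow> g \<in> U) uniformity)"
instance
proof
  fix f g h :: bergman and a :: real
  show "inner f g = inner g f"
    unfolding inner_bergman_def by (subst cinner_commute) simp
  show "inner (f + g) h = inner f h + inner g h"
    by (simp add: inner_bergman_def cinner_add_left)
  show "inner (a *\<^sub>R f) g = a * inner f g"
    by (simp add: inner_bergman_def scaleR_bergman_def cinner_cscale_left)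
  show "0 \<le> inner f f"
    by (simp add: inner_bergman_def cinner_self set_lebesgue_integral_def)
  show "inner f f = 0 \<longleftrightarrow> f = 0"
  proof
    assume "inner f f = 0"
    then have "Rep_bergman f = (\<lambda>_. 0)"
      by (intro bergman_functions_norm_eq_0 Rep_bergman) (simp add: inner_bergman_def cinner_self)
    then show "f = 0"
      by (simp add: zero_bergman.rep_eq flip: Rep_bergman_inject)
  next
    assume "f = 0"
    then show "inner f f = 0"
      by (simp add: inner_bergman_def cinner_self zero_bergman.rep_eq set_lebesgue_integral_def)
  qed
qed (simp_all add: norm_bergman_def sgn_bergman_def dist_bergman_def uniformity_bergman_def open_bergman_def)
end


section \<open>Operators and the weak-* topology\<close>

definition bounded_operators :: "(bergman \<Rightarrow> bergman) set"
  where "bounded_operators = {T. bounded_linear T \<and> Vector_Spaces.linear cscale cscale T}"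

text \<open>
  Every trace class operator has the form \<open>S = (\<Sum>k. x k \<otimes> y k\<^sup>*)\<close> with square summable sequences of
  vectors \<open>x\<close> and \<open>y\<close>, and conversely every such sum is trace class. Hence the functionals
  \<open>T \<mapsto> tr (T S)\<close> in the predual are exactly the following ones.
\<close>

definition trace_functional ::
    "(nat \<Rightarrow> bergman) \<Rightarrow> (nat \<Rightarrow> bergman) \<Rightarrow> (bergman \<Rightarrow> bergman) \<Rightarrow> complex"
  where "trace_functional x y T = (\<Sum>k. cinner (T (x k)) (y k))"

definition weak_star_topology :: "(bergman \<Rightarrow> bergman) topology"
  where "weak_star_topology = topology_generated_by
    {{T \<in> bounded_operators. trace_functional x y T \<in> U} | x y U.
       summable (\<lambda>k. (norm (x k))\<^sup>2) \<and> summable (\<lambda>k. (norm (y k))\<^sup>2) \<and> open U}"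

lemma topspace_weak_star: "topspace weak_star_topology = bounded_operators"
proof -
  have "bounded_operators \<in> {{T \<in> bounded_operators. trace_functional x y T \<in> U} | x y U.
       summable (\<lambda>k. (norm (x k))\<^sup>2) \<and> summable (\<lambda>k. (norm (y k))\<^sup>2) \<and> open U}"
    by (intro CollectI exI[of _ "\<lambda>_. 0"] exI[of _ UNIV]) auto
  then show ?thesis
    unfolding weak_star_topology_def topology_generated_by_topspace by blast
qed

text \<open>Existence and uniqueness hold for closed subspaces, by completeness of the Bergman space.\<close>

definition proj :: "bergman set \<Rightarrow> bergman \<Rightarrow> bergman"
  where "proj N f = (THE g. g \<in> N \<and> (\<forall>h\<in>N. cinner (f - g) h = 0))"

text \<open>
  The operator between direct sums that is given by a matrix of operators. The tensor product of
  \<open>\<complex>\<^sup>r\<close> and the Bergman space is the direct sum of \<open>r\<close> copies of the latter, on which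
  \<open>C \<otimes> T\<close> is the matrix with the entries \<open>C\<^sub>a\<^sub>b T\<close>.
\<close>

definition block_op :: "('m \<Rightarrow> 'n \<Rightarrow> 'a \<Rightarrow> 'a::comm_monoid_add) \<Rightarrow> 'a ^ 'n \<Rightarrow> 'a ^ 'm"
  where "block_op B x = (\<chi> i. \<Sum>j\<in>UNIV. B i j (x $ j))"

definition tensor_op ::
    "complex ^ 'r ^ 'r \<Rightarrow> (bergman \<Rightarrow> bergman) \<Rightarrow> bergman ^ 'r \<Rightarrow> bergman ^ 'r"
  where "tensor_op C T = block_op (\<lambda>a b h. cscale (C $ a $ b) (T h))"

definition cinner_sum :: "bergman ^ 'r ^ 'n \<Rightarrow> bergman ^ 'r ^ 'n \<Rightarrow> complex"
  where "cinner_sum x y = (\<Sum>i\<in>UNIV. \<Sum>a\<in>UNIV. cinner (x $ i $ a) (y $ i $ a))"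

definition positive_semidefinite :: "(bergman ^ 'r ^ 'n \<Rightarrow> bergman ^ 'r ^ 'n) \<Rightarrow> bool"
  where "positive_semidefinite T \<longleftrightarrow> (\<forall>x. cinner_sum (T x) x \<in> \<real>\<^sub>\<ge>\<^sub>0)"

definition conj_transpose :: "complex ^ 'r ^ 'r \<Rightarrow> complex ^ 'r ^ 'r"
  where "conj_transpose C = map_matrix cnj (transpose C)"


section \<open>Dual algebras of multipliers\<close>

definition hinf :: "(complex \<Rightarrow> complex) set"
  where "hinf = {f. f holomorphic_on disk \<and> bounded (f ` disk) \<and> (\<forall>z. z \<notin> disk \<longrightarrow> f z = 0)}"

definition mult_op :: "(complex \<Rightarrow> complex) \<Rightarrow> bergman \<Rightarrow> bergman"
  where "mult_op f h = Abs_bergman (\<lambda>z. f z * Rep_bergman h z)"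

lemma Rep_mult_op: "f \<in> hinf \<Longrightarrow> Rep_bergman (mult_op f h) = (\<lambda>z. f z * Rep_bergman h z)"
  unfolding mult_op_def hinf_def
  by (intro Abs_bergman_inverse bergman_functions_bounded_mult Rep_bergman) auto

text \<open>The indicator function of the disk is the unit of \<^const>\<open>hinf\<close>.\<close>

definition dual_subalgebra :: "(complex \<Rightarrow> complex) set \<Rightarrow> bool"
  where "dual_subalgebra A \<longleftrightarrow>
    A \<subseteq> hinf \<and> indicator disk \<in> A \<and>
    (\<forall>f\<in>A. \<forall>g\<in>A. (\<lambda>z. f z + g z) \<in> A) \<and>
    (\<forall>f\<in>A. \<forall>g\<in>A. (\<lambda>z. f z * g z) \<in> A) \<and>
    (\<forall>c. \<forall>f\<in>A. (\<lambda>z. c * f z) \<in> A) \<and>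
    closedin weak_star_topology (mult_op ` A)"

definition separates :: "(complex \<Rightarrow> complex) set \<Rightarrow> complex set \<Rightarrow> bool"
  where "separates A E \<longleftrightarrow> (\<forall>z\<in>E. \<forall>w\<in>E. z \<noteq> w \<longrightarrow> (\<exists>f\<in>A. f z \<noteq> f w))"

definition vanishing_ideal :: "(complex \<Rightarrow> complex) set \<Rightarrow> complex \<Rightarrow> (complex \<Rightarrow> complex) set"
  where "vanishing_ideal A z = {f \<in> A. f z = 0}"

definition Lat :: "(complex \<Rightarrow> complex) set \<Rightarrow> bergman set set"
  where "Lat A = {L. closed L \<and> bergman.subspace L \<and> (\<forall>f\<in>A. mult_op f ` L \<subseteq> L)}"

definition ominus_ideal :: "bergman set \<Rightarrow> (complex \<Rightarrow> complex) set \<Rightarrow> bergman set"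
  where "ominus_ideal L J = {h \<in> L. \<forall>g\<in>J. \<forall>x\<in>L. cinner h (mult_op g x) = 0}"

definition matrices_over :: "(complex \<Rightarrow> complex) set \<Rightarrow> ((complex \<Rightarrow> complex) ^ 'r ^ 'r) set"
  where "matrices_over A = {F. \<forall>a b. F $ a $ b \<in> A}"

definition eval_matrix :: "(complex \<Rightarrow> complex) ^ 'r ^ 'r \<Rightarrow> complex \<Rightarrow> complex ^ 'r ^ 'r"
  where "eval_matrix F z = map_matrix (\<lambda>f. f z) F"

definition mult_norm :: "(complex \<Rightarrow> complex) ^ 'r ^ 'r \<Rightarrow> real"
  where "mult_norm F = onorm (block_op (\<lambda>a b. mult_op (F $ a $ b)))"

end

theory Submission
  imports Defs "HOL-Complex_Analysis.Great_Picard"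
begin

text \<open>
  Write \<open>N\<^sub>i\<close> for \<open>L \<ominus> \<JJ>\<^sub>i L\<close>. The positivity condition for \<open>L\<close> says that the map sending a sum of vectors
  \<open>h\<^sub>i\<close> in \<open>\<complex>\<^sup>r \<otimes> N\<^sub>i\<close> to the sum of the \<open>W\<^sub>i\<^sup>* h\<^sub>i\<close> is a contraction
  (\<open>positive_semidefinite_iff_adjoint_contractive\<close>). It is necessary because this map is a restriction of the
  adjoint of multiplication by \<open>F\<close>, compressed to \<open>\<complex>\<^sup>r \<otimes> L\<close>, for every interpolating \<open>F\<close>
  (\<open>interpolant_imp_adjoint_contractive\<close>).

  Sufficiency is proved by duality. The matrices over \<open>\<AA>\<close> with supremum norm at most 1 form a compact convex
  set \<open>B\<close> in the Bergman norm: Montel's theorem gives limits, and weak-* closedness keeps them in \<open>\<AA>\<close>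
  (\<open>compact_multiplier_ball\<close>). If the values \<open>W\<close> are not attained on \<open>B\<close>, some real functional \<open>\<psi>\<close> that depends
  only on the values at the points is at most \<open>c\<close> on \<open>B\<close>, but larger than \<open>c\<close> at \<open>W\<close>. Now \<open>\<psi>\<close> has on \<open>B\<close> the form
  \<open>\<psi> F = Re \<langle>F x, y\<rangle>\<close> with vectors \<open>x\<close> and \<open>y\<close> whose norms are as close to \<open>\<surd>c\<close> as desired
  (\<open>functional_factorization\<close>). Let \<open>L\<close> be the invariant subspace generated by the entries of \<open>x\<close>, and project \<open>y\<close>
  to it. As \<open>\<psi>\<close> vanishes on the matrices that vanish at the points, the projection is a sum of vectors of
  \<open>\<complex>\<^sup>r \<otimes> N\<^sub>i\<close>. The contraction property for this \<open>L\<close> then bounds \<open>\<psi>\<close> by \<open>\<parallel>x\<parallel> \<parallel>y\<parallel>\<close> at every matrix over \<open>\<AA>\<close> with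
  the values \<open>W\<close> (\<open>matrix_form_le_of_contractive\<close>), and \<open>\<parallel>x\<parallel> \<parallel>y\<parallel>\<close> is as close to \<open>c\<close> as desired.

  The factorization is the point where the Bergman space enters. The norm of \<open>F\<close> is the supremum of the point
  evaluations \<open>\<bar>\<langle>F(\<lambda>) u, v\<rangle>\<bar>\<close> over unit vectors, hence by a bipolar argument \<open>\<psi>\<close> is approximated on \<open>B\<close> by
  convex combinations of point evaluations, multiplied by \<open>c\<close>. An evaluation is approximately of the form
  \<open>\<langle>F (u \<otimes> g), v \<otimes> g\<rangle>\<close>, where \<open>g\<close> is a normalized multiple of \<open>z\<^sup>m / (1 - cnj \<lambda> z)\<close>. For large \<open>m\<close> the mass of \<open>g\<close> lies
  close to the circle, and the product of \<open>g\<close> with any fixed function is small in the \<open>L\<^sup>1\<close> norm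
  (\<open>peak_vector_exists\<close>). Therefore the vectors for finitely many evaluations can be added one after another
  with negligible interaction, and the squares of their norms add up. Repeating this with the remainder in
  place of \<open>\<psi>\<close> gives convergent series for \<open>x\<close> and \<open>y\<close> and removes the error.
\<close>

section \<open>Integration of power series over disks\<close>

lemma lborel_complex_eq_distr:
  "(lborel :: complex measure) = distr lborel borel (\<lambda>(x, y). Complex x y)"
proof (rule lborel_eqI)
  have cont: "continuous_on UNIV (\<lambda>(x, y). Complex x y)"
    by (simp add: case_prod_beta Complex_eq continuous_intros)
  then have [measurable]: "(\<lambda>(x, y). Complex x y) \<in> borel_measurable borel"
    by (rule borel_measurable_continuous_onI)
  fix l u :: complex
  assume le: "\<And>b. b \<in> Basis \<Longrightarrow> l \<bullet> b \<le> u \<bullet> b"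
  have "Re l \<le> Re u" "Im l \<le> Im u"
    using le[of 1] le[of \<i>] by (auto simp: Basis_complex_def inner_complex_def)
  moreover have "(\<lambda>(x, y). Complex x y) -` box l u = box (Re l, Im l) (Re u, Im u)"
    by (auto simp: box_def Basis_complex_def inner_complex_def Basis_prod_def)
  ultimately show "emeasure (distr lborel borel (\<lambda>(x, y). Complex x y)) (box l u) =
      (\<Prod>b\<in>Basis. (u - l) \<bullet> b)"
    by (simp add: emeasure_distr emeasure_lborel_box_eq Basis_prod_def Basis_complex_def
        inner_complex_def)
qed simp

text \<open>
  On every horizontal line the shear is a translation, so that Fubini's theorem reduces the claim to
  the translation invariance of the Lebesgue measure on the line.
\<close>

lemma lborel_distr_shear_fst:
  "distr lborel borel (\<lambda>(x, y). (x + t * y, y)) = (lborel :: (real \<times> real) measure)"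
proof (rule measure_eqI)
  fix A assume "A \<in> sets (distr lborel borel (\<lambda>(x::real, y::real). (x + t * y, y)))"
  then have A: "A \<in> sets borel" by simp
  have [measurable]: "(\<lambda>(x::real, y::real). (x + t * y, y)) \<in> borel_measurable borel"
    by (intro borel_measurable_continuous_onI) (simp add: case_prod_beta continuous_intros)
  have A': "A \<in> sets (lborel \<Otimes>\<^sub>M lborel)"
    using A unfolding lborel_prod by simp
  have B': "(\<lambda>(x, y). (x + t * y, y)) -` A \<in> sets (lborel \<Otimes>\<^sub>M (lborel :: real measure))"
    using measurable_sets_borel[OF _ A, of "\<lambda>(x::real, y::real). (x + t * y, y)"]
    unfolding lborel_prod by simp
  have "emeasure (distr lborel borel (\<lambda>(x, y). (x + t * y, y))) A
      = emeasure (lborel \<Otimes>\<^sub>M lborel) ((\<lambda>(x, y). (x + t * y, y)) -` A)"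
    using A by (simp add: emeasure_distr lborel_prod)
  also have "\<dots> = (\<integral>\<^sup>+ y. emeasure lborel ((\<lambda>x. (x, y)) -` ((\<lambda>(x, y). (x + t * y, y)) -` A)) \<partial>lborel)"
    using B' by (rule lborel_pair.emeasure_pair_measure_alt2)
  also have "\<dots> = (\<integral>\<^sup>+ y. emeasure lborel ((\<lambda>x. (x, y)) -` A) \<partial>lborel)"
  proof (rule nn_integral_cong)
    fix y :: real
    have m: "(\<lambda>x. (x, y)) -` A \<in> sets borel"
      using A by (rule measurable_sets_borel[rotated]) simp
    have "emeasure lborel ((\<lambda>x. (x, y)) -` A) = emeasure (distr lborel borel ((+) (t * y))) ((\<lambda>x. (x, y)) -` A)"
      by (simp add: lborel_distr_plus)
    also have "\<dots> = emeasure lborel ((\<lambda>x. (x, y)) -` ((\<lambda>(x, y). (x + t * y, y)) -` A))"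
      using m by (simp add: emeasure_distr vimage_def add.commute)
    finally show "emeasure lborel ((\<lambda>x. (x, y)) -` ((\<lambda>(x, y). (x + t * y, y)) -` A))
      = emeasure lborel ((\<lambda>x. (x, y)) -` A)" ..
  qed
  also have "\<dots> = emeasure lborel A"
    using lborel_pair.emeasure_pair_measure_alt2[OF A'] by (simp add: lborel_prod)
  finally show "emeasure (distr lborel borel (\<lambda>(x, y). (x + t * y, y))) A = emeasure lborel A" .
qed simp

lemma lborel_distr_shear_snd:
  "distr lborel borel (\<lambda>(x, y). (x, y + t * x)) = (lborel :: (real \<times> real) measure)"
proof -
  define swap :: "real \<times> real \<Rightarrow> real \<times> real" where "swap = (\<lambda>(x, y). (y, x))"
  define S :: "real \<times> real \<Rightarrow> real \<times> real" where "S = (\<lambda>(x, y). (x + t * y, y))"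
  have [measurable]: "swap \<in> borel_measurable borel" "S \<in> borel_measurable borel"
    by (intro borel_measurable_continuous_onI;
        simp add: swap_def S_def case_prod_beta continuous_intros)+
  have swap: "distr lborel borel swap = lborel"
    using lborel_pair.distr_pair_swap[where ?'a = real and ?'b = real]
    unfolding swap_def lborel_prod by (metis distr_cong sets_lborel)
  have "(\<lambda>(x, y). (x, y + t * x)) = swap \<circ> (S \<circ> swap)"
    by (auto simp: swap_def S_def fun_eq_iff)
  then have "distr lborel borel (\<lambda>(x, y). (x, y + t * x)) = distr (distr (distr lborel borel swap) borel S) borel swap"
    by (simp add: distr_distr comp_assoc)
  then show ?thesis
    by (simp add: swap S_def lborel_distr_shear_fst)
qed

text \<open>
  Every rotation except the half-turn is a product of two horizontal shears and a vertical one between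
  them.
\<close>

lemma lborel_distr_rotation:
  fixes \<omega> :: complex
  assumes \<omega>: "cmod \<omega> = 1" "\<omega> \<noteq> -1"
  shows "distr lborel borel ((*) \<omega>) = lborel"
proof -
  define a b where "a = Re \<omega>" and "b = Im \<omega>"
  have ab: "a\<^sup>2 + b\<^sup>2 = 1"
    using \<omega>(1) by (simp add: a_def b_def cmod_def)
  have "a \<noteq> -1"
  proof
    assume "a = -1"
    then have "b = 0" using ab by simp
    then show False using \<open>a = -1\<close> \<omega>(2) by (simp add: a_def b_def complex_eq_iff)
  qed
  define t where "t = - (b / (1 + a))"
  have t: "t * (1 + a) = - b"
    using \<open>a \<noteq> -1\<close> by (simp add: t_def)
  have "(1 + b * t) * (1 + a) = a * (1 + a)"
    using ab t by algebra
  then have bt: "1 + b * t = a"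
    using \<open>a \<noteq> -1\<close> by simp
  define S1 S2 :: "real \<times> real \<Rightarrow> real \<times> real"
    where "S1 = (\<lambda>(x, y). (x + t * y, y))" and "S2 = (\<lambda>(x, y). (x, y + b * x))"
  define C where "C = (\<lambda>(x, y). Complex x y)"
  have [measurable]: "S1 \<in> borel_measurable borel" "S2 \<in> borel_measurable borel"
    "C \<in> borel_measurable borel"
    by (intro borel_measurable_continuous_onI;
        simp add: S1_def S2_def C_def case_prod_beta Complex_eq continuous_intros)+
  have rot: "\<omega> * C p = C (S1 (S2 (S1 p)))" for p
  proof -
    obtain x y where p: "p = (x, y)" by fastforce
    have "x + t * y + t * (y + b * (x + t * y)) = a * x - b * y"
      using t bt by algebra
    moreover have "y + b * (x + t * y) = a * y + b * x"
      unfolding bt[symmetric] by (simp add: algebra_simps)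
    ultimately show ?thesis
      unfolding p by (simp add: S1_def S2_def C_def complex_eq_iff flip: a_def b_def)
  qed
  have "distr lborel borel ((*) \<omega>) = distr (distr lborel borel C) borel ((*) \<omega>)"
    unfolding C_def by (subst lborel_complex_eq_distr) simp
  also have "\<dots> = distr lborel borel (C \<circ> (S1 \<circ> (S2 \<circ> S1)))"
    by (subst distr_distr) (auto simp: comp_def rot)
  also have "\<dots> = distr (distr (distr (distr lborel borel S1) borel S2) borel S1) borel C"
    by (simp add: distr_distr comp_assoc)
  also have "\<dots> = distr lborel borel C"
    unfolding S1_def S2_def lborel_distr_shear_fst lborel_distr_shear_snd ..
  also have "\<dots> = lborel"
    unfolding C_def by (rule lborel_complex_eq_distr[symmetric])
  finally show ?thesis .
qed

lemma set_integral_ball_rotation: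
  fixes f :: "complex \<Rightarrow> complex"
  assumes f: "f \<in> borel_measurable borel" and \<omega>: "cmod \<omega> = 1" "\<omega> \<noteq> -1"
  shows "(LINT z:ball 0 r|lborel. f (\<omega> * z)) = (LINT z:ball 0 r|lborel. f z)"
proof -
  have "(LINT z:ball 0 r|lborel. f z)
      = (LINT z|distr lborel borel ((*) \<omega>). indicator (ball 0 r) z *\<^sub>R f z)"
    by (simp add: set_lebesgue_integral_def lborel_distr_rotation[OF \<omega>])
  also have "\<dots> = (LINT z|lborel. indicator (ball 0 r) (\<omega> * z) *\<^sub>R f (\<omega> * z))"
    using f by (intro integral_distr borel_measurable_scaleR borel_measurable_indicator) auto
  also have "(\<lambda>z. indicator (ball 0 r) (\<omega> * z) *\<^sub>R f (\<omega> * z))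
      = (\<lambda>z. indicator (ball 0 r) z *\<^sub>R f (\<omega> * z))"
    using \<omega>(1) by (auto simp: indicator_def norm_mult)
  finally show ?thesis
    by (simp add: set_lebesgue_integral_def)
qed

lemma set_integral_ball_monomials:
  assumes "j \<noteq> k"
  shows "(LINT z:ball 0 r|lborel. z ^ j * cnj z ^ k) = 0"
proof -
  define d where "d = real j - real k"
  have "d \<noteq> 0" using assms by (simp add: d_def)
  \<comment> \<open>A rotation that multiplies the integrand by \<open>\<i>\<close>.\<close>
  define \<theta> where "\<theta> = pi / (2 * d)"
  define \<omega> where "\<omega> = cis \<theta>"
  have w: "cmod \<omega> = 1" by (simp add: \<omega>_def)
  have "\<omega> ^ j * cnj \<omega> ^ k = cis (\<theta> * d)"
    by (simp add: \<omega>_def cis_cnj Complex.DeMoivre cis_mult d_def algebra_simps)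
  also have "\<dots> = \<i>" using \<open>d \<noteq> 0\<close> by (simp add: \<theta>_def cis_pi_half)
  finally have i: "\<omega> ^ j * cnj \<omega> ^ k = \<i>" .
  have n: "\<omega> \<noteq> -1"
  proof
    assume "\<omega> = -1"
    with i have "(-1) ^ (j + k) = \<i>" by (simp add: power_add)
    then show False by (cases "even (j + k)") (auto simp: complex_eq_iff)
  qed
  have "(LINT z:ball 0 r|lborel. z ^ j * cnj z ^ k)
      = (LINT z:ball 0 r|lborel. (\<omega> * z) ^ j * cnj (\<omega> * z) ^ k)"
    by (rule set_integral_ball_rotation[OF _ w n, symmetric])
      (intro borel_measurable_continuous_onI continuous_intros)
  also have "\<dots> = (LINT z:ball 0 r|lborel. (\<omega> ^ j * cnj \<omega> ^ k) * (z ^ j * cnj z ^ k))"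
    by (simp add: power_mult_distrib mult_ac)
  also have "\<dots> = \<i> * (LINT z:ball 0 r|lborel. z ^ j * cnj z ^ k)"
    by (simp add: i)
  finally have "(1 - \<i>) * (LINT z:ball 0 r|lborel. z ^ j * cnj z ^ k) = 0"
    by (simp add: algebra_simps)
  then show ?thesis by (auto simp: complex_eq_iff)
qed

lemma set_integrable_ball_continuous:
  fixes f :: "complex \<Rightarrow> 'a::{banach, second_countable_topology}"
  assumes "continuous_on (cball 0 r) f"
  shows "set_integrable lborel (ball 0 r) f"
proof -
  have "set_integrable lborel (cball 0 r) f"
    unfolding set_integrable_def
    by (rule borel_integrable_compact[OF compact_cball assms])
  then show ?thesis
    by (rule set_integrable_subset) auto
qed

text \<open>
  Dilating the unit disk to the disk of radius \<open>r\<close> multiplies its moment by \<open>r\<^bsup>2n+2\<^esup>\<close>. The next lemma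
  evaluates the moment from this: the moment over the annulus between the two disks is compared with
  the area of the annulus, and \<open>r\<close> tends to 1.
\<close>

lemma set_integral_ball_scale:
  assumes "0 < r"
  shows "(LINT z:ball 0 r|lborel. cmod z ^ (2 * n)) =
    r ^ (2 * n + 2) * (LINT z:disk|lborel. cmod z ^ (2 * n))"
proof -
  have m: "(\<lambda>z::complex. indicator (ball 0 r) z *\<^sub>R cmod z ^ (2 * n)) \<in> borel_measurable borel"
    by (intro borel_measurable_scaleR borel_measurable_indicator borel_measurable_continuous_onI
        continuous_intros) auto
  have "(LINT z:ball 0 r|lborel. cmod z ^ (2 * n))
      = (LINT z|density (distr lborel borel (\<lambda>x. 0 + r *\<^sub>R x)) (\<lambda>_. ennreal (\<bar>r\<bar> ^ DIM(complex))).
          indicator (ball 0 r) z *\<^sub>R cmod z ^ (2 * n))"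
    unfolding set_lebesgue_integral_def
    using assms by (subst (1) lborel_affine[of r 0]) auto
  also have "\<dots> = r\<^sup>2 * (LINT z|distr lborel borel (\<lambda>x. r *\<^sub>R x). indicator (ball 0 r) z *\<^sub>R cmod z ^ (2 * n))"
    using assms m by (subst integral_density) auto
  also have "\<dots> = r\<^sup>2 * (LINT z|lborel. indicator (ball 0 r) (r *\<^sub>R z) *\<^sub>R cmod (r *\<^sub>R z) ^ (2 * n))"
    using m by (subst integral_distr) auto
  also have "(\<lambda>z::complex. indicator (ball 0 r) (r *\<^sub>R z) *\<^sub>R cmod (r *\<^sub>R z) ^ (2 * n))
      = (\<lambda>z. r ^ (2 * n) * (indicator disk z *\<^sub>R cmod z ^ (2 * n)))"
    using assms by (auto simp: indicator_def power_mult_distrib fun_eq_iff)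
  finally show ?thesis
    by (simp add: set_lebesgue_integral_def power_add power2_eq_square)
qed

lemma set_integral_disk_moment:
  "(LINT z:disk|lborel. cmod z ^ (2 * n)) = pi / (n + 1)"
proof -
  define c where "c = (LINT z:disk|lborel. cmod z ^ (2 * n))"
  define q where "q = (\<lambda>r::real. \<Sum>i\<le>n. r ^ (2 * i))"
  have area: "measure lborel (ball (0::complex) r) = pi * r\<^sup>2" if "0 \<le> r" for r
    using that content_ball[of r "0::complex"] by (simp add: unit_ball_vol_2)
  have bounds: "r ^ (2 * n) * pi \<le> c * q r \<and> c * q r \<le> pi" if r: "0 < r" "r < 1" for r
  proof -
    define R where "R = disk - ball (0::complex) r"
    have "emeasure lborel R \<le> emeasure lborel disk"
      by (intro emeasure_mono) (auto simp: R_def)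
    also have "\<dots> < \<infinity>" by (rule emeasure_lborel_ball_finite)
    finally have R: "R \<in> sets lborel" "emeasure lborel R < \<infinity>"
      by (auto simp: R_def)
    have mR: "measure lborel R = pi * (1 - r\<^sup>2)"
      unfolding R_def using r emeasure_lborel_ball_finite[of "0::complex" 1]
      by (subst measure_Diff) (auto simp: area algebra_simps)
    have int: "set_integrable lborel X (\<lambda>z. cmod z ^ (2 * n))"
      if "X \<in> sets lborel" "X \<subseteq> disk" for X
      by (rule set_integrable_subset[OF set_integrable_ball_continuous that])
        (intro continuous_intros)
    have split: "c = (LINT z:ball 0 r|lborel. cmod z ^ (2 * n)) + (LINT z:R|lborel. cmod z ^ (2 * n))"
    proof -
      have sub: "ball 0 r \<subseteq> disk" using r by auto
      have "ball 0 r \<union> R = disk" using sub by (auto simp: R_def)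
      then show ?thesis
        unfolding c_def using set_integral_Un[of "ball 0 r" R lborel "\<lambda>z. cmod z ^ (2 * n)"] sub R(1)
        by (auto simp: R_def int)
    qed
    have up: "(LINT z:R|lborel. cmod z ^ (2 * n)) \<le> (LINT z:R|lborel. 1)"
      using R by (intro set_integral_mono int) (auto simp: R_def set_integrable_def power_le_one)
    have lo: "(LINT z:R|lborel. r ^ (2 * n)) \<le> (LINT z:R|lborel. cmod z ^ (2 * n))"
      using R r by (intro set_integral_mono int) (auto simp: R_def set_integrable_def intro!: power_mono)
    have "(1 - r\<^sup>2) * q r = 1 - (r\<^sup>2) ^ Suc n"
      unfolding q_def power_mult by (simp only: one_diff_power_eq lessThan_Suc_atMost)
    moreover have "(r\<^sup>2) ^ Suc n = r ^ (2 * n + 2)"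
      unfolding power_mult[symmetric] by simp
    moreover have "(LINT z:R|lborel. cmod z ^ (2 * n)) = c * (1 - r ^ (2 * n + 2))"
    proof -
      have "(LINT z:ball 0 r|lborel. cmod z ^ (2 * n)) = c * r ^ (2 * n + 2)"
        unfolding c_def using set_integral_ball_scale[OF r(1), of n] by (simp only: mult.commute)
      then show ?thesis using split unfolding right_diff_distrib mult_1_right by linarith
    qed
    ultimately have "(LINT z:R|lborel. cmod z ^ (2 * n)) = c * q r * (1 - r\<^sup>2)"
      by (simp add: mult_ac)
    moreover have "(LINT z:R|lborel. x) = x * (pi * (1 - r\<^sup>2))" for x :: real
      using R by (simp add: set_lebesgue_integral_def mR[symmetric])
    ultimately have "r ^ (2 * n) * pi * (1 - r\<^sup>2) \<le> c * q r * (1 - r\<^sup>2)" "c * q r * (1 - r\<^sup>2) \<le> pi * (1 - r\<^sup>2)"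
      using lo up by (simp_all add: mult_ac)
    moreover have "0 < 1 - r\<^sup>2" using r by (simp add: power_less_one_iff)
    ultimately show ?thesis by (simp add: mult_le_cancel_right)
  qed
  have q: "(q \<longlongrightarrow> q 1) (at_left 1)"
    unfolding q_def by (intro tendsto_intros)
  have ev: "\<forall>\<^sub>F r in at_left (1::real). 0 < r \<and> r < 1"
    by (auto simp: eventually_at_left_field intro: exI[of _ 0])
  have "1 ^ (2 * n) * pi \<le> c * q 1"
  proof (rule tendsto_le)
    show "((\<lambda>r. c * q r) \<longlongrightarrow> c * q 1) (at_left 1)" by (intro tendsto_intros q)
    show "((\<lambda>r. r ^ (2 * n) * pi) \<longlongrightarrow> 1 ^ (2 * n) * pi) (at_left (1::real))" by (intro tendsto_intros)
    show "\<forall>\<^sub>F r in at_left 1. r ^ (2 * n) * pi \<le> c * q r"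
      using ev by eventually_elim (use bounds in auto)
  qed simp
  moreover have "c * q 1 \<le> pi"
  proof (rule tendsto_upperbound)
    show "((\<lambda>r. c * q r) \<longlongrightarrow> c * q 1) (at_left 1)" by (intro tendsto_intros q)
    show "\<forall>\<^sub>F r in at_left 1. c * q r \<le> pi"
      using ev by eventually_elim (use bounds in auto)
  qed simp
  ultimately have "c * q 1 = pi" by simp
  moreover have "q 1 = n + 1" by (simp add: q_def)
  ultimately show ?thesis unfolding c_def[symmetric] by (simp add: field_simps)
qed

lemma of_real_norm_even_power: "complex_of_real (cmod z ^ (2 * m)) = z ^ m * cnj z ^ m"
  by (simp only: power_mult complex_norm_square power_mult_distrib of_real_power[of "_\<^sup>2"])

text \<open>
  Monomials of different degrees are orthogonal over a disk, for any radial weight. Integrating the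
  Taylor series of \<open>h\<close>, which converges uniformly on the disk, therefore leaves one coefficient.
\<close>

lemma set_integral_ball_taylor_coeff:
  assumes hol: "h holomorphic_on ball 0 R" and r: "0 < r" "r < R"
  shows "(LINT z:ball 0 r|lborel. h z * cnj z ^ k * of_real (cmod z ^ (2 * m))) =
    (deriv ^^ k) h 0 / fact k * of_real (LINT z:ball 0 r|lborel. cmod z ^ (2 * (m + k)))"
proof -
  define a where "a = (\<lambda>n. (deriv ^^ n) h 0 / fact n)"
  define b where "b = (\<lambda>z. cnj z ^ k * of_real (cmod z ^ (2 * m)))"
  define C where "C = pi * r\<^sup>2"
  have area: "measure lborel (ball (0::complex) r) = C"
    using r content_ball[of r "0::complex"] by (simp add: unit_ball_vol_2 C_def)
  have b_eq: "b z = z ^ m * cnj z ^ (m + k)" for z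
    by (simp only: b_def of_real_norm_even_power) (simp add: power_add)
  have cont_b: "continuous_on X b" for X
    unfolding b_def by (intro continuous_intros)
  have b_bound: "cmod (b z) \<le> r ^ (2 * m + k)" if "z \<in> ball 0 r" for z
  proof -
    have "cmod (b z) = cmod z ^ (2 * m + k)"
      by (simp add: b_def norm_mult norm_power power_add mult_ac)
    also have "\<dots> \<le> r ^ (2 * m + k)" using that by (intro power_mono) auto
    finally show ?thesis .
  qed
  have conth: "continuous_on (cball 0 r) h"
    using r by (intro holomorphic_on_imp_continuous_on holomorphic_on_subset[OF hol]) auto
  have poly_int: "(LINT z:ball 0 r|lborel. (\<Sum>n<N. a n * z ^ n) * b z)
      = a k * of_real (LINT z:ball 0 r|lborel. cmod z ^ (2 * (m + k)))" if "k < N" for N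
  proof -
    have int: "set_integrable lborel (ball 0 r) (\<lambda>z. a n * z ^ n * b z)" for n
      by (intro set_integrable_ball_continuous continuous_intros cont_b)
    have "(LINT z:ball 0 r|lborel. (\<Sum>n<N. a n * z ^ n) * b z)
        = (\<Sum>n<N. LINT z:ball 0 r|lborel. a n * z ^ n * b z)"
      unfolding sum_distrib_right set_lebesgue_integral_def scaleR_sum_right
      using int by (intro Bochner_Integration.integral_sum) (auto simp: set_integrable_def)
    also have "\<dots> = (\<Sum>n<N. if n = k then a k * of_real (LINT z:ball 0 r|lborel. cmod z ^ (2 * (m + k))) else 0)"
    proof (rule sum.cong)
      fix n
      have "(LINT z:ball 0 r|lborel. a n * z ^ n * b z)
          = a n * (LINT z:ball 0 r|lborel. z ^ (n + m) * cnj z ^ (m + k))"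
        by (simp add: b_eq power_add mult_ac)
      also have "\<dots> = (if n = k then a k * of_real (LINT z:ball 0 r|lborel. cmod z ^ (2 * (m + k))) else 0)"
      proof (cases "n = k")
        case True
        have "z ^ (k + m) * cnj z ^ (m + k) = of_real (cmod z ^ (2 * (m + k)))" for z
          by (simp only: of_real_norm_even_power add.commute)
        then show ?thesis
          using True by (simp only: set_integral_complex_of_real if_True refl)
      qed (simp add: set_integral_ball_monomials)
      finally show "(LINT z:ball 0 r|lborel. a n * z ^ n * b z) = \<dots>" .
    qed simp
    also have "\<dots> = a k * of_real (LINT z:ball 0 r|lborel. cmod z ^ (2 * (m + k)))"
      using that by simp
    finally show ?thesis .
  qed
  have sums: "(\<lambda>n. a n * (z - 0) ^ n) sums h z" if "z \<in> ball 0 R" for z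
    unfolding a_def using hol that by (rule holomorphic_power_series)
  have "ereal ((r + R) / 2) \<le> conv_radius a"
    using sums_summable[OF sums, of "of_real ((r + R) / 2)"] r
      conv_radius_geI[of a "of_real ((r + R) / 2)"] by (simp add: norm_divide flip: of_real_add)
  then have "ereal r < conv_radius a"
    by (rule less_le_trans[rotated]) (use r in auto)
  then have "uniform_limit (cball 0 r) (\<lambda>N z. \<Sum>n<N. a n * (z - 0) ^ n) (\<lambda>z. \<Sum>n. a n * (z - 0) ^ n) sequentially"
    by (rule powser_uniform_limit)
  then have ul: "uniform_limit (cball 0 r) (\<lambda>N z. \<Sum>n<N. a n * z ^ n) h sequentially"
    using r sums_unique[OF sums, symmetric]
    by (subst (asm) uniform_limit_cong'[where g = "\<lambda>N z. \<Sum>n<N. a n * z ^ n" and i = h]) auto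
  have lim: "(\<lambda>N. LINT z:ball 0 r|lborel. (\<Sum>n<N. a n * z ^ n) * b z)
      \<longlonglongrightarrow> (LINT z:ball 0 r|lborel. h z * b z)"
  proof (rule LIMSEQ_I)
    fix e :: real assume e: "0 < e"
    define e' where "e' = e / (2 * (1 + C * r ^ (2 * m + k)))"
    have C0: "0 \<le> C * r ^ (2 * m + k)" using r by (simp add: C_def)
    have "0 < e'" using e C0 by (simp add: e'_def)
    have e'': "e' * (C * r ^ (2 * m + k)) < e"
    proof -
      have "e' * (C * r ^ (2 * m + k)) \<le> e' * (1 + C * r ^ (2 * m + k))"
        using \<open>0 < e'\<close> by (intro mult_left_mono) auto
      also have "\<dots> = e / 2" unfolding e'_def using C0 by (simp add: field_simps)
      finally show ?thesis using e by simp
    qed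
    from uniform_limitD[OF ul \<open>0 < e'\<close>] obtain N0
      where N0: "\<And>N z. N0 \<le> N \<Longrightarrow> z \<in> cball 0 r \<Longrightarrow> dist (\<Sum>n<N. a n * z ^ n) (h z) < e'"
      unfolding eventually_sequentially by blast
    show "\<exists>N0. \<forall>N\<ge>N0. norm ((LINT z:ball 0 r|lborel. (\<Sum>n<N. a n * z ^ n) * b z)
        - (LINT z:ball 0 r|lborel. h z * b z)) < e"
    proof (intro exI allI impI)
      fix N assume "N0 \<le> N"
      have i1: "set_integrable lborel (ball 0 r) (\<lambda>z. (\<Sum>n<N. a n * z ^ n) * b z)"
        and i2: "set_integrable lborel (ball 0 r) (\<lambda>z. h z * b z)"
        by (intro set_integrable_ball_continuous continuous_intros cont_b conth)+
      have "norm ((LINT z:ball 0 r|lborel. (\<Sum>n<N. a n * z ^ n) * b z) - (LINT z:ball 0 r|lborel. h z * b z))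
          = norm (LINT z:ball 0 r|lborel. ((\<Sum>n<N. a n * z ^ n) - h z) * b z)"
        using set_integral_diff(2)[OF i1 i2] by (simp add: left_diff_distrib)
      also have "\<dots> \<le> (LINT z:ball 0 r|lborel. norm (((\<Sum>n<N. a n * z ^ n) - h z) * b z))"
        using set_integral_diff(1)[OF i1 i2] by (intro set_integral_norm_bound) (simp add: left_diff_distrib)
      also have "\<dots> \<le> (LINT z:ball (0::complex) r|lborel. e' * r ^ (2 * m + k))"
      proof (rule set_integral_mono)
        show "set_integrable lborel (ball 0 r) (\<lambda>z. norm (((\<Sum>n<N. a n * z ^ n) - h z) * b z))"
          using set_integral_diff(1)[OF i1 i2] by (intro set_integrable_norm) (simp add: left_diff_distrib)
        show "set_integrable lborel (ball 0 r) (\<lambda>z::complex. e' * r ^ (2 * m + k))"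
          by (rule set_integrable_ball_continuous) auto
        show "norm (((\<Sum>n<N. a n * z ^ n) - h z) * b z) \<le> e' * r ^ (2 * m + k)" if "z \<in> ball 0 r" for z
          unfolding norm_mult using N0[OF \<open>N0 \<le> N\<close>, of z] that \<open>0 < e'\<close> b_bound[OF that]
          by (intro mult_mono) (auto simp: dist_norm)
      qed
      also have "\<dots> = e' * (C * r ^ (2 * m + k))"
        by (simp add: set_lebesgue_integral_def area)
      finally show "norm ((LINT z:ball 0 r|lborel. (\<Sum>n<N. a n * z ^ n) * b z)
        - (LINT z:ball 0 r|lborel. h z * b z)) < e" using e'' by simp
    qed
  qed
  have "(\<lambda>N. LINT z:ball 0 r|lborel. (\<Sum>n<N. a n * z ^ n) * b z)
      \<longlonglongrightarrow> a k * of_real (LINT z:ball 0 r|lborel. cmod z ^ (2 * (m + k)))"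
    by (rule tendsto_eventually) (auto simp: poly_int eventually_sequentially intro!: exI[of _ "Suc k"])
  from LIMSEQ_unique[OF lim this] show ?thesis
    by (simp add: a_def b_def mult.assoc)
qed

section \<open>Completeness of the Bergman space\<close>

lemma Rep_bergman_holomorphic: "Rep_bergman f holomorphic_on disk"
  using Rep_bergman[of f] by (simp add: bergman_functions_def)

lemma Rep_bergman_outside: "z \<notin> disk \<Longrightarrow> Rep_bergman f z = 0"
  using Rep_bergman[of f] by (simp add: bergman_functions_def)

lemma Rep_bergman_square_integrable: "set_integrable lborel disk (\<lambda>z. (cmod (Rep_bergman f z))\<^sup>2)"
  using Rep_bergman[of f] by (simp add: bergman_functions_def)

lemma Rep_bergman_measurable: "Rep_bergman f \<in> borel_measurable borel"
  by (rule bergman_functions_measurable[OF Rep_bergman])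

lemma Rep_bergman_sum: "Rep_bergman (\<Sum>i\<in>I. f i) z = (\<Sum>i\<in>I. Rep_bergman (f i) z)"
  by (induction I rule: infinite_finite_induct) (simp_all add: zero_bergman.rep_eq plus_bergman.rep_eq)

lemma Rep_bergman_scaleR: "Rep_bergman (c *\<^sub>R f) z = of_real c * Rep_bergman f z"
  by (simp add: scaleR_bergman_def cscale.rep_eq)

lemma bergman_eqI: "(\<And>z. z \<in> disk \<Longrightarrow> Rep_bergman f z = Rep_bergman g z) \<Longrightarrow> f = g"
  by (metis Rep_bergman_inject Rep_bergman_outside ext)

lemma norm_bergman_squared: "(norm f)\<^sup>2 = (LINT z:disk|lborel. (cmod (Rep_bergman f z))\<^sup>2)"
  by (simp add: norm_bergman_def inner_bergman_def cinner_self set_lebesgue_integral_def)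

lemma cinner_self_norm: "cinner f f = of_real ((norm f)\<^sup>2)"
  by (simp only: cinner_self norm_bergman_squared)

lemma cinner_add_right: "cinner f (g + h) = cinner f g + cinner f h"
  by (metis cinner_add_left cinner_commute complex_cnj_add)

lemma cinner_cscale_right: "cinner f (cscale c g) = cnj c * cinner f g"
  by (metis cinner_cscale_left cinner_commute complex_cnj_mult)

lemma cscale_simps [simp]: "cscale 0 f = 0" "cscale c 0 = 0" "cscale 1 f = f" "cscale (- 1) f = - f"
  by (simp_all add: bergman.scale_minus_left)

lemma cinner_zero [simp]: "cinner 0 f = 0" "cinner f 0 = 0"
  using cinner_cscale_left[of 0 f f] cinner_cscale_right[of f 0 f] by simp_all

lemma cinner_minus: "cinner (- f) g = - cinner f g" "cinner f (- g) = - cinner f g"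
  using cinner_cscale_left[of "-1" f g] cinner_cscale_right[of f "-1" g] by simp_all

lemma cinner_diff: "cinner (f - g) h = cinner f h - cinner g h" "cinner f (g - h) = cinner f g - cinner f h"
  using cinner_add_left[of f "- g" h] cinner_add_right[of f g "- h"] by (simp_all add: cinner_minus)

lemma cinner_sum: "cinner (\<Sum>i\<in>I. f i) h = (\<Sum>i\<in>I. cinner (f i) h)"
    "cinner h (\<Sum>i\<in>I. f i) = (\<Sum>i\<in>I. cinner h (f i))"
  by (induction I rule: infinite_finite_induct; simp add: cinner_add_left cinner_add_right)+

lemma norm_cscale: "norm (cscale c f) = cmod c * norm f"
proof -
  have "complex_of_real ((norm (cscale c f))\<^sup>2) = complex_of_real ((cmod c * norm f)\<^sup>2)"
    unfolding cinner_self_norm[symmetric] cinner_cscale_left cinner_cscale_right power_mult_distrib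
    by (simp add: cinner_self_norm complex_norm_square mult_ac flip: of_real_power)
  then have "(norm (cscale c f))\<^sup>2 = (cmod c * norm f)\<^sup>2" by (simp only: of_real_eq_iff)
  then show ?thesis by (rule power2_eq_imp_eq) auto
qed

lemma cinner_Cauchy_Schwarz: "cmod (cinner f g) \<le> norm f * norm g"
proof -
  obtain w where w: "cmod w = 1" "w * cinner f g = of_real (cmod (cinner f g))"
  proof (cases "cinner f g = 0")
    case True then show ?thesis using that[of 1] by simp
  next
    case False
    define c where "c = cinner f g"
    have "cnj c / of_real (cmod c) * c = of_real (cmod c)"
      using False complex_norm_square[of c] by (simp add: c_def power2_eq_square field_simps)
    then show ?thesis using that[of "cnj c / of_real (cmod c)"] False
      by (simp add: c_def norm_divide)
  qed
  have "cmod (cinner f g) = inner (cscale w f) g"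
    by (simp add: inner_bergman_def cinner_cscale_left w)
  also have "\<dots> \<le> norm f * norm g"
    using norm_cauchy_schwarz[of "cscale w f" g] by (simp add: norm_cscale w)
  finally show ?thesis .
qed

lemma Re_cinner: "Re (cinner f g) = inner f g"
  by (simp add: inner_bergman_def)

lemma cinner_inner: "cinner f g = Complex (inner f g) (inner f (cscale \<i> g))"
  by (simp add: complex_eq_iff inner_bergman_def cinner_cscale_right)

lemma bounded_linear_cscale: "bounded_linear (cscale c)"
  by (rule bounded_linear_intro[of _ "cmod c"])
    (simp_all add: bergman.scale_right_distrib scaleR_bergman_def bergman.scale_left_commute norm_cscale mult.commute)

lemma bounded_linear_cinner_left: "bounded_linear (\<lambda>f. cinner f g)"
  by (rule bounded_linear_intro[of _ "norm g"])
    (simp_all add: cinner_add_left scaleR_bergman_def cinner_cscale_left scaleR_conv_of_real cinner_Cauchy_Schwarz)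

text \<open>
  The mean value property of the square of \<open>f\<close>, on the disk around \<open>z\<close> whose radius is half the
  distance to the boundary. It makes convergence in norm locally uniform.
\<close>

lemma norm_Rep_bergman_le:
  assumes z: "z \<in> disk"
  shows "cmod (Rep_bergman f z) * (1 - cmod z) \<le> 2 * norm f"
proof -
  define R where "R = 1 - cmod z"
  define r where "r = R / 2"
  have r: "0 < r" "r < R" using z by (auto simp: R_def r_def)
  define h where "h = (\<lambda>w. (Rep_bergman f (z + w))\<^sup>2)"
  have sub: "z + w \<in> disk" if "w \<in> ball 0 R" for w
    using that norm_triangle_ineq[of z w] by (simp add: R_def)
  have "h holomorphic_on ball 0 R"
    unfolding h_def
    by (intro holomorphic_intros holomorphic_on_compose_gen[OF _ Rep_bergman_holomorphic, unfolded o_def])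
      (use sub[of "x - z" for x] in \<open>auto simp: dist_norm norm_minus_commute\<close>)
  from set_integral_ball_taylor_coeff[OF this r, of 0 0]
  have eq: "(LINT w:ball 0 r|lborel. h w) = h 0 * of_real (measure lborel (ball (0::complex) r))"
    by (simp add: set_lebesgue_integral_def)
  have area: "measure lborel (ball (0::complex) r) = pi * r\<^sup>2"
    using r content_ball[of r "0::complex"] by (simp add: unit_ball_vol_2)
  have int: "set_integrable lborel (ball 0 r) h"
    using r \<open>h holomorphic_on ball 0 R\<close>
    by (intro set_integrable_ball_continuous holomorphic_on_imp_continuous_on)
      (auto elim!: holomorphic_on_subset)
  have m: "(\<lambda>w. indicator (ball z r) w *\<^sub>R (cmod (Rep_bergman f w))\<^sup>2) \<in> borel_measurable borel"
    using Rep_bergman_measurable by (intro borel_measurable_scaleR borel_measurable_indicator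
        borel_measurable_power borel_measurable_norm) auto
  have "cmod (h 0) * (pi * r\<^sup>2) = cmod (LINT w:ball 0 r|lborel. h w)"
    by (simp add: eq area norm_mult norm_power)
  also have "\<dots> \<le> (LINT w:ball 0 r|lborel. cmod (h w))"
    using int by (rule set_integral_norm_bound)
  also have "\<dots> = (LINT w|lborel. indicator (ball z r) (z + w) *\<^sub>R (cmod (Rep_bergman f (z + w)))\<^sup>2)"
    unfolding set_lebesgue_integral_def
    by (intro Bochner_Integration.integral_cong) (auto simp: h_def norm_power indicator_def dist_norm)
  also have "\<dots> = (LINT w|distr lborel borel ((+) z). indicator (ball z r) w *\<^sub>R (cmod (Rep_bergman f w))\<^sup>2)"
    using m by (subst integral_distr) auto
  also have "\<dots> = (LINT w:ball z r|lborel. (cmod (Rep_bergman f w))\<^sup>2)"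
    by (simp add: lborel_distr_plus set_lebesgue_integral_def)
  also have "\<dots> \<le> (LINT w:disk|lborel. (cmod (Rep_bergman f w))\<^sup>2)"
  proof -
    have sub': "ball z r \<subseteq> disk"
    proof
      fix w assume "w \<in> ball z r"
      then show "w \<in> disk"
        using sub[of "w - z"] r by (simp add: dist_norm norm_minus_commute)
    qed
    show ?thesis
      using set_integrable_subset[OF Rep_bergman_square_integrable _ sub', of f]
        Rep_bergman_square_integrable[of f] sub'
      unfolding set_lebesgue_integral_def set_integrable_def
      by (intro integral_mono) (auto simp: indicator_def)
  qed
  also have "\<dots> = (norm f)\<^sup>2" by (rule norm_bergman_squared[symmetric])
  finally have "pi * (cmod (Rep_bergman f z) * r)\<^sup>2 \<le> (norm f)\<^sup>2"
    by (simp add: h_def norm_power power_mult_distrib mult_ac)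
  moreover have "1 * (cmod (Rep_bergman f z) * r)\<^sup>2 \<le> pi * (cmod (Rep_bergman f z) * r)\<^sup>2"
    using pi_gt3 by (intro mult_right_mono) auto
  ultimately have "(cmod (Rep_bergman f z) * r)\<^sup>2 \<le> (norm f)\<^sup>2" by simp
  then have "cmod (Rep_bergman f z) * r \<le> norm f"
    by (rule power2_le_imp_le) simp
  then show ?thesis by (simp add: r_def R_def)
qed

lemma bounded_linear_Rep_bergman: "bounded_linear (\<lambda>f. Rep_bergman f z)"
proof (cases "z \<in> disk")
  case True
  then have z: "cmod z < 1" by simp
  show ?thesis
  proof (rule bounded_linear_intro[of _ "2 / (1 - cmod z)"])
    show "norm (Rep_bergman f z) \<le> norm f * (2 / (1 - cmod z))" for f
      using norm_Rep_bergman_le[OF True, of f] z by (simp add: field_simps)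
  qed (simp_all add: plus_bergman.rep_eq Rep_bergman_scaleR scaleR_conv_of_real)
qed (simp add: Rep_bergman_outside)

lemma Abs_bergman_of_nn_integral:
  assumes hol: "f holomorphic_on disk" and out: "\<forall>z. z \<notin> disk \<longrightarrow> f z = 0"
    and le: "(\<integral>\<^sup>+ z. ennreal ((cmod (f z))\<^sup>2) \<partial>lborel) \<le> ennreal (e\<^sup>2)" and "0 \<le> e"
  shows "f \<in> bergman_functions" "norm (Abs_bergman f) \<le> e"
proof -
  have m: "f \<in> borel_measurable borel" using hol out by (rule holomorphic_disk_measurable)
  have eq: "(\<lambda>z. indicator disk z *\<^sub>R (cmod (f z))\<^sup>2) = (\<lambda>z. (cmod (f z))\<^sup>2)"
    using out by (auto simp: indicator_def fun_eq_iff)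
  have int: "integrable lborel (\<lambda>z. (cmod (f z))\<^sup>2)"
    using m le by (intro integrableI_bounded borel_measurable_power borel_measurable_norm)
      (auto simp: le_less_trans)
  then have "set_integrable lborel disk (\<lambda>z. (cmod (f z))\<^sup>2)"
    unfolding set_integrable_def eq .
  then show f: "f \<in> bergman_functions"
    using hol out by (simp add: bergman_functions_def)
  have "(norm (Abs_bergman f))\<^sup>2 = (LINT z|lborel. (cmod (f z))\<^sup>2)"
    unfolding norm_bergman_squared Abs_bergman_inverse[OF f] set_lebesgue_integral_def eq ..
  also have "\<dots> \<le> e\<^sup>2"
    using le int by (subst (asm) nn_integral_eq_integral) auto
  finally show "norm (Abs_bergman f) \<le> e"
    using \<open>0 \<le> e\<close> by (rule power2_le_imp_le)
qed

lemma nn_integral_Rep_bergman: "(\<integral>\<^sup>+ z. ennreal ((cmod (Rep_bergman f z))\<^sup>2) \<partial>lborel) = ennreal ((norm f)\<^sup>2)"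
proof -
  have eq: "(\<lambda>z. indicator disk z *\<^sub>R (cmod (Rep_bergman f z))\<^sup>2) = (\<lambda>z. (cmod (Rep_bergman f z))\<^sup>2)"
    by (auto simp: indicator_def fun_eq_iff Rep_bergman_outside)
  show ?thesis
    using Rep_bergman_square_integrable[of f]
    unfolding norm_bergman_squared set_lebesgue_integral_def set_integrable_def eq
    by (intro nn_integral_eq_integral) auto
qed

text \<open>
  By the pointwise bound a Cauchy sequence converges locally uniformly, so that its limit is
  holomorphic; Fatou's lemma turns the Cauchy property into convergence in norm to that limit.
\<close>

instance bergman :: complete_space
proof
  fix X :: "nat \<Rightarrow> bergman" assume C: "Cauchy X"
  have unif: "uniformly_convergent_on (cball 0 r) (\<lambda>n. Rep_bergman (X n))" if "r < 1" for r
    unfolding uniformly_convergent_eq_Cauchy[symmetric] 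
  proof (rule Cauchy_uniformly_convergent, rule uniformly_Cauchy_onI)
    fix e :: real assume "0 < e"
    then have "0 < e * (1 - r) / 2" using that by simp
    with C obtain M where M: "\<And>m n. M \<le> m \<Longrightarrow> M \<le> n \<Longrightarrow> dist (X m) (X n) < e * (1 - r) / 2"
      unfolding Cauchy_def by metis
    show "\<exists>M. \<forall>x\<in>cball 0 r. \<forall>m\<ge>M. \<forall>n\<ge>M. dist (Rep_bergman (X m) x) (Rep_bergman (X n) x) < e"
    proof (intro exI ballI allI impI)
      fix x :: complex and m n assume x: "x \<in> cball 0 r" and "M \<le> m" "M \<le> n"
      have "x \<in> disk" using x that by simp
      let ?d = "dist (Rep_bergman (X m) x) (Rep_bergman (X n) x)"
      have "?d * (1 - r) \<le> ?d * (1 - cmod x)"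
        using x by (intro mult_left_mono) auto
      also have "\<dots> \<le> 2 * dist (X m) (X n)"
        using norm_Rep_bergman_le[OF \<open>x \<in> disk\<close>, of "X m - X n"]
        by (simp add: dist_norm minus_bergman.rep_eq)
      also have "\<dots> < e * (1 - r)"
        using M[OF \<open>M \<le> m\<close> \<open>M \<le> n\<close>] by simp
      finally show "?d < e" using that by simp
    qed
  qed
  define g where "g = (\<lambda>z. if z \<in> disk then lim (\<lambda>n. Rep_bergman (X n) z) else 0)"
  have ul: "uniform_limit (cball 0 r) (\<lambda>n. Rep_bergman (X n)) g sequentially" if "r < 1" for r
    using unif[OF that] that unfolding uniformly_convergent_uniform_limit_iff
    by (subst uniform_limit_cong'[where g = "\<lambda>n. Rep_bergman (X n)" and
          i = "\<lambda>z. lim (\<lambda>n. Rep_bergman (X n) z)"]) (auto simp: g_def)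
  have g: "g holomorphic_on disk"
  proof (rule holomorphic_uniform_sequence[OF open_ball Rep_bergman_holomorphic])
    fix x :: complex assume "x \<in> disk"
    define d where "d = (1 - cmod x) / 2"
    have d: "0 < d" "cmod x + d < 1" using \<open>x \<in> disk\<close> by (auto simp: d_def field_simps)
    have sub: "cball x d \<subseteq> cball 0 (cmod x + d)"
    proof
      fix w assume "w \<in> cball x d"
      then show "w \<in> cball 0 (cmod x + d)"
        using norm_triangle_ineq[of x "w - x"] by (simp add: dist_norm norm_minus_commute)
    qed
    show "\<exists>d>0. cball x d \<subseteq> disk \<and> uniform_limit (cball x d) (\<lambda>n. Rep_bergman (X n)) g sequentially"
      using d sub uniform_limit_on_subset[OF ul[OF d(2)] sub] by (intro exI[of _ d]) fastforce
  qed
  have lim: "(\<lambda>n. Rep_bergman (X n) z) \<longlonglongrightarrow> g z" for z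
  proof (cases "z \<in> disk")
    case True
    then show ?thesis using tendsto_uniform_limitI[OF ul[of "cmod z"], of z] by simp
  qed (simp add: g_def Rep_bergman_outside)
  have gout: "\<forall>z. z \<notin> disk \<longrightarrow> g z = 0" by (simp add: g_def)
  have gm: "g \<in> borel_measurable borel" using g gout by (rule holomorphic_disk_measurable)
  have key: "(\<lambda>z. Rep_bergman (X n) z - g z) \<in> bergman_functions \<and>
      norm (Abs_bergman (\<lambda>z. Rep_bergman (X n) z - g z)) \<le> e"
    if e: "0 \<le> e" "\<And>m. N \<le> m \<Longrightarrow> dist (X n) (X m) \<le> e" for n N e
  proof (intro conjI Abs_bergman_of_nn_integral)
    have "(\<integral>\<^sup>+ z. ennreal ((cmod (Rep_bergman (X n) z - g z))\<^sup>2) \<partial>lborel)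
        = (\<integral>\<^sup>+ z. liminf (\<lambda>m. ennreal ((cmod (Rep_bergman (X n) z - Rep_bergman (X m) z))\<^sup>2)) \<partial>lborel)"
      by (intro nn_integral_cong lim_imp_Liminf[symmetric] tendsto_intros lim) simp
    also have "\<dots> \<le> liminf (\<lambda>m. \<integral>\<^sup>+ z. ennreal ((cmod (Rep_bergman (X n) z - Rep_bergman (X m) z))\<^sup>2) \<partial>lborel)"
      using Rep_bergman_measurable
      by (intro nn_integral_liminf measurable_compose[OF _ measurable_ennreal]
          borel_measurable_power borel_measurable_norm borel_measurable_diff) auto
    also have "\<dots> = liminf (\<lambda>m. ennreal ((dist (X n) (X m))\<^sup>2))"
      using nn_integral_Rep_bergman[of "X n - X m" for m] by (simp add: minus_bergman.rep_eq dist_norm)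
    also have "\<dots> \<le> ennreal (e\<^sup>2)"
      by (intro Liminf_le) (auto simp: eventually_sequentially intro!: exI[of _ N] ennreal_leI power_mono e(2))
    finally show "(\<integral>\<^sup>+ z. ennreal ((cmod (Rep_bergman (X n) z - g z))\<^sup>2) \<partial>lborel) \<le> ennreal (e\<^sup>2)" .
    then show "(\<integral>\<^sup>+ z. ennreal ((cmod (Rep_bergman (X n) z - g z))\<^sup>2) \<partial>lborel) \<le> ennreal (e\<^sup>2)" .
  qed (auto intro!: holomorphic_intros Rep_bergman_holomorphic g simp: gout Rep_bergman_outside e(1))
  obtain N1 where N1: "\<And>m n. N1 \<le> m \<Longrightarrow> N1 \<le> n \<Longrightarrow> dist (X m) (X n) < 1"
    using C unfolding Cauchy_def by (metis zero_less_one)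
  have "(\<lambda>z. Rep_bergman (X N1) z - g z) \<in> bergman_functions"
    using key[of 1 N1 N1] N1[of N1] by (auto intro: less_imp_le)
  define G where "G = X N1 - Abs_bergman (\<lambda>z. Rep_bergman (X N1) z - g z)"
  have G: "Rep_bergman G = g"
    unfolding G_def minus_bergman.rep_eq
    by (subst Abs_bergman_inverse) (fact, simp)
  have "X \<longlonglongrightarrow> G"
  proof (rule LIMSEQ_I)
    fix e :: real assume "0 < e"
    then have "0 < e / 2" by simp
    with C obtain N where N: "\<And>m n. N \<le> m \<Longrightarrow> N \<le> n \<Longrightarrow> dist (X m) (X n) < e / 2"
      unfolding Cauchy_def by metis
    have "norm (X n - G) < e" if "N \<le> n" for n
    proof -
      have "X n - G = Abs_bergman (\<lambda>z. Rep_bergman (X n) z - g z)"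
        using Rep_bergman_inverse[of "X n - G"] by (simp add: minus_bergman.rep_eq G)
      moreover have "norm (Abs_bergman (\<lambda>z. Rep_bergman (X n) z - g z)) \<le> e / 2"
        using key[of "e / 2" N n] N[OF that] \<open>0 < e\<close> by (auto intro: less_imp_le)
      ultimately show ?thesis using \<open>0 < e\<close> by simp
    qed
    then show "\<exists>N. \<forall>n\<ge>N. norm (X n - G) < e" by blast
  qed
  then show "convergent X" by (rule convergentI)
qed

section \<open>Separation and duality in Hilbert spaces\<close>

lemma closest_point_exists:
  fixes S :: "'a::{real_inner, complete_space} set"
  assumes S: "closed S" "convex S" "S \<noteq> {}"
  obtains x where "x \<in> S" "\<And>y. y \<in> S \<Longrightarrow> inner (p - x) (y - x) \<le> 0"
proof -
  define d where "d = (INF y\<in>S. (norm (p - y))\<^sup>2)"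
  have bdd: "bdd_below ((\<lambda>y. (norm (p - y))\<^sup>2) ` S)"
    by (rule bdd_belowI[of _ 0]) auto
  have lower: "d \<le> (norm (p - y))\<^sup>2" if "y \<in> S" for y
    unfolding d_def using bdd that by (rule cINF_lower)
  have "\<exists>y\<in>S. (norm (p - y))\<^sup>2 < d + 1 / Suc n" for n
  proof (rule ccontr)
    assume "\<not> ?thesis"
    then have "d + 1 / Suc n \<le> d"
      unfolding d_def using S(3) by (intro cINF_greatest) (auto simp: d_def not_less)
    then show False by simp
  qed
  then obtain X where X: "\<And>n. X n \<in> S" "\<And>n. (norm (p - X n))\<^sup>2 < d + 1 / Suc n"
    by metis
  \<comment> \<open>The parallelogram law at the midpoint makes a minimizing sequence Cauchy.\<close>
  have near: "(norm (X m - X n))\<^sup>2 \<le> 2 / Suc m + 2 / Suc n" for m n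
  proof -
    have "(1 / 2) *\<^sub>R X m + (1 / 2) *\<^sub>R X n \<in> S"
      using S(2) X(1) by (intro convexD) auto
    from lower[OF this] have "4 * d \<le> 4 * (norm (p - ((1 / 2) *\<^sub>R X m + (1 / 2) *\<^sub>R X n)))\<^sup>2"
      by simp
    also have "\<dots> = 2 * (norm (p - X m))\<^sup>2 + 2 * (norm (p - X n))\<^sup>2 - (norm (X m - X n))\<^sup>2"
      unfolding power2_norm_eq_inner by (simp add: inner_simps inner_commute algebra_simps)
    finally show ?thesis using X(2)[of m] X(2)[of n] by simp
  qed
  have "Cauchy X"
  proof (rule metric_CauchyI)
    fix e :: real assume "0 < e"
    obtain N where N: "4 / e\<^sup>2 < real N" using reals_Archimedean2 by blast
    show "\<exists>M. \<forall>m\<ge>M. \<forall>n\<ge>M. dist (X m) (X n) < e"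
    proof (intro exI allI impI)
      fix m n assume mn: "N \<le> m" "N \<le> n"
      have "4 / e\<^sup>2 < real (Suc m)" "4 / e\<^sup>2 < real (Suc n)" using N mn by auto
      then have "2 / real (Suc m) < e\<^sup>2 / 2" "2 / real (Suc n) < e\<^sup>2 / 2"
        using \<open>0 < e\<close> by (simp_all add: field_simps)
      then have "(norm (X m - X n))\<^sup>2 < e\<^sup>2" using near[of m n] by linarith
      then show "dist (X m) (X n) < e"
        unfolding dist_norm by (rule power2_less_imp_less) (use \<open>0 < e\<close> in simp)
    qed
  qed
  then obtain x where x: "X \<longlonglongrightarrow> x" using Cauchy_convergent convergent_def by blast
  have "x \<in> S" using S(1) X(1) x by (auto intro: closed_sequentially)
  have "(norm (p - x))\<^sup>2 \<le> d + 0"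
  proof (rule LIMSEQ_le)
    show "(\<lambda>n. (norm (p - X n))\<^sup>2) \<longlonglongrightarrow> (norm (p - x))\<^sup>2" by (intro tendsto_intros x)
    show "(\<lambda>n. d + 1 / Suc n) \<longlonglongrightarrow> d + 0"
      by (intro tendsto_intros LIMSEQ_Suc[OF lim_1_over_n])
    show "\<exists>N. \<forall>n\<ge>N. (norm (p - X n))\<^sup>2 \<le> d + 1 / Suc n"
      using X(2) by (auto intro: less_imp_le)
  qed
  have "inner (p - x) (y - x) \<le> 0" if "y \<in> S" for y
  proof (rule ccontr)
    assume "\<not> ?thesis"
    then have pos: "0 < inner (p - x) (y - x)" by simp
    define c where "c = inner (p - x) (y - x)"
    define q where "q = inner (y - x) (y - x)"
    have q: "0 \<le> q" by (simp add: q_def)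
    define t where "t = min 1 (c / (q + 1))"
    have t: "0 < t" "t \<le> 1" using pos q by (auto simp: t_def c_def)
    have "t * q < 2 * c"
    proof -
      have "t * q \<le> c / (q + 1) * q" unfolding t_def using q by (intro mult_right_mono) auto
      also have "\<dots> = c * (q / (q + 1))" by simp
      also have "\<dots> \<le> c * 1" using pos q by (intro mult_left_mono) (auto simp: c_def)
      finally show ?thesis using pos by (simp add: c_def)
    qed
    have "(1 - t) *\<^sub>R x + t *\<^sub>R y \<in> S"
      using S(2) \<open>x \<in> S\<close> that t by (intro convexD) auto
    from lower[OF this] have "d \<le> (norm ((p - x) - t *\<^sub>R (y - x)))\<^sup>2"
      by (simp add: algebra_simps)
    also have "\<dots> = (norm (p - x))\<^sup>2 - t * (2 * c - t * q)"
      unfolding power2_norm_eq_inner c_def q_def by (simp add: inner_simps inner_commute algebra_simps)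
    finally have "t * (2 * c - t * q) \<le> 0"
      using \<open>(norm (p - x))\<^sup>2 \<le> d + 0\<close> by linarith
    then show False using t(1) \<open>t * q < 2 * c\<close> by (simp add: mult_le_0_iff)
  qed
  with \<open>x \<in> S\<close> show thesis by (rule that)
qed

text \<open>
  The separating functional is the inner product with the vector from the closest point of \<open>S\<close> to \<open>p\<close>.
\<close>

lemma separate_point_from_closed_convex:
  fixes S :: "'a::{real_inner, complete_space} set"
  assumes S: "closed S" "convex S" "S \<noteq> {}" and p: "p \<notin> S"
  obtains G s where "\<And>q. q \<in> S \<Longrightarrow> inner q G \<le> s" "s < inner p G"
proof -
  obtain x where x: "x \<in> S" "\<And>y. y \<in> S \<Longrightarrow> inner (p - x) (y - x) \<le> 0"
    using closest_point_exists[OF S] by blast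
  show thesis
  proof
    show "inner q (p - x) \<le> inner x (p - x)" if "q \<in> S" for q
      using x(2)[OF that] by (simp add: inner_diff_right inner_commute)
    have "0 < inner (p - x) (p - x)" using p x(1) by auto
    then show "inner x (p - x) < inner p (p - x)" by (simp add: inner_diff_left)
  qed
qed

lemma Riesz_representation:
  fixes T :: "'a::{real_inner, complete_space} \<Rightarrow> real"
  assumes "bounded_linear T"
  obtains y where "\<And>x. T x = inner x y"
proof (cases "\<exists>p. T p \<noteq> 0")
  case False
  then show ?thesis using that[of 0] by simp
next
  case True
  then obtain p where p: "T p \<noteq> 0" by blast
  interpret T: bounded_linear T by fact
  define S where "S = {x. T x = 0}"
  have "closed S" unfolding S_def
    by (intro closed_Collect_eq T.continuous_on continuous_intros)
  moreover have "subspace S" unfolding S_def by (auto simp: subspace_def T.add T.scaleR)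
  ultimately obtain x where x: "x \<in> S" "\<And>y. y \<in> S \<Longrightarrow> inner (p - x) (y - x) \<le> 0"
    using closest_point_exists[of S] subspace_imp_convex subspace_0 by blast
  define e where "e = p - x"
  have orth: "inner e y = 0" if "y \<in> S" for y
  proof -
    have "inner e y \<le> 0" using x(2)[of "y + x"] that x(1) \<open>subspace S\<close> by (simp add: e_def subspace_add)
    moreover have "inner e (- y) \<le> 0"
      using x(2)[of "- y + x"] that x(1) \<open>subspace S\<close> by (simp add: e_def subspace_add subspace_neg subspace_diff)
    ultimately show ?thesis by simp
  qed
  have Te: "T e \<noteq> 0" using p x(1) by (simp add: e_def T.diff S_def)
  then have ee: "inner e e \<noteq> 0" by (auto simp: T.zero)
  have "T v = inner v ((T e / inner e e) *\<^sub>R e)" for v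
  proof -
    have "inner e (v - (T v / T e) *\<^sub>R e) = 0"
      by (rule orth) (use Te in \<open>simp add: S_def T.diff T.scaleR\<close>)
    then show ?thesis using Te ee by (simp add: inner_diff_right inner_commute field_simps)
  qed
  then show ?thesis by (rule that)
qed

text \<open>
  A form of the bipolar theorem. If \<open>p\<close> is dominated on \<open>B\<close> by the support function of \<open>K\<close>, then \<open>p\<close>
  lies within any positive multiple of the polar of \<open>B\<close> from \<open>K\<close>. Otherwise some \<open>G\<close> would separate \<open>p\<close> from
  the sum of \<open>K\<close> and this multiple of the polar; as \<open>G\<close> is bounded on the polar, a positive multiple of \<open>G\<close>
  lies in \<open>B\<close>, where domination contradicts the separation. A point of the closure suffices, since the
  polar of a bounded set is a neighbourhood of 0.
\<close>

lemma convex_set_approximates_on_bounded_set: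
  fixes B K :: "'a::{real_inner, complete_space} set"
  assumes B: "closed B" "convex B" "0 \<in> B" "bounded B"
    and K: "convex K" "K \<noteq> {}"
    and dom: "\<And>F t. F \<in> B \<Longrightarrow> (\<And>q. q \<in> K \<Longrightarrow> inner q F \<le> t) \<Longrightarrow> inner p F \<le> t"
    and e: "0 < e"
  obtains q where "q \<in> K" "\<And>F. F \<in> B \<Longrightarrow> inner (p - q) F \<le> e"
proof -
  obtain M where M: "0 < M" "\<And>F. F \<in> B \<Longrightarrow> norm F \<le> M"
    using B(4) unfolding bounded_pos by blast
  define P where "P = {q. \<forall>F\<in>B. inner q F \<le> e / 2}"
  have "0 \<in> P" using e by (simp add: P_def)
  have "convex P"
  proof (rule convexI)
    fix x y :: 'a and u v :: real
    assume xy: "x \<in> P" "y \<in> P" and uv: "0 \<le> u" "0 \<le> v" "u + v = 1"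
    have "u * inner x F + v * inner y F \<le> u * (e / 2) + v * (e / 2)" if "F \<in> B" for F
      using xy uv that by (intro add_mono mult_left_mono) (auto simp: P_def)
    also have "u * (e / 2) + v * (e / 2) = e / 2"
      using uv(3) by (simp flip: distrib_right add_divide_distrib)
    finally show "u *\<^sub>R x + v *\<^sub>R y \<in> P" by (simp add: P_def inner_add_left)
  qed
  define C where "C = {x + y | x y. x \<in> K \<and> y \<in> P}"
  have "convex C"
    unfolding C_def using convex_sums[OF K(1) \<open>convex P\<close>] by (auto simp: set_eq_iff elim!: back_subst[of convex])
  have "p \<in> closure C"
  proof (rule ccontr)
    assume "p \<notin> closure C"
    moreover have "closure C \<noteq> {}" using K(2) \<open>0 \<in> P\<close> by (auto simp: C_def)
    ultimately obtain G s where G: "\<And>q. q \<in> closure C \<Longrightarrow> inner q G \<le> s" "s < inner p G"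
      using separate_point_from_closed_convex[OF closed_closure convex_closure[OF \<open>convex C\<close>]]
      by blast
    have GC: "inner x G + inner y G \<le> s" if "x \<in> K" "y \<in> P" for x y
    proof -
      have "x + y \<in> closure C" using that closure_subset by (fastforce simp: C_def)
      from G(1)[OF this] show ?thesis by (simp add: inner_add_left)
    qed
    obtain k where k: "k \<in> K" using K(2) by blast
    define m where "m = max 1 (s - inner k G)"
    have m: "0 < m" "\<And>y. y \<in> P \<Longrightarrow> inner y G \<le> m"
      using GC[OF k] by (auto simp: m_def le_max_iff_disj algebra_simps)
    define t where "t = e / (2 * m)"
    have t: "0 < t" using e m by (simp add: t_def)
    have "t *\<^sub>R G \<in> B"
    proof (rule ccontr)
      assume "t *\<^sub>R G \<notin> B"
      then obtain q u where q: "\<And>F. F \<in> B \<Longrightarrow> inner F q \<le> u" "u < inner (t *\<^sub>R G) q"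
        using separate_point_from_closed_convex[OF B(1,2)] B(3) by blast
      define v where "v = (u + inner (t *\<^sub>R G) q) / 2"
      have "0 \<le> u" using q(1)[OF B(3)] by simp
      then have v: "0 < v" "u \<le> v" "v < inner (t *\<^sub>R G) q" using q(2) by (auto simp: v_def)
      have "(e / (2 * v)) *\<^sub>R q \<in> P"
      proof -
        have "e / (2 * v) * inner q F \<le> e / (2 * v) * v" if "F \<in> B" for F
          using q(1)[OF that] v e by (intro mult_left_mono) (auto simp: inner_commute)
        then show ?thesis using v(1) by (simp add: P_def)
      qed
      then have "e / (2 * v) * inner q G \<le> m" using m(2) by fastforce
      then have "e * inner q G \<le> m * (2 * v)" using v(1) by (simp add: field_simps)
      moreover have "m * (2 * v) < m * (2 * (t * inner q G))"
        using v(3) m(1) by (simp add: inner_commute)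
      moreover have "m * (2 * (t * inner q G)) = e * inner q G"
        using m(1) by (simp add: t_def)
      ultimately show False by linarith
    qed
    moreover have "inner x (t *\<^sub>R G) \<le> t * s" if "x \<in> K" for x
      using GC[OF that \<open>0 \<in> P\<close>] t by simp
    ultimately have "inner p (t *\<^sub>R G) \<le> t * s" by (rule dom)
    then show False using t G(2) by simp
  qed
  then obtain c where c: "c \<in> C" "dist c p < e / (2 * M)"
    using e M(1) unfolding closure_approachable by (metis divide_pos_pos mult_pos_pos zero_less_numeral)
  then obtain x y where xy: "c = x + y" "x \<in> K" "y \<in> P" by (auto simp: C_def)
  have "inner (p - x) F \<le> e" if F: "F \<in> B" for F
  proof -
    have "inner (p - c) F \<le> norm (p - c) * norm F" by (rule norm_cauchy_schwarz)
    also have "\<dots> \<le> e / (2 * M) * M"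
      using c(2) M(2)[OF F] e M(1) by (intro mult_mono) (auto simp: dist_norm norm_minus_commute)
    also have "\<dots> = e / 2" using M(1) by simp
    finally have "inner (p - c) F \<le> e / 2" .
    moreover have "inner y F \<le> e / 2" using xy(3) F by (simp add: P_def)
    ultimately show ?thesis by (simp add: xy(1) inner_diff_left inner_add_left)
  qed
  with xy(2) show thesis by (rule that)
qed

section \<open>Projections and multiplication operators on the Bergman space\<close>

lemma bergman_subspaceD: "bergman.subspace N \<Longrightarrow> subspace N"
  by (auto simp: subspace_def bergman.subspace_def scaleR_bergman_def)

lemma proj_spec:
  assumes "closed N" "bergman.subspace N"
  shows "proj N f \<in> N \<and> (\<forall>h\<in>N. cinner (f - proj N f) h = 0)"
proof -
  note N = bergman_subspaceD[OF assms(2)]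
  obtain x where x: "x \<in> N" "\<And>y. y \<in> N \<Longrightarrow> inner (f - x) (y - x) \<le> 0"
    using closest_point_exists[OF assms(1) subspace_imp_convex[OF N]] subspace_0[OF N] by blast
  have re: "inner (f - x) h = 0" if "h \<in> N" for h
  proof (rule antisym)
    show "inner (f - x) h \<le> 0"
      using x(2)[of "h + x"] subspace_add[OF N that x(1)] by simp
    show "0 \<le> inner (f - x) h"
      using x(2)[of "x - h"] subspace_diff[OF N x(1) that] by simp
  qed
  have "cinner (f - x) h = 0" if "h \<in> N" for h
    using re[OF that] re[OF bergman.subspace_scale[OF assms(2) that], of \<i>]
    by (simp add: cinner_inner complex_eq_iff)
  with x(1) have ex: "x \<in> N \<and> (\<forall>h\<in>N. cinner (f - x) h = 0)" by blast
  have "g = x" if g: "g \<in> N \<and> (\<forall>h\<in>N. cinner (f - g) h = 0)" for g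
  proof -
    have "g - x \<in> N" using g x(1) N by (simp add: subspace_diff)
    with g ex have "cinner ((f - x) - (f - g)) (g - x) = 0" unfolding cinner_diff(1)[of "f - x"] by simp
    then have "cinner (g - x) (g - x) = 0" by simp
    then show "g = x" by (simp add: cinner_self_norm)
  qed
  with ex have "\<exists>!g. g \<in> N \<and> (\<forall>h\<in>N. cinner (f - g) h = 0)" by blast
  then show ?thesis unfolding proj_def by (rule theI')
qed

lemma
  assumes "closed N" "bergman.subspace N"
  shows proj_in: "proj N f \<in> N"
    and cinner_proj_left: "h \<in> N \<Longrightarrow> cinner (proj N f) h = cinner f h"
    and cinner_proj_right: "h \<in> N \<Longrightarrow> cinner h (proj N f) = cinner h f"
proof -
  show "proj N f \<in> N" and *: "h \<in> N \<Longrightarrow> cinner (proj N f) h = cinner f h"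
    using proj_spec[OF assms, of f] by (auto simp: cinner_diff)
  show "h \<in> N \<Longrightarrow> cinner h (proj N f) = cinner h f"
    using * by (metis cinner_commute)
qed

lemma proj_eq:
  assumes "closed N" "bergman.subspace N" "f \<in> N"
  shows "proj N f = f"
proof -
  have "proj N f - f \<in> N"
    using proj_in[OF assms(1,2)] assms(3) by (simp add: subspace_diff[OF bergman_subspaceD[OF assms(2)]])
  then have "cinner (proj N f - f) (proj N f - f) = 0"
    by (simp add: cinner_diff(1) cinner_proj_left[OF assms(1,2)])
  then show ?thesis by (simp add: cinner_self_norm)
qed

lemma norm_proj_le:
  assumes "closed N" "bergman.subspace N"
  shows "norm (proj N f) \<le> norm f"
proof -
  let ?p = "proj N f"
  have "norm ?p * norm ?p = cmod (cinner ?p ?p)"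
    by (simp add: cinner_self_norm power2_eq_square norm_mult)
  also have "\<dots> = cmod (cinner f ?p)"
    using cinner_proj_left[OF assms proj_in[OF assms]] by simp
  also have "\<dots> \<le> norm f * norm ?p" by (rule cinner_Cauchy_Schwarz)
  finally show ?thesis by (cases "norm ?p = 0") (auto simp: mult_le_cancel_right)
qed

lemma complex_Riesz_representation:
  assumes T: "bounded_linear T" "\<And>c f. T (cscale c f) = c * T f"
  obtains y where "\<And>f. T f = cinner f y"
proof -
  have "bounded_linear (\<lambda>f. Re (T f))" by (rule bounded_linear_compose[OF bounded_linear_Re T(1)])
  then obtain y where y: "\<And>f. Re (T f) = inner f y" using Riesz_representation by blast
  have "Im (T f) = Im (cinner f y)" for f
    using y[of "cscale \<i> f"] by (simp add: T(2) Re_cinner[symmetric] cinner_cscale_left)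
  then show thesis using y by (intro that[of y]) (simp add: complex_eq_iff Re_cinner)
qed

lemma hinfD:
  assumes "f \<in> hinf"
  shows "f holomorphic_on disk" "z \<notin> disk \<Longrightarrow> f z = 0" "\<exists>C\<ge>0. \<forall>z. cmod (f z) \<le> C"
proof -
  show "f holomorphic_on disk" and out: "z \<notin> disk \<Longrightarrow> f z = 0" for z
    using assms by (auto simp: hinf_def)
  obtain C where C: "\<And>z. z \<in> disk \<Longrightarrow> cmod (f z) \<le> C"
    using assms unfolding hinf_def bounded_iff by blast
  have "cmod (f z) \<le> max 0 C" for z
    using C[of z] out[of z] by (cases "z \<in> disk") auto
  then show "\<exists>C\<ge>0. \<forall>z. cmod (f z) \<le> C" by (metis max.cobounded1)
qed

lemma hinfI:
  assumes "f holomorphic_on disk" "\<And>z. z \<notin> disk \<Longrightarrow> f z = 0" "\<And>z. z \<in> disk \<Longrightarrow> cmod (f z) \<le> C"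
  shows "f \<in> hinf"
  using assms unfolding hinf_def bounded_iff by blast

lemma hinf_add: "f \<in> hinf \<Longrightarrow> g \<in> hinf \<Longrightarrow> (\<lambda>z. f z + g z) \<in> hinf"
  by (auto simp: hinf_def intro!: holomorphic_intros bounded_plus_comp)

lemma hinf_cmult: "f \<in> hinf \<Longrightarrow> (\<lambda>z. c * f z) \<in> hinf"
proof -
  assume f: "f \<in> hinf"
  then obtain C where "\<And>z. cmod (f z) \<le> C" using hinfD(3) by blast
  then show ?thesis
    using hinfD(1,2)[OF f] by (intro hinfI[of _ "cmod c * C"])
      (auto intro!: holomorphic_intros mult_left_mono simp: norm_mult)
qed

lemma hinf_measurable: "f \<in> hinf \<Longrightarrow> f \<in> borel_measurable borel"
  using hinfD(1,2) by (intro holomorphic_disk_measurable) auto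

lemma mult_op_linear:
  assumes "f \<in> hinf"
  shows "mult_op f (x + y) = mult_op f x + mult_op f y" "mult_op f (cscale c x) = cscale c (mult_op f x)"
    "mult_op f (r *\<^sub>R x) = r *\<^sub>R mult_op f x"
  by (rule bergman_eqI; simp add: Rep_mult_op[OF assms] plus_bergman.rep_eq cscale.rep_eq
      scaleR_bergman_def algebra_simps)+

lemma mult_op_add_fun:
  "f \<in> hinf \<Longrightarrow> g \<in> hinf \<Longrightarrow> mult_op (\<lambda>z. f z + g z) x = mult_op f x + mult_op g x"
  by (rule bergman_eqI) (simp add: Rep_mult_op hinf_add plus_bergman.rep_eq algebra_simps)

lemma mult_op_cmult_fun: "f \<in> hinf \<Longrightarrow> mult_op (\<lambda>z. c * f z) x = cscale c (mult_op f x)"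
  by (rule bergman_eqI) (simp add: Rep_mult_op hinf_cmult cscale.rep_eq algebra_simps)

lemma indicator_disk_hinf: "(indicator disk :: complex \<Rightarrow> complex) \<in> hinf"
proof (rule hinfI)
  show "(indicator disk :: complex \<Rightarrow> complex) holomorphic_on disk"
    by (rule holomorphic_transform[of "\<lambda>_. 1"]) (auto simp: indicator_def)
qed (auto simp: indicator_def split: if_splits intro: order_refl)

lemma mult_op_indicator: "mult_op (indicator disk) x = x"
  by (rule bergman_eqI) (simp add: Rep_mult_op[OF indicator_disk_hinf])

lemma mult_op_mult_fun:
  assumes "f \<in> hinf" "g \<in> hinf" "(\<lambda>z. f z * g z) \<in> hinf"
  shows "mult_op (\<lambda>z. f z * g z) x = mult_op f (mult_op g x)"
  by (rule bergman_eqI) (simp add: Rep_mult_op assms)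

lemma norm_mult_op_le:
  assumes f: "f \<in> hinf" and C: "\<And>z. z \<in> disk \<Longrightarrow> cmod (f z) \<le> C" "0 \<le> C"
  shows "norm (mult_op f x) \<le> C * norm x"
proof (rule power2_le_imp_le)
  have "(norm (mult_op f x))\<^sup>2 \<le> (LINT z:disk|lborel. C\<^sup>2 * (cmod (Rep_bergman x z))\<^sup>2)"
    unfolding norm_bergman_squared
    using C Rep_bergman_square_integrable[of "mult_op f x"] Rep_bergman_square_integrable[of x]
    by (intro set_integral_mono) (auto simp: Rep_mult_op[OF f] norm_mult power_mult_distrib
        intro!: mult_right_mono power_mono)
  also have "\<dots> = (C * norm x)\<^sup>2" by (simp add: power_mult_distrib norm_bergman_squared)
  finally show "(norm (mult_op f x))\<^sup>2 \<le> (C * norm x)\<^sup>2" .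
qed (use C(2) in simp)

lemma bounded_linear_mult_op:
  assumes "f \<in> hinf"
  shows "bounded_linear (mult_op f)"
proof -
  obtain C where "0 \<le> C" "\<And>z. cmod (f z) \<le> C" using hinfD(3)[OF assms] by blast
  then have "norm (mult_op f x) \<le> norm x * C" for x
    using norm_mult_op_le[OF assms, of C x] by (simp add: mult.commute)
  then show ?thesis
    by (intro bounded_linear_intro[of _ C]) (simp_all add: mult_op_linear[OF assms])
qed

lemma mult_op_bounded_operators: "f \<in> hinf \<Longrightarrow> mult_op f \<in> bounded_operators"
  by (auto simp: bounded_operators_def bounded_linear_mult_op mult_op_linear
      intro!: Vector_Spaces.linear_iff[THEN iffD2] bergman.vector_space_axioms)

lemma cinner_mult_op:
  "f \<in> hinf \<Longrightarrow> cinner (mult_op f x) y = (LINT z:disk|lborel. f z * Rep_bergman x z * cnj (Rep_bergman y z))"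
  by (simp add: cinner.rep_eq Rep_mult_op)

lemma mult_op_adjoint:
  assumes "f \<in> hinf"
  obtains y' where "\<And>x. cinner (mult_op f x) y = cinner x y'"
proof (rule complex_Riesz_representation)
  show "bounded_linear (\<lambda>x. cinner (mult_op f x) y)"
    by (rule bounded_linear_compose[OF bounded_linear_cinner_left bounded_linear_mult_op[OF assms]])
  show "cinner (mult_op f (cscale c x)) y = c * cinner (mult_op f x) y" for c x
    by (simp add: mult_op_linear[OF assms] cinner_cscale_left)
qed (rule that)

lemma closed_Collect_cinner_eq_0: "closed {h. cinner h x = 0}"
  by (intro closed_Collect_eq continuous_intros bounded_linear.continuous_on[OF bounded_linear_cinner_left])

lemma ominus_ideal_closed:
  assumes "closed L" "bergman.subspace L"
  shows "closed (ominus_ideal L J)" "bergman.subspace (ominus_ideal L J)"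
proof -
  have "ominus_ideal L J = L \<inter> (\<Inter>g\<in>J. \<Inter>x\<in>L. {h. cinner h (mult_op g x) = 0})"
    by (auto simp: ominus_ideal_def)
  then show "closed (ominus_ideal L J)"
    using assms(1) by (auto intro!: closed_Int closed_INT closed_Collect_cinner_eq_0)
  show "bergman.subspace (ominus_ideal L J)"
    using assms(2) by (auto simp: bergman.subspace_def ominus_ideal_def cinner_add_left cinner_cscale_left)
qed

lemma dual_subalgebraD:
  assumes "dual_subalgebra A"
  shows "A \<subseteq> hinf" "indicator disk \<in> A" "f \<in> A \<Longrightarrow> g \<in> A \<Longrightarrow> (\<lambda>z. f z + g z) \<in> A"
    "f \<in> A \<Longrightarrow> g \<in> A \<Longrightarrow> (\<lambda>z. f z * g z) \<in> A" "f \<in> A \<Longrightarrow> (\<lambda>z. c * f z) \<in> A"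
    "closedin weak_star_topology (mult_op ` A)"
  using assms unfolding dual_subalgebra_def by blast+

text \<open>
  Compressed to \<open>L\<close>, the adjoint of multiplication by \<open>f\<close> has every vector of \<open>L \<ominus> \<JJ>\<^sub>w L\<close> as an eigenvector
  with the eigenvalue \<open>cnj (f w)\<close>, because the ideal of \<open>w\<close> contains \<open>f - f w\<close>.
\<close>

lemma cinner_ominus_vanishing_ideal:
  assumes A: "dual_subalgebra A" and L: "L \<in> Lat A" and w: "w \<in> disk"
    and v: "v \<in> ominus_ideal L (vanishing_ideal A w)" and f: "f \<in> A" and x: "x \<in> L"
  shows "cinner (mult_op f x) v = f w * cinner x v"
proof -
  define g where "g = (\<lambda>z. f z + (- f w) * indicator disk z)"
  have fh: "f \<in> hinf" using A f by (auto simp: dual_subalgebra_def)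
  have "(\<lambda>z. (- f w) * indicator disk z) \<in> A"
    using A by (intro dual_subalgebraD(5,2))
  then have "g \<in> A" using A f unfolding g_def by (intro dual_subalgebraD(3))
  then have "g \<in> vanishing_ideal A w" using w by (simp add: vanishing_ideal_def g_def)
  then have "cinner v (mult_op g x) = 0" using v x by (auto simp: ominus_ideal_def)
  then have "cinner (mult_op g x) v = 0" by (subst cinner_commute) simp
  moreover have "mult_op g x = mult_op f x + cscale (- f w) x"
    unfolding g_def using fh indicator_disk_hinf
    by (simp only: mult_op_add_fun hinf_cmult mult_op_cmult_fun mult_op_indicator)
  ultimately show ?thesis by (simp only: cinner_add_left cinner_cscale_left) simp
qed

section \<open>The positivity condition as a contraction property\<close>

lemma norm_vec_squared: "(norm (x :: 'a::real_inner ^ 'n))\<^sup>2 = (\<Sum>i\<in>UNIV. (norm (x $ i))\<^sup>2)"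
  by (simp add: norm_vec_def L2_set_def sum_nonneg)

lemma cinner_vec_Cauchy_Schwarz:
  "cmod (\<Sum>a\<in>UNIV. cinner (x $ a) (y $ a)) \<le> norm x * norm (y :: bergman ^ 'r)"
proof -
  have "cmod (\<Sum>a\<in>UNIV. cinner (x $ a) (y $ a)) \<le> (\<Sum>a\<in>UNIV. \<bar>norm (x $ a)\<bar> * \<bar>norm (y $ a)\<bar>)"
    by (intro sum_norm_le) (simp add: cinner_Cauchy_Schwarz)
  also have "\<dots> \<le> norm x * norm y"
    unfolding norm_vec_def by (rule L2_set_mult_ineq)
  finally show ?thesis .
qed

text \<open>
  The map that sends a sum of vectors \<open>h\<^sub>i\<close> in \<open>\<complex>\<^sup>r \<otimes> N\<^sub>i\<close> to the sum of the \<open>W\<^sub>i\<^sup>* h\<^sub>i\<close> is a contraction. The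
  condition is imposed on families \<open>h\<close>; that the value depends only on the sum of the family is part
  of it.
\<close>

definition adjoint_contractive :: "('n \<Rightarrow> complex ^ 'r ^ 'r) \<Rightarrow> ('n \<Rightarrow> bergman set) \<Rightarrow> bool"
  where "adjoint_contractive W N \<longleftrightarrow> (\<forall>h. (\<forall>i a. h i a \<in> N i) \<longrightarrow>
      (\<Sum>c\<in>UNIV. (norm (\<Sum>i\<in>UNIV. \<Sum>a\<in>UNIV. cscale (cnj (W i $ a $ c)) (h i a)))\<^sup>2)
        \<le> (\<Sum>a\<in>UNIV. (norm (\<Sum>i\<in>UNIV. h i a))\<^sup>2))"

text \<open>
  With \<open>h\<^sub>i\<close> the projection of \<open>x\<^sub>i\<close>, the quadratic form of the operator matrix at \<open>x\<close> is the difference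
  between the squared norms of the sum of the \<open>h\<^sub>i\<close> and of the sum of the \<open>W\<^sub>i\<^sup>* h\<^sub>i\<close>.
\<close>

lemma positive_semidefinite_iff_adjoint_contractive:
  fixes W :: "'n::finite \<Rightarrow> complex ^ 'r::finite ^ 'r" and N :: "'n \<Rightarrow> bergman set"
  assumes N: "\<And>i. closed (N i)" "\<And>i. bergman.subspace (N i)"
  shows "positive_semidefinite (block_op (\<lambda>i j.
        tensor_op (mat 1 - W i ** conj_transpose (W j)) (proj (N i) \<circ> proj (N j)))) \<longleftrightarrow>
    adjoint_contractive W N"
proof -
  let ?T = "block_op (\<lambda>i j.
    tensor_op (mat 1 - W i ** conj_transpose (W j)) (proj (N i) \<circ> proj (N j))) :: bergman ^ 'r ^ 'n \<Rightarrow> _"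
  let ?N = "\<lambda>h :: 'n \<Rightarrow> 'r \<Rightarrow> bergman. \<forall>i a. h i a \<in> N i"
  let ?K = "\<lambda>h. \<Sum>c\<in>UNIV. (norm (\<Sum>i\<in>UNIV. \<Sum>a\<in>UNIV. cscale (cnj (W i $ a $ c)) (h i a)))\<^sup>2"
  let ?H = "\<lambda>h. \<Sum>a\<in>UNIV. (norm (\<Sum>i\<in>UNIV. h i a))\<^sup>2"
  have form: "cinner_sum (?T x) x = of_real (?H (\<lambda>i a. proj (N i) (x $ i $ a)) - ?K (\<lambda>i a. proj (N i) (x $ i $ a)))"
    for x :: "bergman ^ 'r ^ 'n"
  proof -
    define h where "h = (\<lambda>i a. proj (N i) (x $ i $ a))"
    have h: "h i a \<in> N i" for i a unfolding h_def by (rule proj_in[OF N])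
    have adj: "cinner (proj (N i) v) (x $ i $ a) = cinner v (h i a)" for i a v
      unfolding h_def by (metis N cinner_proj_left cinner_proj_right proj_in)
    have entry: "(mat 1 - W i ** conj_transpose (W j)) $ a $ b =
        (if a = b then 1 else 0) - (\<Sum>c\<in>UNIV. W i $ a $ c * cnj (W j $ b $ c))" for i j a b
      by (simp add: mat_def matrix_matrix_mult_def conj_transpose_def map_matrix_def transpose_def)
    have "cinner_sum (?T x) x = (\<Sum>i\<in>UNIV. \<Sum>a\<in>UNIV. \<Sum>j\<in>UNIV. \<Sum>b\<in>UNIV.
        ((if a = b then 1 else 0) - (\<Sum>c\<in>UNIV. W i $ a $ c * cnj (W j $ b $ c))) * cinner (h j b) (h i a))"
      by (simp add: cinner_sum_def block_op_def tensor_op_def sum_component cinner_sum cinner_cscale_left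
          adj entry[unfolded vector_minus_component]) (simp add: h_def)
    also have "\<dots> = (\<Sum>i\<in>UNIV. \<Sum>a\<in>UNIV. \<Sum>j\<in>UNIV. \<Sum>b\<in>UNIV. (if a = b then cinner (h j b) (h i a) else 0))
        - (\<Sum>i\<in>UNIV. \<Sum>a\<in>UNIV. \<Sum>j\<in>UNIV. \<Sum>b\<in>UNIV. \<Sum>c\<in>UNIV.
            W i $ a $ c * cnj (W j $ b $ c) * cinner (h j b) (h i a))"
      unfolding sum_subtractf[symmetric]
      by (intro sum.cong refl) (simp add: left_diff_distrib sum_distrib_right)
    also have "(\<Sum>i\<in>UNIV. \<Sum>a\<in>UNIV. \<Sum>j\<in>UNIV. \<Sum>b\<in>UNIV. (if a = b then cinner (h j b) (h i a) else 0))
        = of_real (?H h)"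
    proof -
      have "of_real (?H h) = (\<Sum>a\<in>UNIV. \<Sum>i\<in>UNIV. \<Sum>j\<in>UNIV. cinner (h j a) (h i a))"
        by (simp only: of_real_sum cinner_self_norm[symmetric]) (simp only: cinner_sum)
      then show ?thesis by (simp add: sum.swap[of _ "UNIV :: 'r set" "UNIV :: 'n set"])
    qed
    also have "(\<Sum>i\<in>UNIV. \<Sum>a\<in>UNIV. \<Sum>j\<in>UNIV. \<Sum>b\<in>UNIV. \<Sum>c\<in>UNIV.
            W i $ a $ c * cnj (W j $ b $ c) * cinner (h j b) (h i a)) = of_real (?K h)"
    proof -
      have "of_real (?K h) = (\<Sum>c\<in>UNIV. \<Sum>i\<in>UNIV. \<Sum>a\<in>UNIV. \<Sum>j\<in>UNIV. \<Sum>b\<in>UNIV.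
            W i $ a $ c * cnj (W j $ b $ c) * cinner (h j b) (h i a))"
        by (simp only: of_real_sum cinner_self_norm[symmetric])
          (simp only: cinner_sum cinner_cscale_left cinner_cscale_right complex_cnj_cnj sum_distrib_left mult.assoc)
      also have "\<dots> = (\<Sum>i\<in>UNIV. \<Sum>a\<in>UNIV. \<Sum>j\<in>UNIV. \<Sum>b\<in>UNIV. \<Sum>c\<in>UNIV.
            W i $ a $ c * cnj (W j $ b $ c) * cinner (h j b) (h i a))"
        by (subst sum.swap, rule sum.cong[OF refl], subst sum.swap, rule sum.cong[OF refl],
            subst sum.swap, rule sum.cong[OF refl], subst sum.swap, rule refl)
      finally show ?thesis ..
    qed
    finally show ?thesis by (simp only: of_real_diff h_def)
  qed
  show ?thesis
    unfolding adjoint_contractive_def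
  proof (intro iffI allI impI)
    fix h :: "'n \<Rightarrow> 'r \<Rightarrow> bergman"
    assume psd: "positive_semidefinite ?T" and h: "?N h"
    define x :: "bergman ^ 'r ^ 'n" where "x = (\<chi> i a. h i a)"
    have hx: "proj (N i) (x $ i $ a) = h i a" for i a
      using h by (simp add: x_def proj_eq[OF N])
    have "cinner_sum (?T x) x \<in> \<real>\<^sub>\<ge>\<^sub>0"
      using psd unfolding positive_semidefinite_def by blast
    then have "complex_of_real (?H h - ?K h) \<in> \<real>\<^sub>\<ge>\<^sub>0"
      unfolding form hx .
    then show "?K h \<le> ?H h" by (simp only: nonneg_Reals_of_real_iff diff_ge_0_iff_ge)
  next
    assume *: "\<forall>h :: 'n \<Rightarrow> 'r \<Rightarrow> bergman. ?N h \<longrightarrow> ?K h \<le> ?H h"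
    show "positive_semidefinite ?T"
      unfolding positive_semidefinite_def form nonneg_Reals_of_real_iff diff_ge_0_iff_ge
      by (intro allI *[rule_format]) (rule proj_in[OF N])
  qed
qed

lemma bounded_linear_vec_lambda:
  fixes f :: "'n::finite \<Rightarrow> 'a::real_normed_vector \<Rightarrow> 'b::real_normed_vector"
  assumes "\<And>i. bounded_linear (f i)"
  shows "bounded_linear (\<lambda>x. \<chi> i. f i x)"
proof (rule bounded_linear_intro)
  fix x y r
  show "(\<chi> i. f i (x + y)) = (\<chi> i. f i x) + (\<chi> i. f i y)" "(\<chi> i. f i (r *\<^sub>R x)) = r *\<^sub>R (\<chi> i. f i x)"
    using assms by (simp_all add: vec_eq_iff linear_simps)
  have "norm (\<chi> i. f i x) \<le> (\<Sum>i\<in>UNIV. norm (f i x))"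
    unfolding norm_vec_def by (simp add: L2_set_le_sum)
  also have "\<dots> \<le> (\<Sum>i\<in>UNIV. onorm (f i) * norm x)"
    by (intro sum_mono onorm assms)
  finally show "norm (\<chi> i. f i x) \<le> norm x * (\<Sum>i\<in>UNIV. onorm (f i))"
    by (simp add: sum_distrib_left mult.commute)
qed

lemma norm_block_op_le_mult_norm:
  fixes F :: "(complex \<Rightarrow> complex) ^ 'r::finite ^ 'r"
  assumes F: "\<And>a b. F $ a $ b \<in> hinf"
  shows "norm (block_op (\<lambda>a b. mult_op (F $ a $ b)) x) \<le> mult_norm F * norm x"
proof -
  have "bounded_linear (\<lambda>x. block_op (\<lambda>a b. mult_op (F $ a $ b)) x)"
    unfolding block_op_def
    by (intro bounded_linear_vec_lambda bounded_linear_sum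
        bounded_linear_compose[OF bounded_linear_mult_op[OF F] bounded_linear_vec_nth])
  then show ?thesis unfolding mult_norm_def by (rule onorm)
qed

lemma Lat_D:
  assumes "L \<in> Lat A"
  shows "closed L" "bergman.subspace L" "f \<in> A \<Longrightarrow> x \<in> L \<Longrightarrow> mult_op f x \<in> L"
  using assms by (auto simp: Lat_def)

text \<open>
  Let \<open>H\<close> be the sum of the \<open>h\<^sub>i\<close> and \<open>k\<close> the sum of the \<open>F (z i)\<^sup>* h\<^sub>i\<close>. The eigenvector property moves the
  matrices \<open>F (z i)\<close> to the other side and gives \<open>\<parallel>k\<parallel>\<^sup>2 = \<langle>F k, H\<rangle>\<close>, which is at most \<open>\<parallel>k\<parallel> \<parallel>H\<parallel>\<close>.
\<close>

lemma interpolant_imp_adjoint_contractive: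
  fixes F :: "(complex \<Rightarrow> complex) ^ 'r::finite ^ 'r" and z :: "'n::finite \<Rightarrow> complex"
  assumes A: "dual_subalgebra A" and z: "range z \<subseteq> disk" and F: "F \<in> matrices_over A" "mult_norm F \<le> 1"
    and L: "L \<in> Lat A"
  shows "adjoint_contractive (\<lambda>i. eval_matrix F (z i)) (\<lambda>i. ominus_ideal L (vanishing_ideal A (z i)))"
  unfolding adjoint_contractive_def
proof (intro allI impI)
  fix h :: "'n \<Rightarrow> 'r \<Rightarrow> bergman"
  assume "\<forall>i a. h i a \<in> ominus_ideal L (vanishing_ideal A (z i))"
  then have h: "h i a \<in> ominus_ideal L (vanishing_ideal A (z i))" for i a by blast
  define k where "k = (\<lambda>c. \<Sum>i\<in>UNIV. \<Sum>a\<in>UNIV. cscale (cnj (eval_matrix F (z i) $ a $ c)) (h i a))"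
  have FA: "F $ a $ b \<in> A" for a b using F by (simp add: matrices_over_def)
  then have Fh: "F $ a $ b \<in> hinf" for a b using dual_subalgebraD(1)[OF A] by blast
  have zi: "z i \<in> disk" for i using z by blast
  have kL: "k c \<in> L" for c
    unfolding k_def using h by (intro bergman.subspace_sum bergman.subspace_scale Lat_D(2)[OF L])
      (auto simp: ominus_ideal_def)
  define x y :: "bergman ^ 'r" where "x = (\<chi> c. k c)" and "y = (\<chi> a. \<Sum>i\<in>UNIV. h i a)"
  have "complex_of_real ((norm x)\<^sup>2) = (\<Sum>c\<in>UNIV. cinner (k c) (k c))"
    by (simp add: norm_vec_squared x_def cinner_self_norm)
  also have "\<dots> = (\<Sum>c\<in>UNIV. \<Sum>i\<in>UNIV. \<Sum>a\<in>UNIV. cinner (mult_op (F $ a $ c) (k c)) (h i a))"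
  proof (rule sum.cong[OF refl])
    fix c
    have "cinner (k c) (k c) = (\<Sum>i\<in>UNIV. \<Sum>a\<in>UNIV. cinner (k c) (cscale (cnj (eval_matrix F (z i) $ a $ c)) (h i a)))"
      by (subst (2) k_def) (simp only: cinner_sum)
    also have "\<dots> = (\<Sum>i\<in>UNIV. \<Sum>a\<in>UNIV. cinner (mult_op (F $ a $ c) (k c)) (h i a))"
    proof (intro sum.cong refl)
      fix i a
      have "cinner (mult_op (F $ a $ c) (k c)) (h i a) = (F $ a $ c) (z i) * cinner (k c) (h i a)"
        by (rule cinner_ominus_vanishing_ideal[OF A L zi h FA kL])
      then show "cinner (k c) (cscale (cnj (eval_matrix F (z i) $ a $ c)) (h i a)) = cinner (mult_op (F $ a $ c) (k c)) (h i a)"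
        by (simp add: cinner_cscale_right eval_matrix_def map_matrix_def)
    qed
    finally show "cinner (k c) (k c) = (\<Sum>i\<in>UNIV. \<Sum>a\<in>UNIV. cinner (mult_op (F $ a $ c) (k c)) (h i a))" .
  qed
  also have "\<dots> = (\<Sum>a\<in>UNIV. cinner (block_op (\<lambda>a b. mult_op (F $ a $ b)) x $ a) (y $ a))"
  proof -
    have "(\<Sum>c\<in>UNIV. \<Sum>i\<in>UNIV. \<Sum>a\<in>UNIV. cinner (mult_op (F $ a $ c) (k c)) (h i a))
        = (\<Sum>c\<in>UNIV. \<Sum>a\<in>UNIV. \<Sum>i\<in>UNIV. cinner (mult_op (F $ a $ c) (k c)) (h i a))"
      by (intro sum.cong refl sum.swap)
    also have "\<dots> = (\<Sum>a\<in>UNIV. \<Sum>c\<in>UNIV. \<Sum>i\<in>UNIV. cinner (mult_op (F $ a $ c) (k c)) (h i a))"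
      by (rule sum.swap)
    also have "\<dots> = (\<Sum>a\<in>UNIV. cinner (block_op (\<lambda>a b. mult_op (F $ a $ b)) x $ a) (y $ a))"
      by (simp add: block_op_def x_def y_def cinner_sum sum.swap[of _ "UNIV :: 'n set"])
    finally show ?thesis .
  qed
  finally have "(norm x)\<^sup>2 = cmod (\<Sum>a\<in>UNIV. cinner (block_op (\<lambda>a b. mult_op (F $ a $ b)) x $ a) (y $ a))"
    by (metis norm_of_real abs_power2)
  also have "\<dots> \<le> norm (block_op (\<lambda>a b. mult_op (F $ a $ b)) x) * norm y"
    by (rule cinner_vec_Cauchy_Schwarz)
  also have "\<dots> \<le> norm x * norm y"
  proof (rule mult_right_mono)
    have "norm (block_op (\<lambda>a b. mult_op (F $ a $ b)) x) \<le> mult_norm F * norm x"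
      by (rule norm_block_op_le_mult_norm[OF Fh])
    also have "\<dots> \<le> 1 * norm x" by (intro mult_right_mono F(2)) simp
    finally show "norm (block_op (\<lambda>a b. mult_op (F $ a $ b)) x) \<le> norm x" by simp
  qed simp
  finally have "norm x * norm x \<le> norm x * norm y" by (simp add: power2_eq_square)
  then have "norm x \<le> norm y" by (cases "norm x = 0") (auto simp: mult_le_cancel_left)
  then have "(norm x)\<^sup>2 \<le> (norm y)\<^sup>2" by (rule power_mono) simp
  then show "(\<Sum>c\<in>UNIV. (norm (\<Sum>i\<in>UNIV. \<Sum>a\<in>UNIV. cscale (cnj (eval_matrix F (z i) $ a $ c)) (h i a)))\<^sup>2)
      \<le> (\<Sum>a\<in>UNIV. (norm (\<Sum>i\<in>UNIV. h i a))\<^sup>2)"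
    by (simp add: norm_vec_squared x_def y_def k_def)
qed

section \<open>Compactness of the unit ball of the matrices over a dual algebra\<close>

lemma set_integrable_disk_const: "set_integrable lborel disk (\<lambda>z. c :: 'a::{banach, second_countable_topology})"
  by (rule set_integrable_ball_continuous) simp

lemma hinf_bergman_functions:
  assumes "f \<in> hinf"
  shows "f \<in> bergman_functions"
proof -
  obtain C where C: "0 \<le> C" "\<And>z. cmod (f z) \<le> C" using hinfD(3)[OF assms] by blast
  note m = hinf_measurable[OF assms]
  have "set_integrable lborel disk (\<lambda>z. (cmod (f z))\<^sup>2)"
    unfolding set_integrable_def
  proof (rule Bochner_Integration.integrable_bound)
    show "integrable lborel (\<lambda>z. indicator disk z *\<^sub>R C\<^sup>2)"
      using set_integrable_disk_const[of "C\<^sup>2"] by (simp only: set_integrable_def)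
    show "(\<lambda>z. indicator disk z *\<^sub>R (cmod (f z))\<^sup>2) \<in> borel_measurable lborel"
      using m by (intro borel_measurable_scaleR borel_measurable_power borel_measurable_norm
          borel_measurable_indicator) auto
    show "AE z in lborel. norm (indicator disk z *\<^sub>R (cmod (f z))\<^sup>2) \<le> norm (indicator disk z *\<^sub>R C\<^sup>2)"
      using C by (intro AE_I2) (auto simp: indicator_def intro!: power_mono)
  qed
  then show ?thesis
    using hinfD(1,2)[OF assms] by (auto simp: bergman_functions_def)
qed

text \<open>
  A bounded pointwise limit is a weak-* limit: every matrix coefficient of the multiplication
  operators converges by dominated convergence, and the series of a trace functional converges by
  Tannery's theorem.
\<close>

lemma weak_star_closed_sequentially:
  assumes A: "dual_subalgebra A" and f: "\<And>n. f n \<in> A" "\<And>n z. cmod (f n z) \<le> C"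
    and lim: "\<And>z. (\<lambda>n. f n z) \<longlonglongrightarrow> g z" and g: "g \<in> hinf"
  shows "g \<in> A"
proof -
  have fh: "f n \<in> hinf" for n using f(1) dual_subalgebraD(1)[OF A] by blast
  have C: "0 \<le> C" using f(2)[of 0 0] norm_ge_zero order_trans by blast
  have gC: "cmod (g z) \<le> C" for z
    by (rule Lim_norm_ubound[OF _ lim]) (simp_all add: f(2))
  have term_lim: "(\<lambda>n. cinner (mult_op (f n) x) y) \<longlonglongrightarrow> cinner (mult_op g x) y" for x y
    unfolding cinner_mult_op[OF fh] cinner_mult_op[OF g] set_lebesgue_integral_def
  proof (rule integral_dominated_convergence)
    have xy: "set_integrable lborel disk (\<lambda>z. Rep_bergman x z * cnj (Rep_bergman y z))"
      by (rule bergman_functions_product_integrable[OF Rep_bergman Rep_bergman])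
    show "integrable lborel (\<lambda>z. C * norm (indicator disk z *\<^sub>R (Rep_bergman x z * cnj (Rep_bergman y z))))"
      using xy unfolding set_integrable_def by (intro integrable_mult_right integrable_norm)
    show "(\<lambda>z. indicator disk z *\<^sub>R (g z * Rep_bergman x z * cnj (Rep_bergman y z))) \<in> borel_measurable lborel"
      using bergman_functions_product_integrable[OF Rep_bergman Rep_bergman, of "mult_op g x" y]
      unfolding set_integrable_def Rep_mult_op[OF g] by (rule borel_measurable_integrable)
    show "(\<lambda>z. indicator disk z *\<^sub>R (f n z * Rep_bergman x z * cnj (Rep_bergman y z))) \<in> borel_measurable lborel" for n
      using bergman_functions_product_integrable[OF Rep_bergman Rep_bergman, of "mult_op (f n) x" y]
      unfolding set_integrable_def Rep_mult_op[OF fh] by (rule borel_measurable_integrable)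
    show "AE z in lborel. (\<lambda>n. indicator disk z *\<^sub>R (f n z * Rep_bergman x z * cnj (Rep_bergman y z)))
        \<longlonglongrightarrow> indicator disk z *\<^sub>R (g z * Rep_bergman x z * cnj (Rep_bergman y z))"
      by (intro AE_I2 tendsto_intros lim)
    show "AE z in lborel. norm (indicator disk z *\<^sub>R (f n z * Rep_bergman x z * cnj (Rep_bergman y z)))
        \<le> C * norm (indicator disk z *\<^sub>R (Rep_bergman x z * cnj (Rep_bergman y z)))" for n
      using f(2)[of n] by (intro AE_I2) (auto simp: norm_mult indicator_def mult.assoc intro!: mult_right_mono)
  qed
  have trace_lim: "(\<lambda>n. trace_functional x y (mult_op (f n))) \<longlonglongrightarrow> trace_functional x y (mult_op g)"
    if xy: "summable (\<lambda>k. (norm (x k))\<^sup>2)" "summable (\<lambda>k. (norm (y k))\<^sup>2)" for x y :: "nat \<Rightarrow> bergman"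
    unfolding trace_functional_def
  proof (rule tannerys_theorem[THEN conjunct2, THEN conjunct2])
    show "summable (\<lambda>k. C * ((norm (x k))\<^sup>2 + (norm (y k))\<^sup>2))"
      by (intro summable_mult summable_add xy)
    have "norm (cinner (mult_op (f n) (x k)) (y k)) \<le> C * ((norm (x k))\<^sup>2 + (norm (y k))\<^sup>2)" for n k
    proof -
      have "norm (cinner (mult_op (f n) (x k)) (y k)) \<le> norm (mult_op (f n) (x k)) * norm (y k)"
        by (rule cinner_Cauchy_Schwarz)
      also have "\<dots> \<le> (C * norm (x k)) * norm (y k)"
        by (intro mult_right_mono norm_mult_op_le[OF fh] f(2) C) simp
      also have "\<dots> = C * (norm (x k) * norm (y k))" by simp
      also have "norm (x k) * norm (y k) \<le> (norm (x k))\<^sup>2 + (norm (y k))\<^sup>2"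
        using sum_squares_bound[of "norm (x k)" "norm (y k)"]
          mult_nonneg_nonneg[OF norm_ge_zero[of "x k"] norm_ge_zero[of "y k"]] by linarith
      finally show ?thesis using C by (simp add: mult_left_mono)
    qed
    then show "\<forall>\<^sub>F (k, n) in sequentially \<times>\<^sub>F sequentially.
        norm (cinner (mult_op (f n) (x k)) (y k)) \<le> C * ((norm (x k))\<^sup>2 + (norm (y k))\<^sup>2)"
      by (simp add: case_prod_unfold)
  qed (simp_all add: term_lim)
  have "limitin weak_star_topology (\<lambda>n. mult_op (f n)) (mult_op g) sequentially"
    unfolding limitin_def
  proof (intro conjI allI impI)
    show "mult_op g \<in> topspace weak_star_topology"
      by (simp add: topspace_weak_star mult_op_bounded_operators g)
    fix U assume U: "openin weak_star_topology U \<and> mult_op g \<in> U"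
    then have "generate_topology_on {{T \<in> bounded_operators. trace_functional x y T \<in> U} | x y U.
       summable (\<lambda>k. (norm (x k))\<^sup>2) \<and> summable (\<lambda>k. (norm (y k))\<^sup>2) \<and> open U} U"
      unfolding weak_star_topology_def by (intro openin_topology_generated_by) simp
    then have "mult_op g \<in> U \<longrightarrow> (\<forall>\<^sub>F n in sequentially. mult_op (f n) \<in> U)"
    proof induction
      case (Int a b)
      then show ?case by (auto intro: eventually_conj)
    next
      case (UN K)
      show ?case
      proof
        assume "mult_op g \<in> \<Union>K"
        then obtain X where X: "X \<in> K" "mult_op g \<in> X" by blast
        then have "\<forall>\<^sub>F n in sequentially. mult_op (f n) \<in> X" using UN.IH by blast
        then show "\<forall>\<^sub>F n in sequentially. mult_op (f n) \<in> \<Union>K"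
          by eventually_elim (use X(1) in blast)
      qed
    next
      case (Basis s)
      then obtain x y V where s: "s = {T \<in> bounded_operators. trace_functional x y T \<in> V}"
        "summable (\<lambda>k. (norm (x k))\<^sup>2)" "summable (\<lambda>k. (norm (y k))\<^sup>2)" "open V" by blast
      show ?case
        using topological_tendstoD[OF trace_lim[OF s(2,3)] s(4)]
        by (auto simp: s(1) mult_op_bounded_operators fh elim: eventually_mono)
    qed simp
    then show "\<forall>\<^sub>F n in sequentially. mult_op (f n) \<in> U" using U by blast
  qed
  then have "mult_op g \<in> mult_op ` A"
    by (rule limitin_closedin[OF _ dual_subalgebraD(6)[OF A]]) (simp_all add: f(1))
  then obtain h where h: "h \<in> A" "mult_op g = mult_op h" by blast
  have hh: "h \<in> hinf" using h(1) dual_subalgebraD(1)[OF A] by blast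
  have one: "(indicator disk :: complex \<Rightarrow> complex) \<in> bergman_functions"
    by (rule hinf_bergman_functions[OF indicator_disk_hinf])
  have "g = h"
  proof
    fix z
    have "g z * Rep_bergman (Abs_bergman (indicator disk)) z = h z * Rep_bergman (Abs_bergman (indicator disk)) z"
      using h(2) Rep_mult_op[OF g] Rep_mult_op[OF hh] by metis
    then show "g z = h z"
      using hinfD(2)[OF g] hinfD(2)[OF hh] by (cases "z \<in> disk") (auto simp: Abs_bergman_inverse[OF one])
  qed
  then show ?thesis using h(1) by simp
qed

text \<open>
  Montel's theorem gives a locally uniform limit, which stays in the algebra by weak-* closedness; since
  the functions are uniformly bounded, the convergence also holds in the Bergman norm.
\<close>

lemma compact_scalar_unit_ball:
  assumes A: "dual_subalgebra A"
  shows "compact {g. Rep_bergman g \<in> A \<and> (\<forall>w\<in>disk. cmod (Rep_bergman g w) \<le> 1)}" (is "compact ?B")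
  unfolding compact_eq_seq_compact_metric seq_compact_def
proof (intro allI impI)
  fix f :: "nat \<Rightarrow> bergman" assume f: "\<forall>n. f n \<in> ?B"
  have le1: "cmod (Rep_bergman (f n) w) \<le> 1" for n w
    using f by (cases "w \<in> disk") (auto simp: Rep_bergman_outside)
  define \<H> where "\<H> = {h. h holomorphic_on disk \<and> (\<forall>w\<in>disk. cmod (h w) \<le> 1)}"
  obtain g r where g: "g holomorphic_on disk" and r: "strict_mono (r :: nat \<Rightarrow> nat)"
    and lim: "\<And>w. w \<in> disk \<Longrightarrow> ((\<lambda>n. Rep_bergman (f (r n)) w) \<longlongrightarrow> g w) sequentially"
  proof (rule Montel[of disk \<H> "\<lambda>n. Rep_bergman (f n)"])
    show "\<exists>B. \<forall>h\<in>\<H>. \<forall>z\<in>K. cmod (h z) \<le> B" if "compact K" "K \<subseteq> disk" for K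
      using that by (intro exI[of _ 1]) (auto simp: \<H>_def)
    show "range (\<lambda>n. Rep_bergman (f n)) \<subseteq> \<H>"
      using le1 by (auto simp: \<H>_def Rep_bergman_holomorphic)
  qed (auto simp: \<H>_def)
  define G where "G = (\<lambda>w. if w \<in> disk then g w else 0)"
  have limG: "(\<lambda>n. Rep_bergman (f (r n)) w) \<longlonglongrightarrow> G w" for w
    using lim by (cases "w \<in> disk") (auto simp: G_def Rep_bergman_outside)
  have G1: "cmod (G w) \<le> 1" for w
    by (rule Lim_norm_ubound[OF _ limG]) (simp_all add: le1)
  have "G holomorphic_on disk"
    using g by (rule holomorphic_transform) (simp add: G_def)
  then have Gh: "G \<in> hinf"
    by (rule hinfI[OF _ _ G1]) (simp add: G_def)
  have "G \<in> A"
    by (rule weak_star_closed_sequentially[OF A _ le1 limG Gh]) (use f in blast)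
  define L where "L = Abs_bergman G"
  have L: "Rep_bergman L = G"
    unfolding L_def by (rule Abs_bergman_inverse[OF hinf_bergman_functions[OF Gh]])
  have "(\<lambda>n. (norm (f (r n) - L))\<^sup>2) \<longlonglongrightarrow> (LINT z::complex|lborel. (0::real))"
    unfolding norm_bergman_squared set_lebesgue_integral_def
  proof (rule integral_dominated_convergence)
    show "integrable lborel (\<lambda>z. indicator disk z *\<^sub>R (4::real))"
      using set_integrable_disk_const[of "4::real"] by (simp only: set_integrable_def)
    show "(\<lambda>z. indicator disk z *\<^sub>R (cmod (Rep_bergman (f (r n) - L) z))\<^sup>2) \<in> borel_measurable lborel" for n
      using Rep_bergman_square_integrable unfolding set_integrable_def by (rule borel_measurable_integrable)
    show "AE z in lborel. (\<lambda>n. indicator disk z *\<^sub>R (cmod (Rep_bergman (f (r n) - L) z))\<^sup>2) \<longlonglongrightarrow> 0"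
    proof (rule AE_I2)
      fix z
      have "(\<lambda>n. indicator disk z *\<^sub>R (cmod (Rep_bergman (f (r n)) z - G z))\<^sup>2)
          \<longlonglongrightarrow> indicator disk z *\<^sub>R (cmod (G z - G z))\<^sup>2"
        by (intro tendsto_intros limG)
      then show "(\<lambda>n. indicator disk z *\<^sub>R (cmod (Rep_bergman (f (r n) - L) z))\<^sup>2) \<longlonglongrightarrow> 0"
        by (simp add: minus_bergman.rep_eq L)
    qed
    show "AE z in lborel. norm (indicator disk z *\<^sub>R (cmod (Rep_bergman (f (r n) - L) z))\<^sup>2)
        \<le> indicator disk z *\<^sub>R 4" for n
    proof (rule AE_I2)
      fix z
      have "cmod (Rep_bergman (f (r n) - L) z) \<le> 1 + 1"
        unfolding minus_bergman.rep_eq L by (intro order_trans[OF norm_triangle_ineq4] add_mono le1 G1)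
      then have "(cmod (Rep_bergman (f (r n) - L) z))\<^sup>2 \<le> 2\<^sup>2" by (intro power_mono) auto
      then show "norm (indicator disk z *\<^sub>R (cmod (Rep_bergman (f (r n) - L) z))\<^sup>2) \<le> indicator disk z *\<^sub>R 4"
        by (auto simp: indicator_def)
    qed
  qed simp
  then have "(\<lambda>n. sqrt ((norm (f (r n) - L))\<^sup>2)) \<longlonglongrightarrow> sqrt 0"
    by (intro tendsto_real_sqrt) simp
  then have "(f \<circ> r) \<longlonglongrightarrow> L"
    by (simp add: LIM_zero_iff tendsto_norm_zero_iff comp_def)
  moreover have "L \<in> ?B" using \<open>G \<in> A\<close> G1 by (simp add: L)
  ultimately show "\<exists>l\<in>?B. \<exists>r. strict_mono r \<and> (f \<circ> r) \<longlonglongrightarrow> l" using r by blast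
qed

lemma compact_Collect_vec:
  fixes K :: "'a::metric_space set"
  assumes "compact K"
  shows "compact {x :: 'a ^ 'n::finite. \<forall>i. x $ i \<in> K}"
  unfolding compact_eq_seq_compact_metric seq_compact_def
proof (intro allI impI)
  fix f :: "nat \<Rightarrow> 'a ^ 'n" assume "\<forall>n. f n \<in> {x. \<forall>i. x $ i \<in> K}"
  then have f: "f n $ i \<in> K" for n i by simp
  have "\<exists>l r. strict_mono (r :: nat \<Rightarrow> nat) \<and> (\<forall>i\<in>D. l i \<in> K \<and> (\<lambda>n. f (r n) $ i) \<longlonglongrightarrow> l i)"
    if "finite D" for D :: "'n set"
    using that
  proof induction
    case empty
    then show ?case by (auto intro!: exI[of _ id] strict_mono_id)
  next
    case (insert i D)
    then obtain l r where lr: "strict_mono (r :: nat \<Rightarrow> nat)"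
      "\<And>j. j \<in> D \<Longrightarrow> l j \<in> K \<and> (\<lambda>n. f (r n) $ j) \<longlonglongrightarrow> l j" by blast
    obtain m s where ms: "m \<in> K" "strict_mono (s :: nat \<Rightarrow> nat)" "((\<lambda>n. f (r n) $ i) \<circ> s) \<longlonglongrightarrow> m"
      using assms f unfolding compact_eq_seq_compact_metric
      by (elim seq_compactE[where f = "\<lambda>n. f (r n) $ i"]) blast+
    have "\<forall>j\<in>insert i D. (l(i := m)) j \<in> K \<and> (\<lambda>n. f ((r \<circ> s) n) $ j) \<longlonglongrightarrow> (l(i := m)) j"
      using ms lr(2) insert.hyps(2) LIMSEQ_subseq_LIMSEQ[OF _ ms(2)] by (auto simp: comp_def)
    then show ?case using strict_mono_o[OF lr(1) ms(2)] by blast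
  qed
  from this[OF finite] obtain l r where lr: "strict_mono (r :: nat \<Rightarrow> nat)"
    "\<And>i. l i \<in> K" "\<And>i. (\<lambda>n. f (r n) $ i) \<longlonglongrightarrow> l i" by blast
  have "(f \<circ> r) \<longlonglongrightarrow> (\<chi> i. l i)"
    by (rule vec_tendstoI) (simp add: comp_def lr(3))
  then show "\<exists>l\<in>{x. \<forall>i. x $ i \<in> K}. \<exists>r. strict_mono r \<and> (f \<circ> r) \<longlonglongrightarrow> l"
    using lr(1,2) by (intro bexI[of _ "\<chi> i. l i"] exI[of _ r]) auto
qed

definition symbol :: "bergman ^ 'r ^ 'r \<Rightarrow> complex \<Rightarrow> complex ^ 'r ^ 'r"
  where "symbol F w = (\<chi> a b. Rep_bergman (F $ a $ b) w)"

definition symbol_form :: "bergman ^ 'r ^ 'r \<Rightarrow> complex \<Rightarrow> complex ^ 'r \<Rightarrow> complex ^ 'r \<Rightarrow> complex"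
  where "symbol_form F w u v = (\<Sum>a\<in>UNIV. (symbol F w *v u) $ a * cnj (v $ a))"

text \<open>
  The unit ball of the matrices over \<open>A\<close> for the supremum norm, as a set of matrices of Bergman
  functions. The Hilbert space of these matrices makes the ball compact and represents the point
  evaluations by vectors.
\<close>

definition multiplier_ball :: "(complex \<Rightarrow> complex) set \<Rightarrow> (bergman ^ 'r ^ 'r) set"
  where "multiplier_ball A = {F. (\<forall>a b. Rep_bergman (F $ a $ b) \<in> A) \<and>
    (\<forall>w\<in>disk. \<forall>u. norm (symbol F w *v u) \<le> norm u)}"

lemma bounded_linear_symbol_entry:
  "bounded_linear (\<lambda>F :: bergman ^ 'r::finite ^ 'r. Rep_bergman (F $ a $ b) w)"
  by (rule bounded_linear_compose[OF bounded_linear_Rep_bergman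
        bounded_linear_compose[OF bounded_linear_vec_nth bounded_linear_vec_nth]])

lemma bounded_linear_symbol_vector:
  "bounded_linear (\<lambda>F :: bergman ^ 'r::finite ^ 'r. symbol F w *v u)"
  unfolding symbol_def matrix_vector_mult_def
  by (simp, intro bounded_linear_vec_lambda bounded_linear_sum bounded_linear_mult_const
      bounded_linear_symbol_entry)

lemma multiplier_ballD:
  assumes A: "dual_subalgebra A" and F: "F \<in> multiplier_ball A"
  shows "Rep_bergman (F $ a $ b) \<in> A" "Rep_bergman (F $ a $ b) \<in> hinf"
    "cmod (Rep_bergman (F $ a $ b) w) \<le> 1" "w \<in> disk \<Longrightarrow> norm (symbol F w *v u) \<le> norm u"
proof -
  show "Rep_bergman (F $ a $ b) \<in> A" and *: "w \<in> disk \<Longrightarrow> norm (symbol F w *v u) \<le> norm u" for w u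
    using F by (auto simp: multiplier_ball_def)
  then show "Rep_bergman (F $ a $ b) \<in> hinf" using dual_subalgebraD(1)[OF A] by blast
  show "cmod (Rep_bergman (F $ a $ b) w) \<le> 1"
  proof (cases "w \<in> disk")
    case True
    have "(symbol F w *v axis b 1) $ a = Rep_bergman (F $ a $ b) w"
      by (simp add: matrix_vector_mul_component symbol_def axis_def inner_vec_def matrix_vector_mult_def if_distrib cong: if_cong)
    then have "cmod (Rep_bergman (F $ a $ b) w) \<le> norm (symbol F w *v axis b 1)"
      using Finite_Cartesian_Product.norm_nth_le[of "symbol F w *v axis b 1" a] by simp
    also have "\<dots> \<le> 1" using *[OF True, of "axis b 1"] by simp
    finally show ?thesis .
  qed (simp add: Rep_bergman_outside)
qed

lemma compact_multiplier_ball: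
  assumes A: "dual_subalgebra A"
  shows "compact (multiplier_ball A :: (bergman ^ 'r::finite ^ 'r) set)"
proof -
  let ?K = "{g. Rep_bergman g \<in> A \<and> (\<forall>w\<in>disk. cmod (Rep_bergman g w) \<le> 1)}"
  have eq: "multiplier_ball A = {F :: bergman ^ 'r ^ 'r. \<forall>a. F $ a \<in> {x. \<forall>b. x $ b \<in> ?K}} \<inter>
      (\<Inter>w\<in>disk. \<Inter>u. {F. norm (symbol F w *v u) \<le> norm u})"
    using multiplier_ballD(3)[OF A] by (auto simp: multiplier_ball_def)
  have "closed {F :: bergman ^ 'r ^ 'r. norm (symbol F w *v u) \<le> norm u}" for w u
    by (intro closed_Collect_le continuous_intros bounded_linear.continuous_on[OF bounded_linear_symbol_vector])
  then show ?thesis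
    unfolding eq by (intro compact_Int_closed compact_Collect_vec compact_scalar_unit_ball[OF A] closed_INT) auto
qed

lemma multiplier_ball_convex:
  assumes A: "dual_subalgebra A"
  shows "convex (multiplier_ball A :: (bergman ^ 'r::finite ^ 'r) set)"
proof (rule convexI)
  fix F G :: "bergman ^ 'r ^ 'r" and s t :: real
  assume F: "F \<in> multiplier_ball A" and G: "G \<in> multiplier_ball A" and st: "0 \<le> s" "0 \<le> t" "s + t = 1"
  have "Rep_bergman ((s *\<^sub>R F + t *\<^sub>R G) $ a $ b) = (\<lambda>z. of_real s * Rep_bergman (F $ a $ b) z + of_real t * Rep_bergman (G $ a $ b) z)" for a b
    by (simp add: fun_eq_iff plus_bergman.rep_eq Rep_bergman_scaleR)
  then have "Rep_bergman ((s *\<^sub>R F + t *\<^sub>R G) $ a $ b) \<in> A" for a b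
    using multiplier_ballD(1)[OF A F] multiplier_ballD(1)[OF A G] by (simp add: dual_subalgebraD(3,5)[OF A])
  moreover have "norm (symbol (s *\<^sub>R F + t *\<^sub>R G) w *v u) \<le> norm u" if "w \<in> disk" for w u
  proof -
    interpret bounded_linear "\<lambda>F :: bergman ^ 'r ^ 'r. symbol F w *v u"
      by (rule bounded_linear_symbol_vector)
    have "symbol (s *\<^sub>R F + t *\<^sub>R G) w *v u = s *\<^sub>R (symbol F w *v u) + t *\<^sub>R (symbol G w *v u)"
      by (simp add: add scaleR)
    also have "norm \<dots> \<le> s * norm u + t * norm u"
      using st multiplier_ballD(4)[OF A F that] multiplier_ballD(4)[OF A G that]
      by (intro order_trans[OF norm_triangle_ineq] add_mono) (auto intro!: mult_left_mono)
    finally show ?thesis using st(3) by (simp flip: distrib_right)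
  qed
  ultimately show "s *\<^sub>R F + t *\<^sub>R G \<in> multiplier_ball A"
    by (simp add: multiplier_ball_def)
qed

lemma multiplier_ball_scaleI:
  fixes F :: "bergman ^ 'r::finite ^ 'r"
  assumes A: "dual_subalgebra A" and F: "\<And>a b. Rep_bergman (F $ a $ b) \<in> A"
    and le: "\<And>w u. w \<in> disk \<Longrightarrow> \<bar>t\<bar> * norm (symbol F w *v u) \<le> norm u"
  shows "t *\<^sub>R F \<in> multiplier_ball A"
proof -
  have "Rep_bergman ((t *\<^sub>R F) $ a $ b) = (\<lambda>z. of_real t * Rep_bergman (F $ a $ b) z)" for a b
    by (simp add: fun_eq_iff Rep_bergman_scaleR)
  then have "Rep_bergman ((t *\<^sub>R F) $ a $ b) \<in> A" for a b
    using dual_subalgebraD(5)[OF A F, of "of_real t" a b] by simp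
  moreover have "norm (symbol (t *\<^sub>R F) w *v u) \<le> norm u" if "w \<in> disk" for w u
  proof -
    interpret bounded_linear "\<lambda>F :: bergman ^ 'r ^ 'r. symbol F w *v u"
      by (rule bounded_linear_symbol_vector)
    show ?thesis using le[OF that] by (simp add: scaleR)
  qed
  ultimately show ?thesis by (simp add: multiplier_ball_def)
qed

lemma multiplier_ball_zero:
  assumes A: "dual_subalgebra A"
  shows "(0 :: bergman ^ 'r::finite ^ 'r) \<in> multiplier_ball A"
proof -
  have "(\<lambda>z. 0 * (indicator disk z :: complex)) \<in> A" by (intro dual_subalgebraD(5,2) A)
  moreover have "symbol 0 w *v u = 0" for w and u :: "complex ^ 'r"
    using bounded_linear.linear[OF bounded_linear_symbol_vector[of w u]] by (rule linear_0)
  ultimately show ?thesis by (simp add: multiplier_ball_def zero_bergman.rep_eq)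
qed

section \<open>Peak vectors\<close>

text \<open>
  For bounded \<open>h\<close> the radius of the disk may tend to 1.
\<close>

lemma set_integral_disk_taylor_coeff:
  assumes h: "h \<in> hinf"
  shows "(LINT z:disk|lborel. h z * cnj z ^ k * of_real (cmod z ^ (2 * m))) =
    (deriv ^^ k) h 0 / fact k * of_real (pi / (m + k + 1))"
proof -
  define r where "r = (\<lambda>n. 1 - inverse (real (Suc n)) / 2)"
  have r: "0 < r n" "r n < 1" for n
    by (auto simp: r_def field_simps)
  have "r \<longlonglongrightarrow> 1 - 0 / 2" unfolding r_def by (intro tendsto_intros LIMSEQ_inverse_real_of_nat) simp
  then have rlim: "r \<longlonglongrightarrow> 1" by simp
  obtain C where C: "0 \<le> C" "\<And>z. cmod (h z) \<le> C" using hinfD(3)[OF h] by blast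
  let ?b = "\<lambda>z. h z * cnj z ^ k * of_real (cmod z ^ (2 * m))"
  note hm = hinf_measurable[OF h]
  have bm: "?b \<in> borel_measurable borel"
    by (intro borel_measurable_times hm borel_measurable_continuous_onI continuous_intros)
  have bC: "cmod (?b z) \<le> C" if "z \<in> disk" for z
  proof -
    have "cmod (?b z) = cmod (h z) * (cmod z ^ k * cmod z ^ (2 * m))"
      by (simp add: norm_mult norm_power)
    also have "\<dots> \<le> C * 1"
      using C that by (intro mult_mono mult_le_one power_le_one) auto
    finally show ?thesis by simp
  qed
  have "(\<lambda>n. LINT z:ball 0 (r n)|lborel. ?b z) \<longlonglongrightarrow> (LINT z:disk|lborel. ?b z)"
    unfolding set_lebesgue_integral_def
  proof (rule integral_dominated_convergence)
    show "integrable lborel (\<lambda>z. indicator disk z *\<^sub>R C)"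
      using set_integrable_disk_const[of C] by (simp only: set_integrable_def)
    show "AE z in lborel. (\<lambda>n. indicator (ball 0 (r n)) z *\<^sub>R ?b z) \<longlonglongrightarrow> indicator disk z *\<^sub>R ?b z"
    proof (rule AE_I2)
      fix z :: complex
      have "\<forall>\<^sub>F n in sequentially. indicator (ball 0 (r n)) z *\<^sub>R ?b z = indicator disk z *\<^sub>R ?b z"
      proof (cases "z \<in> disk")
        case True
        then have "\<forall>\<^sub>F n in sequentially. cmod z < r n"
          using order_tendstoD(1)[OF rlim, of "cmod z"] by simp
        then show ?thesis by eventually_elim (use True in \<open>simp add: indicator_def\<close>)
      next
        case False
        then have "z \<notin> ball 0 (r n)" for n using r(2)[of n] by auto
        then show ?thesis using False by (simp add: indicator_def)
      qed
      then show "(\<lambda>n. indicator (ball 0 (r n)) z *\<^sub>R ?b z) \<longlonglongrightarrow> indicator disk z *\<^sub>R ?b z"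
        by (rule tendsto_eventually)
    qed
    show "AE z in lborel. norm (indicator (ball 0 (r n)) z *\<^sub>R ?b z) \<le> indicator disk z *\<^sub>R C" for n
      using bC r(2)[of n] C(1) by (intro AE_I2) (auto simp: indicator_def)
  qed (use bm in \<open>auto intro!: borel_measurable_scaleR borel_measurable_indicator\<close>)
  moreover have "(LINT z:ball 0 (r n)|lborel. ?b z)
      = (deriv ^^ k) h 0 / fact k * of_real (r n ^ (2 * (m + k) + 2) * (pi / (m + k + 1)))" for n
    unfolding set_integral_ball_taylor_coeff[OF hinfD(1)[OF h] r]
    by (simp only: set_integral_ball_scale[OF r(1)] set_integral_disk_moment of_nat_add)
  moreover have "(\<lambda>n. (deriv ^^ k) h 0 / fact k * of_real (r n ^ (2 * (m + k) + 2) * (pi / (m + k + 1))))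
      \<longlonglongrightarrow> (deriv ^^ k) h 0 / fact k * of_real (1 ^ (2 * (m + k) + 2) * (pi / (m + k + 1)))"
    by (intro tendsto_intros rlim)
  ultimately show ?thesis by (auto dest: LIMSEQ_unique)
qed

lemma set_integrable_disk_bounded:
  fixes h :: "complex \<Rightarrow> complex"
  assumes m: "h \<in> borel_measurable borel" and C: "\<And>z. z \<in> disk \<Longrightarrow> cmod (h z) \<le> C"
  shows "set_integrable lborel disk h"
  unfolding set_integrable_def
proof (rule Bochner_Integration.integrable_bound)
  show "integrable lborel (\<lambda>z. indicator disk z *\<^sub>R C)"
    using set_integrable_disk_const[of C] by (simp only: set_integrable_def)
  show "(\<lambda>z. indicator disk z *\<^sub>R h z) \<in> borel_measurable lborel"
    using m by (intro borel_measurable_scaleR borel_measurable_indicator) auto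
  show "AE z in lborel. norm (indicator disk z *\<^sub>R h z) \<le> norm (indicator disk z *\<^sub>R C)"
    using C by (intro AE_I2) (fastforce simp: indicator_def)
qed

lemma taylor_coeff_bound:
  assumes h: "h \<in> hinf" and C: "\<And>z. cmod (h z) \<le> C"
  shows "cmod ((deriv ^^ k) h 0 / fact k) \<le> 2 * C"
proof -
  let ?b = "\<lambda>z. h z * cnj z ^ k * of_real (cmod z ^ (2 * k))"
  have C0: "0 \<le> C" using C[of 0] norm_ge_zero order_trans by blast
  note hm = hinf_measurable[OF h]
  have bm: "?b \<in> borel_measurable borel"
    by (intro borel_measurable_times hm borel_measurable_continuous_onI continuous_intros)
  have bC: "cmod (?b z) \<le> C * cmod z ^ (2 * k)" if "z \<in> disk" for z
  proof -
    have "cmod (?b z) = cmod (h z) * cmod z ^ k * cmod z ^ (2 * k)"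
      by (simp add: norm_mult norm_power)
    also have "\<dots> \<le> C * 1 * cmod z ^ (2 * k)"
      using C C0 that by (intro mult_mono power_le_one) auto
    finally show ?thesis by simp
  qed
  have int: "set_integrable lborel disk ?b"
    using bm
  proof (rule set_integrable_disk_bounded)
    show "cmod (?b z) \<le> C" if "z \<in> disk" for z
      using bC[OF that] mult_left_mono[OF power_le_one C0, of "cmod z" "2 * k"] that by simp
  qed
  have "cmod ((deriv ^^ k) h 0 / fact k) * (pi / (k + k + 1)) = cmod (LINT z:disk|lborel. ?b z)"
    unfolding set_integral_disk_taylor_coeff[OF h] norm_mult norm_of_real by simp
  also have "\<dots> \<le> (LINT z:disk|lborel. cmod (?b z))"
    by (rule set_integral_norm_bound[OF int])
  also have "\<dots> \<le> (LINT z:disk|lborel. C * cmod z ^ (2 * k))"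
    by (intro set_integral_mono set_integrable_norm int set_integrable_ball_continuous continuous_intros bC)
  also have "\<dots> = C * (pi / (k + 1))" by (simp add: set_integral_disk_moment)
  finally have le: "cmod ((deriv ^^ k) h 0 / fact k) * (pi / (k + k + 1)) \<le> C * (pi / (k + 1))" .
  define x where "x = cmod ((deriv ^^ k) h 0 / fact k)"
  define p q where "p = real (k + k + 1)" and "q = real (k + 1)"
  have pq: "0 < p" "0 < q" "p \<le> 2 * q" by (auto simp: p_def q_def)
  have "x * (pi / p) * (p * q / pi) \<le> C * (pi / q) * (p * q / pi)"
    using le pq by (intro mult_right_mono) (auto simp: x_def p_def q_def)
  then have "x * q \<le> C * p" using pq by simp
  also have "\<dots> \<le> C * (2 * q)" using C0 pq by (intro mult_left_mono) auto
  finally have "x * q \<le> (2 * C) * q" by simp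
  then show ?thesis using pq(2) by (simp only: x_def mult_le_cancel_right_pos)
qed

lemma szego_denominator_bound:
  assumes "z \<in> disk"
  shows "1 - cmod l \<le> cmod (1 - cnj l * z)"
proof -
  have "cmod (cnj l * z) \<le> cmod l * 1"
    unfolding norm_mult using assms by (intro mult_mono) auto
  then show ?thesis using norm_triangle_ineq2[of 1 "cnj l * z"] by simp
qed

text \<open>
  The weight \<open>\<bar>s\<bar>\<^sup>2\<close>, for the Szego kernel \<open>s\<close> at \<open>l\<close>, is up to the factor \<open>1 - \<bar>l\<bar>\<^sup>2\<close> the Poisson kernel
  on the circle, and the probability measure with the density \<open>(m + 1) / pi * \<bar>z\<bar>\<^bsup>2m\<^esup>\<close> approaches the
  normalized arc length there. Expanding \<open>cnj s\<close> in powers of \<open>cnj z\<close> turns the integral into the Taylor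
  series of \<open>f s\<close> at \<open>l\<close>, with the \<open>k\<close>-th term multiplied by \<open>(m + 1) / (m + k + 1)\<close>.
\<close>

lemma szego_weight_integral:
  assumes l: "l \<in> disk" and f: "f \<in> hinf" "\<And>z. cmod (f z) \<le> 1"
  defines "s \<equiv> \<lambda>z. 1 / (1 - cnj l * z)"
  shows "cmod (of_real (real (m + 1) / pi * (1 - (cmod l)\<^sup>2)) *
      (LINT z:disk|lborel. f z * s z * cnj (s z) * of_real (cmod z ^ (2 * m))) - f l)
    \<le> 2 / (1 - cmod l) * (\<Sum>k. k * cmod l ^ k) / real (m + 1)"
proof -
  define t where "t = cmod l"
  have t: "0 \<le> t" "t < 1" using l by (auto simp: t_def)
  define h where "h = (\<lambda>z. f z * s z)"
  note den = szego_denominator_bound[of _ l, folded t_def]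
  have sC: "cmod (s z) \<le> 1 / (1 - t)" if "z \<in> disk" for z
    unfolding s_def norm_divide using den[OF that] t by (auto intro!: frac_le)
  have hC: "cmod (h z) \<le> 1 / (1 - t)" for z
  proof (cases "z \<in> disk")
    case True
    have "cmod (h z) \<le> 1 * (1 / (1 - t))"
      unfolding h_def norm_mult using f(2)[of z] sC[OF True] by (intro mult_mono) auto
    then show ?thesis by simp
  qed (use t in \<open>simp add: h_def hinfD(2)[OF f(1)]\<close>)
  have hh: "h \<in> hinf"
  proof (rule hinfI[OF _ _ hC])
    have "1 - cnj l * z \<noteq> 0" if "z \<in> disk" for z using den[OF that] t by auto
    then show "h holomorphic_on disk"
      unfolding h_def s_def by (intro holomorphic_intros hinfD(1)[OF f(1)]) auto
  qed (simp add: h_def hinfD(2)[OF f(1)])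
  define a where "a = (\<lambda>k. (deriv ^^ k) h 0 / fact k)"
  have a_bound: "cmod (a k) \<le> 2 / (1 - t)" for k
    using taylor_coeff_bound[OF hh hC, of k] by (simp add: a_def)
  note hm = hinf_measurable[OF hh]
  let ?b = "\<lambda>k z. h z * cnj z ^ k * of_real (cmod z ^ (2 * m))"
  have bm: "?b k \<in> borel_measurable borel" for k
    by (intro borel_measurable_times hm borel_measurable_continuous_onI continuous_intros)
  have b1: "cmod (?b k z) \<le> 1 / (1 - t)" if "z \<in> disk" for k z
  proof -
    have "cmod (?b k z) = cmod (h z) * (cmod z ^ k * cmod z ^ (2 * m))"
      by (simp add: norm_mult norm_power)
    also have "\<dots> \<le> 1 / (1 - t) * 1"
      using hC[of z] that t by (intro mult_mono mult_le_one power_le_one) auto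
    finally show ?thesis by simp
  qed
  have geo: "(\<lambda>k. (l * cnj z) ^ k) sums cnj (s z)" if "z \<in> disk" for z
  proof -
    have "cmod (l * cnj z) \<le> t * 1" unfolding norm_mult t_def using that by (intro mult_mono) auto
    then show ?thesis using t geometric_sums[of "l * cnj z"] by (simp add: s_def)
  qed
  have "(\<lambda>K. LINT z:disk|lborel. \<Sum>k<K. l ^ k * ?b k z) \<longlonglongrightarrow> (LINT z:disk|lborel. cnj (s z) * ?b 0 z)"
    unfolding set_lebesgue_integral_def
  proof (rule integral_dominated_convergence)
    show "integrable lborel (\<lambda>z. indicator disk z *\<^sub>R (1 / (1 - t) * (1 / (1 - t))))"
      using set_integrable_disk_const[of "1 / (1 - t) * (1 / (1 - t))"] by (simp only: set_integrable_def)
    have pw: "(\<lambda>K. \<Sum>k<K. l ^ k * ?b k z) \<longlonglongrightarrow> cnj (s z) * ?b 0 z" if "z \<in> disk" for z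
      using tendsto_mult_right[OF geo[OF that, unfolded sums_def], of "?b 0 z"]
      by (simp add: sum_distrib_left power_mult_distrib mult_ac)
    show conv: "AE z in lborel. (\<lambda>K. indicator disk z *\<^sub>R (\<Sum>k<K. l ^ k * ?b k z))
        \<longlonglongrightarrow> indicator disk z *\<^sub>R (cnj (s z) * ?b 0 z)"
      using pw by (intro AE_I2) (simp add: indicator_def)
    show meas: "(\<lambda>z. indicator disk z *\<^sub>R (\<Sum>k<K. l ^ k * ?b k z)) \<in> borel_measurable lborel" for K
    proof -
      have "(\<lambda>z. \<Sum>k<K. l ^ k * ?b k z) \<in> borel_measurable borel"
        by (intro borel_measurable_sum borel_measurable_times[OF borel_measurable_const bm])
      then show ?thesis by (intro borel_measurable_scaleR borel_measurable_indicator) auto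
    qed
    have "(\<lambda>z. indicator disk z *\<^sub>R (cnj (s z) * ?b 0 z)) \<in> borel_measurable borel"
    proof (rule borel_measurable_LIMSEQ_metric)
      show "(\<lambda>z. indicator disk z *\<^sub>R (\<Sum>k<K. l ^ k * ?b k z)) \<in> borel_measurable borel" for K
        using meas[of K] by simp
      show "(\<lambda>K. indicator disk z *\<^sub>R (\<Sum>k<K. l ^ k * ?b k z)) \<longlonglongrightarrow> indicator disk z *\<^sub>R (cnj (s z) * ?b 0 z)" for z
        using pw[of z] by (simp add: indicator_def)
    qed
    then show "(\<lambda>z. indicator disk z *\<^sub>R (cnj (s z) * ?b 0 z)) \<in> borel_measurable lborel" by simp
    show "AE z in lborel. norm (indicator disk z *\<^sub>R (\<Sum>k<K. l ^ k * ?b k z))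
        \<le> indicator disk z *\<^sub>R (1 / (1 - t) * (1 / (1 - t)))" for K
    proof (rule AE_I2)
      fix z
      have "norm (\<Sum>k<K. l ^ k * ?b k z) \<le> 1 / (1 - t) * (1 / (1 - t))" if z: "z \<in> disk"
      proof -
        have "norm (\<Sum>k<K. l ^ k * ?b k z) \<le> (\<Sum>k<K. t ^ k * (1 / (1 - t)))"
          unfolding t_def by (intro sum_norm_le) (simp only: norm_mult norm_power, intro mult_left_mono,
              use b1[OF z] in \<open>simp_all add: norm_mult norm_power t_def\<close>)
        also have "\<dots> = (\<Sum>k<K. t ^ k) * (1 / (1 - t))" by (rule sum_distrib_right[symmetric])
        also have "\<dots> \<le> (1 / (1 - t)) * (1 / (1 - t))"
          using t sum_le_suminf[of "\<lambda>k. t ^ k" "{..<K}"] by (intro mult_right_mono) (simp_all add: suminf_geometric)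
        finally show ?thesis .
      qed
      then show "norm (indicator disk z *\<^sub>R (\<Sum>k<K. l ^ k * ?b k z)) \<le> indicator disk z *\<^sub>R (1 / (1 - t) * (1 / (1 - t)))"
        by (cases "z \<in> disk") simp_all
    qed
  qed
  moreover have "(LINT z:disk|lborel. \<Sum>k<K. l ^ k * ?b k z) = (\<Sum>k<K. l ^ k * (a k * of_real (pi / (m + k + 1))))" for K
  proof -
    have int: "set_integrable lborel disk (\<lambda>z. l ^ k * ?b k z)" for k
      by (rule set_integrable_mult_right, rule set_integrable_disk_bounded[OF bm b1])
    have "(LINT z:disk|lborel. \<Sum>k<K. l ^ k * ?b k z) = (\<Sum>k<K. LINT z:disk|lborel. l ^ k * ?b k z)"
      unfolding set_lebesgue_integral_def scaleR_sum_right
      using int unfolding set_integrable_def by (intro Bochner_Integration.integral_sum)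
    then show ?thesis
      by (simp only: set_integral_mult_right set_integral_disk_taylor_coeff[OF hh] a_def)
  qed
  ultimately have I: "(\<lambda>k. l ^ k * (a k * of_real (pi / (m + k + 1)))) sums (LINT z:disk|lborel. cnj (s z) * ?b 0 z)"
    by (simp add: sums_def)
  have T: "(\<lambda>k. a k * l ^ k) sums h l"
    using holomorphic_power_series[OF hinfD(1)[OF hh] l] by (simp add: a_def)
  define I0 where "I0 = (LINT z:disk|lborel. cnj (s z) * ?b 0 z)"
  have diff: "(\<lambda>k. a k * l ^ k * of_real (- (k / (m + k + 1)))) sums ((m + 1) / pi * I0 - h l)"
  proof -
    have eq: "of_real ((m + 1) / pi) * (l ^ k * (a k * of_real (pi / (m + k + 1)))) - a k * l ^ k
        = a k * l ^ k * of_real (- (k / (m + k + 1)))" for k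
    proof -
      have "N / pi * (pi / (N + x)) - 1 = - (x / (N + x))" if "0 < N" "0 \<le> x" for N x :: real
        using that by (simp add: field_simps)
      from this[of "real (m + 1)" "real k"]
      have "(m + 1) / pi * (pi / (m + k + 1)) - 1 = - (k / (m + k + 1))"
        by (simp add: add_ac)
      from arg_cong[OF this, of complex_of_real]
      have "of_real ((m + 1) / pi) * of_real (pi / (m + k + 1)) - 1 = (of_real (- (k / (m + k + 1))) :: complex)"
        by (simp only: of_real_mult of_real_1 of_real_diff)
      moreover have "c * (x * (y * d)) - y * x = y * x * (c * d - 1)" for c d x y :: complex
        by (simp add: algebra_simps)
      ultimately show ?thesis by (simp only:)
    qed
    from sums_diff[OF sums_mult[OF I, of "of_real ((m + 1) / pi)"] T] show ?thesis
      unfolding eq I0_def by simp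
  qed
  have summ: "summable (\<lambda>k. k * t ^ k)"
  proof (rule summable_comparison_test')
    show "summable (\<lambda>k. real (Suc k) * t ^ k)"
      using geometric_deriv_sums[of t] t by (auto simp: sums_iff)
    show "norm (k * t ^ k) \<le> real (Suc k) * t ^ k" for k
      using t by (auto intro!: mult_right_mono)
  qed
  have "cmod ((m + 1) / pi * I0 - h l) \<le> (\<Sum>k. 2 / (1 - t) / (m + 1) * (k * t ^ k))"
    unfolding sums_unique[OF diff]
  proof (rule norm_suminf_le[OF _ summable_mult[OF summ]])
    fix k
    have "norm (a k * l ^ k * of_real (- (k / (m + k + 1)))) = cmod (a k) * t ^ k * (k / (m + k + 1))"
      unfolding norm_mult norm_of_real norm_power t_def by simp
    also have "\<dots> \<le> 2 / (1 - t) * t ^ k * (k / (m + 1))"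
      using a_bound[of k] t by (intro mult_mono frac_le) auto
    finally show "norm (a k * l ^ k * of_real (- (k / (m + k + 1)))) \<le> 2 / (1 - t) / (m + 1) * (k * t ^ k)"
      by (simp add: mult_ac)
  qed
  also have "\<dots> = 2 / (1 - t) * (\<Sum>k. k * t ^ k) / (m + 1)"
    by (subst suminf_mult[OF summ]) simp
  finally have bound: "cmod ((m + 1) / pi * I0 - h l) \<le> 2 / (1 - t) * (\<Sum>k. k * t ^ k) / (m + 1)" .
  have sl: "(1 - t\<^sup>2) * h l = f l"
  proof -
    have "complex_of_real (t\<^sup>2) = cnj l * l" by (simp only: t_def complex_norm_square mult.commute)
    moreover have "1 - cnj l * l \<noteq> 0" using den[OF l] t by auto
    ultimately show ?thesis by (simp add: h_def s_def)
  qed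
  have t2: "0 \<le> 1 - t\<^sup>2" "1 - t\<^sup>2 \<le> 1" using t by (auto simp: power_le_one)
  have "(m + 1) / pi * (1 - t\<^sup>2) * I0 - f l = (1 - t\<^sup>2) * ((m + 1) / pi * I0 - h l)"
    unfolding sl[symmetric]
    by (simp only: of_real_mult right_diff_distrib[of "of_real (1 - t\<^sup>2)"] mult.assoc mult.left_commute[of "of_real (1 - t\<^sup>2)"])
  then have "cmod ((m + 1) / pi * (1 - t\<^sup>2) * I0 - f l) = (1 - t\<^sup>2) * cmod ((m + 1) / pi * I0 - h l)"
    using t2(1) by (simp only: norm_mult norm_of_real abs_of_nonneg)
  also have "\<dots> \<le> 1 * (2 / (1 - t) * (\<Sum>k. k * t ^ k) / (m + 1))"
    using t2 bound by (intro mult_mono) auto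
  also have "I0 = (LINT z:disk|lborel. f z * s z * cnj (s z) * of_real (cmod z ^ (2 * m)))"
    by (simp add: I0_def h_def mult_ac)
  finally show ?thesis by (simp only: t_def mult_1_left)
qed

text \<open>
  The vectors are the normalized multiples of \<open>s z\<^bsup>2j\<^esup>\<close> for large \<open>j\<close>, with \<open>s\<close> the Szego kernel at \<open>l\<close>. Their
  squared moduli represent the evaluation at \<open>l\<close> up to a small error. Their mass moves to the boundary, which makes their products
  with any fixed square integrable function small in the \<open>L\<^sup>1\<close> norm.
\<close>

lemma peak_vector_exists:
  assumes l: "l \<in> disk" and X: "finite X" and e: "0 < e"
  obtains g where "Rep_bergman g \<in> hinf"
    "\<And>f. f \<in> hinf \<Longrightarrow> (\<And>z. cmod (f z) \<le> 1) \<Longrightarrow> cmod (cinner (mult_op f g) g - f l) \<le> e"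
    "\<And>f w. f \<in> hinf \<Longrightarrow> (\<And>z. cmod (f z) \<le> 1) \<Longrightarrow> w \<in> X \<Longrightarrow> cmod (cinner (mult_op f g) w) \<le> e"
    "\<And>f w. f \<in> hinf \<Longrightarrow> (\<And>z. cmod (f z) \<le> 1) \<Longrightarrow> w \<in> X \<Longrightarrow> cmod (cinner (mult_op f w) g) \<le> e"
proof -
  define t where "t = cmod l"
  have t: "0 \<le> t" "t < 1" using l by (auto simp: t_def)
  define s where "s = (\<lambda>z. 1 / (1 - cnj l * z))"
  note den = szego_denominator_bound[of _ l, folded t_def]
  have sC: "cmod (s z) \<le> 1 / (1 - t)" if "z \<in> disk" for z
    unfolding s_def norm_divide using den[OF that] t by (auto intro!: frac_le)


  have t2: "0 \<le> 1 - t\<^sup>2" "1 - t\<^sup>2 \<le> 1" using t by (auto simp: power_le_one)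
  define c where "c = (\<lambda>j::nat. sqrt (real (2 * j + 1) / pi * (1 - t\<^sup>2)))"
  have c2: "(c j)\<^sup>2 = real (2 * j + 1) / pi * (1 - t\<^sup>2)" "0 \<le> c j" for j
    unfolding c_def using t2 by auto
  define G where "G = (\<lambda>j z. if z \<in> disk then of_real (c j) * z ^ (2 * j) * s z else 0)"
  have G_bound: "cmod (G j z) \<le> c j * cmod z ^ (2 * j) * (1 / (1 - t))" for j z
  proof (cases "z \<in> disk")
    case True
    have "cmod (G j z) = c j * cmod z ^ (2 * j) * cmod (s z)"
      using True c2(2)[of j] by (simp add: G_def norm_mult norm_power)
    also have "\<dots> \<le> c j * cmod z ^ (2 * j) * (1 / (1 - t))"
      using sC[OF True] c2(2)[of j] by (intro mult_left_mono) auto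
    finally show ?thesis .
  qed (use c2(2)[of j] t in \<open>simp add: G_def\<close>)
  have Gh: "G j \<in> hinf" for j
  proof (rule hinfI)
    have "1 - cnj l * z \<noteq> 0" if "z \<in> disk" for z using den[OF that] t by auto
    then have "(\<lambda>z. of_real (c j) * z ^ (2 * j) * s z) holomorphic_on disk"
      unfolding s_def by (intro holomorphic_intros) auto
    then show "G j holomorphic_on disk"
      by (rule holomorphic_transform) (simp add: G_def)
    show "cmod (G j z) \<le> c j * 1 * (1 / (1 - t))" if "z \<in> disk" for z
      using that t c2(2)[of j]
      by (intro order_trans[OF G_bound] mult_right_mono mult_left_mono power_le_one) auto
  qed (simp add: G_def)
  define g where "g = (\<lambda>j. Abs_bergman (G j))"
  have g: "Rep_bergman (g j) = G j" for j
    unfolding g_def by (rule Abs_bergman_inverse[OF hinf_bergman_functions[OF Gh]])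
  define J where "J = (\<lambda>j w. LINT z:disk|lborel. cmod (Rep_bergman w z * cnj (G j z)))"
  have J_int: "set_integrable lborel disk (\<lambda>z. cmod (Rep_bergman w z * cnj (G j z)))" for j w
    using bergman_functions_product_integrable[OF Rep_bergman Rep_bergman, of w "g j"]
    unfolding g by (rule set_integrable_norm)
  have bound: "cmod (LINT z:disk|lborel. k z) \<le> J j w"
    if k: "set_integrable lborel disk k" "\<And>z. cmod (k z) \<le> cmod (Rep_bergman w z * cnj (G j z))" for k j w
    unfolding J_def
    by (rule order_trans[OF set_integral_norm_bound[OF k(1)]])
      (intro set_integral_mono set_integrable_norm k J_int)
  have J1: "cmod (cinner (mult_op f (g j)) w) \<le> J j w"
    and J2: "cmod (cinner (mult_op f w) (g j)) \<le> J j w"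
    if f: "f \<in> hinf" "\<And>z. cmod (f z) \<le> 1" for f j w
  proof -
    have le: "cmod (f z) * (cmod (Rep_bergman w z) * cmod (G j z)) \<le> cmod (Rep_bergman w z) * cmod (G j z)" for z
      using f(2)[of z] by (intro mult_left_le_one_le) auto
    show "cmod (cinner (mult_op f (g j)) w) \<le> J j w"
      unfolding cinner_mult_op[OF f(1)] g
    proof (rule bound)
      show "set_integrable lborel disk (\<lambda>z. f z * G j z * cnj (Rep_bergman w z))"
        using bergman_functions_product_integrable[OF Rep_bergman Rep_bergman, of "mult_op f (g j)" w]
        by (simp add: Rep_mult_op[OF f(1)] g)
    qed (use le in \<open>simp add: norm_mult mult_ac\<close>)
    show "cmod (cinner (mult_op f w) (g j)) \<le> J j w"
      unfolding cinner_mult_op[OF f(1)] g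
    proof (rule bound)
      show "set_integrable lborel disk (\<lambda>z. f z * Rep_bergman w z * cnj (G j z))"
        using bergman_functions_product_integrable[OF Rep_bergman Rep_bergman, of "mult_op f w" "g j"]
        by (simp add: Rep_mult_op[OF f(1)] g)
    qed (use le in \<open>simp add: norm_mult mult_ac\<close>)
  qed
  have ev_J: "\<forall>\<^sub>F j in sequentially. J j w \<le> e" for w
  proof -
    define I where "I = (\<lambda>j. LINT z:disk|lborel. cmod z ^ (2 * j) * (cmod (Rep_bergman w z))\<^sup>2)"
    have I_meas: "(\<lambda>z. indicator disk z *\<^sub>R (cmod z ^ (2 * j) * (cmod (Rep_bergman w z))\<^sup>2)) \<in> borel_measurable borel" for j
    proof -
      have "(\<lambda>z::complex. cmod z ^ (2 * j)) \<in> borel_measurable borel"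
        by (intro borel_measurable_continuous_onI continuous_intros)
      then show ?thesis
        using Rep_bergman_measurable[of w]
        by (intro borel_measurable_scaleR borel_measurable_indicator borel_measurable_times
            borel_measurable_power[OF borel_measurable_norm]) auto
    qed
    have dom: "norm (indicator disk z *\<^sub>R (cmod z ^ (2 * j) * (cmod (Rep_bergman w z))\<^sup>2))
        \<le> indicator disk z *\<^sub>R (cmod (Rep_bergman w z))\<^sup>2" for j z
      by (cases "z \<in> disk") (auto simp: norm_mult intro!: mult_left_le_one_le power_le_one)
    have I_int: "set_integrable lborel disk (\<lambda>z. cmod z ^ (2 * j) * (cmod (Rep_bergman w z))\<^sup>2)" for j
      unfolding set_integrable_def
    proof (rule Bochner_Integration.integrable_bound)
      show "integrable lborel (\<lambda>z. indicator disk z *\<^sub>R (cmod (Rep_bergman w z))\<^sup>2)"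
        using Rep_bergman_square_integrable[of w] by (simp only: set_integrable_def)
      show "AE z in lborel. norm (indicator disk z *\<^sub>R (cmod z ^ (2 * j) * (cmod (Rep_bergman w z))\<^sup>2))
          \<le> norm (indicator disk z *\<^sub>R (cmod (Rep_bergman w z))\<^sup>2)"
        by (intro AE_I2 order_trans[OF dom]) simp
    qed (use I_meas in simp)
    have I_lim: "I \<longlonglongrightarrow> (LINT z::complex|lborel. (0::real))"
      unfolding I_def set_lebesgue_integral_def
    proof (rule integral_dominated_convergence)
      show "integrable lborel (\<lambda>z. indicator disk z *\<^sub>R (cmod (Rep_bergman w z))\<^sup>2)"
        using Rep_bergman_square_integrable[of w] by (simp only: set_integrable_def)
      show "AE z in lborel. (\<lambda>j. indicator disk z *\<^sub>R (cmod z ^ (2 * j) * (cmod (Rep_bergman w z))\<^sup>2)) \<longlonglongrightarrow> 0"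
      proof (rule AE_I2)
        fix z :: complex
        show "(\<lambda>j. indicator disk z *\<^sub>R (cmod z ^ (2 * j) * (cmod (Rep_bergman w z))\<^sup>2)) \<longlonglongrightarrow> 0"
        proof (cases "z \<in> disk")
          case True
          then have "(\<lambda>j. ((cmod z)\<^sup>2) ^ j * (cmod (Rep_bergman w z))\<^sup>2) \<longlonglongrightarrow> 0 * (cmod (Rep_bergman w z))\<^sup>2"
            by (intro tendsto_intros LIMSEQ_power_zero) (simp add: power_less_one_iff)
          then show ?thesis using True by (simp add: power_mult)
        qed simp
      qed
    qed (use I_meas dom in auto)
    \<comment> \<open>The weight in \<open>a b \<le> d a\<^sup>2 + b\<^sup>2 / d\<close>: the first summand contributes at most half of \<open>e\<close>, and the
      second one tends to 0.\<close>
    define d where "d = e * (1 - t) / 4"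
    have d: "0 < d" using e t by (simp add: d_def)
    have i1: "set_integrable lborel disk (\<lambda>z. d * (c j)\<^sup>2 * cmod z ^ (2 * j))" for j
      by (intro set_integrable_ball_continuous continuous_intros)
    have i2: "set_integrable lborel disk (\<lambda>z. 1 / d * (cmod z ^ (2 * j) * (cmod (Rep_bergman w z))\<^sup>2))" for j
      by (rule set_integrable_mult_right) (rule I_int)
    have J_le: "J j w \<le> (2 * d + I j / d) / (1 - t)" for j
    proof -
      have "J j w \<le> (LINT z:disk|lborel. 1 / (1 - t) * (d * (c j)\<^sup>2 * cmod z ^ (2 * j) + 1 / d * (cmod z ^ (2 * j) * (cmod (Rep_bergman w z))\<^sup>2)))"
        unfolding J_def
      proof (rule set_integral_mono[OF J_int])
        show "set_integrable lborel disk (\<lambda>z. 1 / (1 - t) * (d * (c j)\<^sup>2 * cmod z ^ (2 * j) + 1 / d * (cmod z ^ (2 * j) * (cmod (Rep_bergman w z))\<^sup>2)))"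
          by (rule set_integrable_mult_right) (rule set_integral_add(1)[OF i1 i2])
        fix z assume "z \<in> disk"
        define x where "x = cmod (Rep_bergman w z)"
        have "0 \<le> (sqrt d * c j - x / sqrt d)\<^sup>2" by simp
        also have "\<dots> = d * (c j)\<^sup>2 + 1 / d * x\<^sup>2 - 2 * (c j * x)"
          using d by (simp add: power2_diff power_mult_distrib power_divide)
        finally have "2 * (c j * x) \<le> d * (c j)\<^sup>2 + 1 / d * x\<^sup>2" by simp
        moreover have "0 \<le> c j * x" using c2(2)[of j] by (simp add: x_def)
        ultimately have am: "c j * x \<le> d * (c j)\<^sup>2 + 1 / d * x\<^sup>2" by linarith
        have "cmod (Rep_bergman w z * cnj (G j z)) \<le> x * (c j * cmod z ^ (2 * j) * (1 / (1 - t)))"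
          unfolding norm_mult complex_mod_cnj x_def by (intro mult_left_mono G_bound) simp
        also have "\<dots> = (cmod z ^ (2 * j) * (1 / (1 - t))) * (c j * x)" by simp
        also have "\<dots> \<le> (cmod z ^ (2 * j) * (1 / (1 - t))) * (d * (c j)\<^sup>2 + 1 / d * x\<^sup>2)"
          using t by (intro mult_left_mono am) auto
        finally show "cmod (Rep_bergman w z * cnj (G j z))
            \<le> 1 / (1 - t) * (d * (c j)\<^sup>2 * cmod z ^ (2 * j) + 1 / d * (cmod z ^ (2 * j) * (cmod (Rep_bergman w z))\<^sup>2))"
          unfolding x_def by (simp add: algebra_simps add_divide_distrib)
      qed
      also have "\<dots> = 1 / (1 - t) * (d * (c j)\<^sup>2 * (pi / (j + 1)) + 1 / d * I j)"
        unfolding set_integral_mult_right I_def set_integral_add(2)[OF i1 i2] set_integral_disk_moment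
        by simp
      also have "\<dots> \<le> 1 / (1 - t) * (d * 2 + 1 / d * I j)"
      proof -
        have "(c j)\<^sup>2 * (pi / (j + 1)) = (1 - t\<^sup>2) * (real (2 * j + 1) / (j + 1))"
        proof -
          have "a / pi * u * (pi / b) = u * (a / b)" for a b u :: real by simp
          then show ?thesis unfolding c2 .
        qed
        also have "\<dots> \<le> 1 * 2" using t2 by (intro mult_mono) (auto simp: field_simps)
        finally have "d * ((c j)\<^sup>2 * (pi / (j + 1))) \<le> d * 2" using d by (intro mult_left_mono) auto
        then show ?thesis using t by (intro mult_left_mono add_right_mono) (auto simp: mult.assoc)
      qed
      finally show ?thesis by (simp add: mult.commute)
    qed
    have "I \<longlonglongrightarrow> 0" using I_lim by simp
    moreover have "0 < 2 * d * d" using d by simp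
    ultimately have "\<forall>\<^sub>F j in sequentially. I j < 2 * d * d" by (rule order_tendstoD)
    then show ?thesis
    proof eventually_elim
      case (elim j)
      then have "I j / d \<le> 2 * d" using d by (simp add: field_simps)
      then have "(2 * d + I j / d) / (1 - t) \<le> (4 * d) / (1 - t)" using t by (intro divide_right_mono) auto
      also have "\<dots> = e" using t by (simp add: d_def)
      finally show ?case using J_le[of j] by simp
    qed
  qed
  define K where "K = 2 / (1 - t) * (\<Sum>k. k * t ^ k)"
  have "(\<lambda>j. K * (1 / real (Suc j))) \<longlonglongrightarrow> K * 0"
    by (intro tendsto_intros LIMSEQ_Suc[OF lim_1_over_n])
  then have "\<forall>\<^sub>F j in sequentially. K * (1 / real (Suc j)) < e"
    by (rule order_tendstoD(2)) (simp add: e)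
  then obtain j0 where j0: "\<And>j. j0 \<le> j \<Longrightarrow> K * (1 / real (Suc j)) < e"
    by (auto simp: eventually_sequentially)
  have "K / real (2 * j + 1) \<le> e" if "j0 \<le> j" for j
    using j0[of "2 * j"] that by simp
  then have ev_K: "\<forall>\<^sub>F j in sequentially. K / real (2 * j + 1) \<le> e"
    unfolding eventually_sequentially by blast
  have "\<forall>\<^sub>F j in sequentially. (\<forall>w\<in>X. J j w \<le> e) \<and> K / real (2 * j + 1) \<le> e"
    using ev_J ev_K X by (intro eventually_conj eventually_ball_finite) auto
  then obtain j where j: "\<And>w. w \<in> X \<Longrightarrow> J j w \<le> e" "K / real (2 * j + 1) \<le> e"
    by (auto simp: eventually_sequentially)
  show thesis
  proof (rule that[of "g j"])
    show "Rep_bergman (g j) \<in> hinf" by (simp add: g Gh)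
    fix f assume f: "f \<in> hinf" "\<And>z. cmod (f z) \<le> 1"
    show "cmod (cinner (mult_op f (g j)) w) \<le> e" "cmod (cinner (mult_op f w) (g j)) \<le> e" if "w \<in> X" for w
      by (rule order_trans[OF J1[OF f] j(1)[OF that]], rule order_trans[OF J2[OF f] j(1)[OF that]])
    have "cinner (mult_op f (g j)) (g j) = (LINT z:disk|lborel. of_real ((c j)\<^sup>2) *
        (f z * s z * cnj (s z) * of_real (cmod z ^ (2 * (2 * j)))))"
      unfolding cinner_mult_op[OF f(1)] g
    proof (rule set_lebesgue_integral_cong)
      show "\<forall>z. z \<in> disk \<longrightarrow> f z * G j z * cnj (G j z) = of_real ((c j)\<^sup>2) *
        (f z * s z * cnj (s z) * of_real (cmod z ^ (2 * (2 * j))))"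
        by (simp only: of_real_norm_even_power) (simp add: G_def power2_eq_square mult_ac)
    qed simp
    also have "\<dots> = of_real (real (2 * j + 1) / pi * (1 - (cmod l)\<^sup>2)) *
        (LINT z:disk|lborel. f z * s z * cnj (s z) * of_real (cmod z ^ (2 * (2 * j))))"
      by (simp only: set_integral_mult_right c2 t_def)
    finally have "cmod (cinner (mult_op f (g j)) (g j) - f l) \<le> K / real (2 * j + 1)"
      using szego_weight_integral[OF l f, of "2 * j"] by (simp only: K_def t_def s_def)
    then show "cmod (cinner (mult_op f (g j)) (g j) - f l) \<le> e" using j(2) by simp
  qed
qed

section \<open>Factorization of functionals\<close>

instance bergman :: banach ..

lemma bounded_bilinear_cinner: "bounded_bilinear cinner"
  by (rule bounded_bilinear.intro)
    (auto simp: cinner_add_left cinner_add_right scaleR_bergman_def cinner_cscale_left cinner_cscale_right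
      scaleR_conv_of_real cinner_Cauchy_Schwarz intro!: exI[of _ 1])

definition matrix_form :: "bergman ^ 'r ^ 'r \<Rightarrow> bergman ^ 'r \<Rightarrow> bergman ^ 'r \<Rightarrow> complex"
  where "matrix_form F x y = (\<Sum>a\<in>UNIV. \<Sum>b\<in>UNIV. cinner (mult_op (Rep_bergman (F $ a $ b)) (x $ b)) (y $ a))"

text \<open>
  If the entries of \<open>x\<close> are bounded functions, then \<open>\<langle>F x, y\<rangle>\<close> depends continuously on \<open>F\<close> in the Bergman
  norm. This keeps the remainders in the iteration below within reach of the bipolar theorem.
\<close>

definition bounded_vectors :: "(bergman ^ 'r) set"
  where "bounded_vectors = {x. \<forall>b. Rep_bergman (x $ b) \<in> hinf}"

text \<open>
  Both sides come from the pointwise product. If one of the factors is bounded, it can thus take the role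
  of the multiplier.
\<close>

lemma mult_op_Rep_commute: "mult_op (Rep_bergman f) g = mult_op (Rep_bergman g) f"
  by (simp add: mult_op_def mult.commute)

lemma bounded_linear_matrix_form:
  assumes "x \<in> bounded_vectors"
  shows "bounded_linear (\<lambda>F :: bergman ^ 'r::finite ^ 'r. Re (matrix_form F x y))"
proof -
  have "bounded_linear (\<lambda>F :: bergman ^ 'r ^ 'r. cinner (mult_op (Rep_bergman (F $ a $ b)) (x $ b)) (y $ a))" for a b
    unfolding mult_op_Rep_commute[of "_ $ _ $ _"]
    using assms by (intro bounded_linear_compose[OF bounded_linear_cinner_left]
        bounded_linear_compose[OF bounded_linear_mult_op]
        bounded_linear_compose[OF bounded_linear_vec_nth bounded_linear_vec_nth])
      (simp add: bounded_vectors_def)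
  then show ?thesis
    unfolding matrix_form_def by (intro bounded_linear_compose[OF bounded_linear_Re] bounded_linear_sum)
qed

lemma bounded_vectors_zero: "0 \<in> bounded_vectors"
  by (auto simp: bounded_vectors_def zero_bergman.rep_eq intro!: hinfI[of _ 0])

lemma bounded_vectors_add: "x \<in> bounded_vectors \<Longrightarrow> y \<in> bounded_vectors \<Longrightarrow> x + y \<in> bounded_vectors"
  by (simp add: bounded_vectors_def plus_bergman.rep_eq hinf_add)

context
  fixes A :: "(complex \<Rightarrow> complex) set"
  assumes A: "dual_subalgebra A"
begin

lemma matrix_form_add:
  assumes F: "F \<in> multiplier_ball A"
  shows "matrix_form F (x + x') y = matrix_form F x y + matrix_form F x' y"
    "matrix_form F x (y + y') = matrix_form F x y + matrix_form F x y'"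
  by (simp_all add: matrix_form_def mult_op_linear[OF multiplier_ballD(2)[OF A F]] cinner_add_left
      cinner_add_right sum.distrib)

lemma multiplier_ball_uminus:
  assumes F: "F \<in> multiplier_ball A"
  shows "- F \<in> multiplier_ball A"
  using multiplier_ball_scaleI[OF A multiplier_ballD(1)[OF A F], of "-1"] multiplier_ballD(4)[OF A F]
  by simp

text \<open>
  One point evaluation \<open>\<alpha> \<langle>F(l) u, v\<rangle>\<close> is added to the functional \<open>\<langle>F x, y\<rangle>\<close> by adding multiples of a peak
  vector \<open>g\<close> at \<open>l\<close>, namely \<open>\<surd>\<alpha> u \<otimes> g\<close> and \<open>\<surd>\<alpha> v \<otimes> g\<close>, to \<open>x\<close> and \<open>y\<close>. The mixed terms are small, and so are the inner
  products with \<open>dx\<close> and \<open>dy\<close>; the squared norms thus increase by hardly more than \<open>\<alpha>\<close>.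
\<close>

lemma atom_step:
  fixes u v :: "complex ^ 'r::finite"
  assumes l: "l \<in> disk" and u: "norm u \<le> 1" and v: "norm v \<le> 1" and \<alpha>: "0 \<le> \<alpha>" and e: "0 < e"
  obtains ex ey where "ex \<in> bounded_vectors" "ey \<in> bounded_vectors"
    "(norm (dx + ex))\<^sup>2 \<le> (norm dx)\<^sup>2 + \<alpha> + e" "(norm (dy + ey))\<^sup>2 \<le> (norm dy)\<^sup>2 + \<alpha> + e"
    "\<And>F. F \<in> multiplier_ball A \<Longrightarrow>
      cmod (matrix_form F (x + ex) (y + ey) - matrix_form F x y - \<alpha> * symbol_form F l u v) \<le> e"
proof -
  define r where "r = real (CARD('r))"
  define q where "q = sqrt \<alpha>"
  have q: "0 \<le> q" "q * q = \<alpha>" using \<alpha> by (auto simp: q_def)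
  have r: "0 \<le> r" by (simp add: r_def)
  \<comment> \<open>In all three estimates the sum of the error terms is at most \<open>d M\<close>.\<close>
  define M where "M = r * r * (2 * q + \<alpha>) + 2 * (r * q) + \<alpha> + 1"
  have M: "0 < M" using q \<alpha> r by (auto simp: M_def intro!: add_nonneg_pos)
  define d where "d = e / M"
  have d: "0 < d" using e M by (simp add: d_def)
  have dM: "d * M = e" using M by (simp add: d_def)
  have d_le: "d * k \<le> e" if "k \<le> M" for k
    using mult_left_mono[OF that, of d] d dM by simp
  have comp: "cmod (u $ a) \<le> 1" "cmod (v $ a) \<le> 1" for a
    using Finite_Cartesian_Product.norm_nth_le[of u a] Finite_Cartesian_Product.norm_nth_le[of v a] u v by simp_all
  define X where "X = range (($) x) \<union> range (($) y) \<union> range (($) dx) \<union> range (($) dy)"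
  have X: "finite X" by (simp add: X_def)
  have inX: "x $ a \<in> X" "y $ a \<in> X" "dx $ a \<in> X" "dy $ a \<in> X" for a by (auto simp: X_def)
  obtain g where gh: "Rep_bergman g \<in> hinf"
    and g1: "\<And>f. f \<in> hinf \<Longrightarrow> (\<And>z. cmod (f z) \<le> 1) \<Longrightarrow> cmod (cinner (mult_op f g) g - f l) \<le> d"
    and g2: "\<And>f w. f \<in> hinf \<Longrightarrow> (\<And>z. cmod (f z) \<le> 1) \<Longrightarrow> w \<in> X \<Longrightarrow> cmod (cinner (mult_op f g) w) \<le> d"
    and g3: "\<And>f w. f \<in> hinf \<Longrightarrow> (\<And>z. cmod (f z) \<le> 1) \<Longrightarrow> w \<in> X \<Longrightarrow> cmod (cinner (mult_op f w) g) \<le> d"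
    using peak_vector_exists[OF l X d] by metis
  define vec where "vec = (\<lambda>u :: complex ^ 'r. \<chi> b. cscale (of_real q * u $ b) g)"
  have ind: "cmod (indicator disk z) \<le> 1" for z :: complex by (simp add: indicator_def)
  have gg: "(norm g)\<^sup>2 \<le> 1 + d"
  proof -
    have "cmod (cinner g g - 1) \<le> d"
      using g1[OF indicator_disk_hinf ind] l by (simp add: mult_op_indicator)
    then have "cmod (of_real ((norm g)\<^sup>2 - 1)) \<le> d" by (simp add: cinner_self_norm)
    then show ?thesis unfolding norm_of_real by linarith
  qed
  have gw: "cmod (cinner w g) \<le> d" if "w \<in> X" for w
    using g3[OF indicator_disk_hinf ind that] by (simp add: mult_op_indicator)
  have vec_bounded: "vec w \<in> bounded_vectors" for w
    using gh by (simp add: bounded_vectors_def vec_def cscale.rep_eq hinf_cmult)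
  have norm_step: "(norm (k + vec w))\<^sup>2 \<le> (norm k)\<^sup>2 + \<alpha> + e"
    if w: "norm w \<le> 1" and k: "\<And>a. k $ a \<in> X" for k w
  proof -
    have wa: "cmod (w $ a) \<le> 1" for a using Finite_Cartesian_Product.norm_nth_le[of w a] w by simp
    have "(norm (vec w))\<^sup>2 = \<alpha> * (norm w)\<^sup>2 * (norm g)\<^sup>2"
      unfolding norm_vec_squared vec_def using \<alpha>
      by (simp add: norm_cscale norm_mult power_mult_distrib q_def sum_distrib_left sum_distrib_right mult_ac)
    also have "\<dots> \<le> \<alpha> * 1 * (1 + d)"
      using \<alpha> w gg by (intro mult_mono) (auto simp: power_le_one)
    finally have n: "(norm (vec w))\<^sup>2 \<le> \<alpha> + \<alpha> * d" by (simp add: algebra_simps)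
    have "inner k (vec w) = (\<Sum>a\<in>UNIV. Re (cnj (of_real q * w $ a) * cinner (k $ a) g))"
      by (simp add: inner_vec_def vec_def Re_cinner[symmetric] cinner_cscale_right)
    also have "\<dots> \<le> (\<Sum>a\<in>(UNIV :: 'r set). q * 1 * d)"
    proof (rule sum_mono)
      fix a
      have "Re (cnj (of_real q * w $ a) * cinner (k $ a) g) \<le> cmod (cnj (of_real q * w $ a) * cinner (k $ a) g)"
        by (rule complex_Re_le_cmod)
      also have "\<dots> = q * cmod (w $ a) * cmod (cinner (k $ a) g)"
        using q(1) by (simp add: norm_mult)
      also have "\<dots> \<le> q * 1 * d"
        using q(1) wa gw[OF k] by (intro mult_mono) auto
      finally show "Re (cnj (of_real q * w $ a) * cinner (k $ a) g) \<le> q * 1 * d" .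
    qed
    also have "\<dots> = r * q * d" by (simp add: r_def)
    finally have i: "inner k (vec w) \<le> r * q * d" .
    have "(norm (k + vec w))\<^sup>2 = (norm k)\<^sup>2 + 2 * inner k (vec w) + (norm (vec w))\<^sup>2"
      unfolding power2_norm_eq_inner by (simp add: inner_simps inner_commute)
    also have "\<dots> \<le> (norm k)\<^sup>2 + \<alpha> + d * (2 * (r * q) + \<alpha>)"
      using n i by (simp add: algebra_simps)
    also have "d * (2 * (r * q) + \<alpha>) \<le> e"
      using q \<alpha> r by (intro d_le) (simp add: M_def)
    finally show ?thesis by simp
  qed
  show thesis
  proof (rule that[of "vec u" "vec v"])
    show "(norm (dx + vec u))\<^sup>2 \<le> (norm dx)\<^sup>2 + \<alpha> + e" "(norm (dy + vec v))\<^sup>2 \<le> (norm dy)\<^sup>2 + \<alpha> + e"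
      using norm_step u v inX by auto
    fix F :: "bergman ^ 'r ^ 'r" assume F: "F \<in> multiplier_ball A"
    define f where "f = (\<lambda>a b. Rep_bergman (F $ a $ b))"
    have fab: "Rep_bergman (F $ a $ b) = f a b" for a b by (simp add: f_def)
    have f: "f a b \<in> hinf" "cmod (f a b z) \<le> 1" for a b z
      unfolding f_def using multiplier_ballD(2,3)[OF A F] by auto
    have sum_bound: "cmod (\<Sum>a\<in>UNIV. \<Sum>b\<in>UNIV. t a b) \<le> r * r * c"
      if "\<And>a b. cmod (t a b) \<le> c" for t :: "'r \<Rightarrow> 'r \<Rightarrow> complex" and c
    proof -
      have "cmod (\<Sum>a\<in>UNIV. \<Sum>b\<in>UNIV. t a b) \<le> (\<Sum>a\<in>(UNIV::'r set). \<Sum>b\<in>(UNIV::'r set). c)"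
        by (intro sum_norm_le that)
      then show ?thesis by (simp add: r_def)
    qed
    have t1: "cmod (matrix_form F (vec u) y) \<le> r * r * (q * d)"
      unfolding matrix_form_def fab
    proof (rule sum_bound)
      fix a b
      have "cmod (cinner (mult_op (f a b) (vec u $ b)) (y $ a)) = q * cmod (u $ b) * cmod (cinner (mult_op (f a b) g) (y $ a))"
        using q(1) by (simp add: vec_def mult_op_linear[OF f(1)] cinner_cscale_left norm_mult)
      also have "\<dots> \<le> q * 1 * d" using q(1) comp g2[OF f inX(2)] by (intro mult_mono) auto
      finally show "cmod (cinner (mult_op (f a b) (vec u $ b)) (y $ a)) \<le> q * d" by simp
    qed
    have t2: "cmod (matrix_form F x (vec v)) \<le> r * r * (q * d)"
      unfolding matrix_form_def fab
    proof (rule sum_bound)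
      fix a b
      have "cmod (cinner (mult_op (f a b) (x $ b)) (vec v $ a)) = q * cmod (v $ a) * cmod (cinner (mult_op (f a b) (x $ b)) g)"
        using q(1) by (simp add: vec_def cinner_cscale_right norm_mult)
      also have "\<dots> \<le> q * 1 * d" using q(1) comp g3[OF f inX(1)] by (intro mult_mono) auto
      finally show "cmod (cinner (mult_op (f a b) (x $ b)) (vec v $ a)) \<le> q * d" by simp
    qed
    have "matrix_form F (vec u) (vec v) - \<alpha> * symbol_form F l u v
        = (\<Sum>a\<in>UNIV. \<Sum>b\<in>UNIV. \<alpha> * (u $ b * cnj (v $ a)) * (cinner (mult_op (f a b) g) g - f a b l))"
    proof -
      have "matrix_form F (vec u) (vec v) = (\<Sum>a\<in>UNIV. \<Sum>b\<in>UNIV. \<alpha> * (u $ b * cnj (v $ a)) * cinner (mult_op (f a b) g) g)"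
        unfolding matrix_form_def fab
        by (simp add: vec_def mult_op_linear[OF f(1)] cinner_cscale_left cinner_cscale_right mult_ac
            flip: q(2))
      moreover have "\<alpha> * symbol_form F l u v
          = (\<Sum>a\<in>UNIV. \<Sum>b\<in>UNIV. \<alpha> * (u $ b * cnj (v $ a)) * f a b l)"
        by (simp add: symbol_form_def symbol_def matrix_vector_mult_def f_def sum_distrib_left sum_distrib_right mult_ac)
      ultimately show ?thesis by (simp only: right_diff_distrib sum_subtractf)
    qed
    also have "cmod \<dots> \<le> r * r * (\<alpha> * d)"
    proof (rule sum_bound)
      fix a b
      have "cmod (\<alpha> * (u $ b * cnj (v $ a)) * (cinner (mult_op (f a b) g) g - f a b l))
          = \<alpha> * (cmod (u $ b) * cmod (v $ a)) * cmod (cinner (mult_op (f a b) g) g - f a b l)"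
        using \<alpha> by (simp add: norm_mult)
      also have "\<dots> \<le> \<alpha> * (1 * 1) * d"
        using \<alpha> comp g1[OF f] by (intro mult_mono mult_nonneg_nonneg) auto
      finally show "cmod (\<alpha> * (u $ b * cnj (v $ a)) * (cinner (mult_op (f a b) g) g - f a b l)) \<le> \<alpha> * d" by simp
    qed
    finally have t3: "cmod (matrix_form F (vec u) (vec v) - \<alpha> * symbol_form F l u v)
        \<le> r * r * (\<alpha> * d)" .
    have "matrix_form F (x + vec u) (y + vec v) - matrix_form F x y - \<alpha> * symbol_form F l u v
        = matrix_form F (vec u) y + matrix_form F x (vec v)
          + (matrix_form F (vec u) (vec v) - \<alpha> * symbol_form F l u v)"
      by (simp add: matrix_form_add[OF F])
    also have "cmod \<dots> \<le> r * r * (q * d) + r * r * (q * d) + r * r * (\<alpha> * d)"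
      by (intro order_trans[OF norm_triangle_ineq] add_mono t1 t2 t3)
    also have "\<dots> = d * (r * r * (2 * q + \<alpha>))" by (simp add: algebra_simps)
    also have "\<dots> \<le> e" using q \<alpha> r by (intro d_le) (simp add: M_def)
    finally show "cmod (matrix_form F (x + vec u) (y + vec v) - matrix_form F x y
        - \<alpha> * symbol_form F l u v) \<le> e" .
  qed (rule vec_bounded)+
qed

lemma atoms_step:
  fixes u v :: "'i \<Rightarrow> complex ^ 'r::finite"
  assumes "finite I"
    and "\<And>i. i \<in> I \<Longrightarrow> l i \<in> disk \<and> norm (u i) \<le> 1 \<and> norm (v i) \<le> 1 \<and> 0 \<le> \<alpha> i"
    and "0 < e"
  shows "\<exists>dx dy. dx \<in> bounded_vectors \<and> dy \<in> bounded_vectors \<and>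
    (norm dx)\<^sup>2 \<le> sum \<alpha> I + e \<and> (norm dy)\<^sup>2 \<le> sum \<alpha> I + e \<and>
    (\<forall>F\<in>multiplier_ball A. cmod (matrix_form F (x + dx) (y + dy) - matrix_form F x y -
      (\<Sum>i\<in>I. \<alpha> i * symbol_form F (l i) (u i) (v i))) \<le> e)"
  using assms
proof (induction I arbitrary: e)
  case empty
  then show ?case by (intro exI[of _ 0]) (auto simp: bounded_vectors_zero)
next
  case (insert i I)
  have "0 < e / 2" using insert.prems by simp
  from insert.IH[OF _ this] insert.prems obtain dx dy where IH: "dx \<in> bounded_vectors" "dy \<in> bounded_vectors"
    "(norm dx)\<^sup>2 \<le> sum \<alpha> I + e / 2" "(norm dy)\<^sup>2 \<le> sum \<alpha> I + e / 2"
    "\<And>F. F \<in> multiplier_ball A \<Longrightarrow> cmod (matrix_form F (x + dx) (y + dy) - matrix_form F x y -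
      (\<Sum>i\<in>I. \<alpha> i * symbol_form F (l i) (u i) (v i))) \<le> e / 2"
    by blast
  have i: "l i \<in> disk" "norm (u i) \<le> 1" "norm (v i) \<le> 1" "0 \<le> \<alpha> i" using insert.prems(1) by auto
  obtain ex ey where E: "ex \<in> bounded_vectors" "ey \<in> bounded_vectors"
    "(norm (dx + ex))\<^sup>2 \<le> (norm dx)\<^sup>2 + \<alpha> i + e / 2" "(norm (dy + ey))\<^sup>2 \<le> (norm dy)\<^sup>2 + \<alpha> i + e / 2"
    "\<And>F. F \<in> multiplier_ball A \<Longrightarrow>
      cmod (matrix_form F ((x + dx) + ex) ((y + dy) + ey) - matrix_form F (x + dx) (y + dy)
        - \<alpha> i * symbol_form F (l i) (u i) (v i)) \<le> e / 2"
    using atom_step[OF i \<open>0 < e / 2\<close>] by blast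
  have "cmod (matrix_form F (x + (dx + ex)) (y + (dy + ey)) - matrix_form F x y -
      (\<Sum>i\<in>insert i I. \<alpha> i * symbol_form F (l i) (u i) (v i))) \<le> e"
    if F: "F \<in> multiplier_ball A" for F
  proof -
    define k where "k = (\<lambda>i. complex_of_real (\<alpha> i) * symbol_form F (l i) (u i) (v i))"
    have "matrix_form F (x + (dx + ex)) (y + (dy + ey)) - matrix_form F x y - (\<Sum>i\<in>insert i I. k i)
        = (matrix_form F ((x + dx) + ex) ((y + dy) + ey) - matrix_form F (x + dx) (y + dy) - k i)
          + (matrix_form F (x + dx) (y + dy) - matrix_form F x y - (\<Sum>i\<in>I. k i))"
      using insert.hyps by (simp add: add.assoc)
    also have "cmod \<dots> \<le> e / 2 + e / 2"
      unfolding k_def by (intro order_trans[OF norm_triangle_ineq] add_mono E(5) IH(5) F)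
    finally show ?thesis by (simp add: k_def)
  qed
  moreover have "(norm (dx + ex))\<^sup>2 \<le> sum \<alpha> (insert i I) + e" "(norm (dy + ey))\<^sup>2 \<le> sum \<alpha> (insert i I) + e"
    using E(3,4) IH(3,4) insert.hyps by auto
  ultimately show ?case using E(1,2) IH(1,2) by (blast intro: bounded_vectors_add)
qed

text \<open>
  The point evaluations \<open>\<langle>F(l) u, v\<rangle>\<close> with \<open>u\<close> and \<open>v\<close> in the unit ball have the norm of \<open>F\<close> as supremum, so that \<open>c\<close>
  times this supremum dominates \<open>\<psi>\<close>. By the bipolar theorem a convex combination of the evaluations,
  multiplied by \<open>c\<close>, is close to \<open>\<psi>\<close> on the ball, and it is realized atom by atom.
\<close>

lemma functional_approximation:
  fixes \<psi> :: "bergman ^ 'r::finite ^ 'r \<Rightarrow> real"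
  assumes \<psi>: "bounded_linear \<psi>" and c: "0 < c" and le: "\<forall>F\<in>multiplier_ball A. \<psi> F \<le> c"
    and e: "0 < e"
  shows "\<exists>dx dy. dx \<in> bounded_vectors \<and> dy \<in> bounded_vectors \<and>
    (norm dx)\<^sup>2 \<le> c + e \<and> (norm dy)\<^sup>2 \<le> c + e \<and>
    (\<forall>F\<in>multiplier_ball A. \<bar>\<psi> F - (Re (matrix_form F (x + dx) (y + dy)) - Re (matrix_form F x y))\<bar> \<le> e)"
proof -
  let ?B = "multiplier_ball A :: (bergman ^ 'r ^ 'r) set"
  interpret \<psi>: bounded_linear \<psi> by fact
  obtain p where p: "\<And>F. \<psi> F = inner F p" using Riesz_representation[OF \<psi>] by blast
  have form_linear: "bounded_linear (\<lambda>F :: bergman ^ 'r ^ 'r. c * Re (symbol_form F l u v))" for l u v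
  proof -
    have "bounded_linear (\<lambda>F :: bergman ^ 'r ^ 'r. (symbol F l *v u) $ a * cnj (v $ a))" for a
      by (intro bounded_linear_mult_const bounded_linear_compose[OF bounded_linear_vec_nth bounded_linear_symbol_vector])
    then have "bounded_linear (\<lambda>F :: bergman ^ 'r ^ 'r. symbol_form F l u v)"
      unfolding symbol_form_def by (rule bounded_linear_sum)
    then show ?thesis
      by (intro bounded_linear_const_mult bounded_linear_compose[OF bounded_linear_Re])
  qed
  have "\<exists>k. \<forall>F :: bergman ^ 'r ^ 'r. c * Re (symbol_form F l u v) = inner F k" for l and u v :: "complex ^ 'r"
    using Riesz_representation[OF form_linear[of l u v]] by blast
  then obtain R where R: "\<And>l (u :: complex ^ 'r) v (F :: bergman ^ 'r ^ 'r). inner F (R l u v) = c * Re (symbol_form F l u v)"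
    by metis
  define S where "S = (\<lambda>(l, u, v). R l u v) ` (disk \<times> cball 0 1 \<times> cball 0 1)"
  have S: "R l u v \<in> S" if "l \<in> disk" "norm u \<le> 1" "norm v \<le> 1" for l u v
    unfolding S_def using that by (intro image_eqI[of _ _ "(l, u, v)"]) auto
  have dom: "inner p F \<le> t" if F: "F \<in> ?B" and t: "\<And>q. q \<in> convex hull S \<Longrightarrow> inner q F \<le> t" for F t
  proof -
    have Re_le: "c * Re (symbol_form F l u v) \<le> t" if "l \<in> disk" "norm u \<le> 1" "norm v \<le> 1" for l u v
      using t[OF hull_inc[OF S[OF that]]] R[of F l u v] by (simp add: inner_commute)
    have unit: "c * norm (symbol F l *v u) \<le> t" if "l \<in> disk" "norm u \<le> 1" for l u
    proof -
      define w where "w = symbol F l *v u"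
      define v where "v = (if w = 0 then 0 else (1 / norm w) *\<^sub>R w)"
      have "symbol_form F l u v = of_real (norm w)"
      proof (cases "w = 0")
        case False
        have "symbol_form F l u v = of_real (1 / norm w) * (\<Sum>a\<in>UNIV. w $ a * cnj (w $ a))"
          using False by (simp add: symbol_form_def v_def sum_distrib_left scaleR_conv_of_real[where 'a = complex] mult_ac flip: w_def)
        also have "(\<Sum>a\<in>UNIV. w $ a * cnj (w $ a)) = of_real ((norm w)\<^sup>2)"
          by (simp only: norm_vec_squared of_real_sum complex_norm_square)
        finally show ?thesis using False by (simp add: power2_eq_square)
      qed (simp add: symbol_form_def v_def)
      moreover have "norm v \<le> 1" by (simp add: v_def)
      ultimately show ?thesis using Re_le[OF that, of v] by (simp add: w_def)
    qed
    have t0: "0 \<le> t" using unit[of 0 0] by (simp add: matrix_vector_mult_0_right)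
    have hom: "c * norm (symbol F l *v u) \<le> t * norm u" if l: "l \<in> disk" for l u
    proof (cases "u = 0")
      case False
      have "symbol F l *v ((1 / norm u) *\<^sub>R u) = (1 / norm u) *\<^sub>R (symbol F l *v u)"
        by (simp add: vec_eq_iff matrix_vector_mult_def scaleR_sum_right)
      then have "c * (1 / norm u * norm (symbol F l *v u)) \<le> t"
        using unit[OF l, of "(1 / norm u) *\<^sub>R u"] False by simp
      then show ?thesis using False by (simp add: field_simps)
    qed (simp add: matrix_vector_mult_0_right)
    show ?thesis
    proof (cases "t = 0")
      case True
      have "F $ a $ b = 0" for a b
      proof (rule bergman_eqI)
        fix z assume z: "z \<in> disk"
        have "symbol F z *v axis b 1 = 0" using hom[OF z, of "axis b 1"] True c by (simp add: mult_le_0_iff)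
        then have "(symbol F z *v axis b 1) $ a = 0" by simp
        then show "Rep_bergman (F $ a $ b) z = Rep_bergman 0 z"
          by (simp add: symbol_def axis_def matrix_vector_mult_def if_distrib zero_bergman.rep_eq cong: if_cong)
      qed
      then have "F = 0" by (simp add: vec_eq_iff)
      then show ?thesis using t0 by simp
    next
      case False
      with t0 have tp: "0 < t" by simp
      have "(c / t) *\<^sub>R F \<in> ?B"
      proof (rule multiplier_ball_scaleI[OF A multiplier_ballD(1)[OF A F]])
        fix w u assume "w \<in> disk"
        then have "c * norm (symbol F w *v u) / t \<le> t * norm u / t"
          using tp by (intro divide_right_mono hom) auto
        then show "\<bar>c / t\<bar> * norm (symbol F w *v u) \<le> norm u" using c tp by simp
      qed
      from bspec[OF le this] have "c / t * \<psi> F \<le> c" by (simp add: \<psi>.scaleR)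
      then have "\<psi> F \<le> t" using c tp by (simp add: field_simps)
      then show ?thesis by (simp add: p inner_commute)
    qed
  qed
  have cB: "compact ?B" by (rule compact_multiplier_ball[OF A])
  have "R 0 0 0 \<in> S" by (rule S) auto
  then have ne: "convex hull S \<noteq> {}" using hull_inc by fastforce
  have "\<exists>q\<in>convex hull S. \<forall>F\<in>?B. inner (p - q) F \<le> e / 2"
  proof (rule convex_set_approximates_on_bounded_set[of ?B "convex hull S" p "e / 2"])
    show "inner p F \<le> t" if "F \<in> ?B" "\<And>q. q \<in> convex hull S \<Longrightarrow> inner q F \<le> t" for F t
      using that by (rule dom)
    fix q assume "q \<in> convex hull S" "\<And>F. F \<in> ?B \<Longrightarrow> inner (p - q) F \<le> e / 2"
    then show "\<exists>q\<in>convex hull S. \<forall>F\<in>?B. inner (p - q) F \<le> e / 2" by blast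
  qed (use cB ne e in \<open>simp_all add: compact_imp_closed compact_imp_bounded multiplier_ball_convex[OF A]
      multiplier_ball_zero[OF A]\<close>)
  then obtain q where q: "q \<in> convex hull S" "\<And>F. F \<in> ?B \<Longrightarrow> inner (p - q) F \<le> e / 2" by blast
  obtain m :: nat and w k where wk: "\<And>i. i \<in> {1..m} \<Longrightarrow> 0 \<le> w i \<and> k i \<in> S" "sum w {1..m} = 1"
    "(\<Sum>i = 1..m. w i *\<^sub>R k i) = q"
    using q(1) unfolding convex_hull_indexed by blast
  have "\<forall>i\<in>{1..m}. \<exists>p. k i = R (fst p) (fst (snd p)) (snd (snd p)) \<and> p \<in> disk \<times> cball 0 1 \<times> cball 0 1"
    using wk(1) by (fastforce simp: S_def)
  from bchoice[OF this] obtain P where P: "\<And>i. i \<in> {1..m} \<Longrightarrow> k i = R (fst (P i)) (fst (snd (P i))) (snd (snd (P i)))"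
    "\<And>i. i \<in> {1..m} \<Longrightarrow> P i \<in> disk \<times> cball 0 1 \<times> cball 0 1" by blast
  define l u v where "l = (\<lambda>i. fst (P i))" and "u = (\<lambda>i. fst (snd (P i)))" and "v = (\<lambda>i. snd (snd (P i)))"
  have luv: "l i \<in> disk \<and> norm (u i) \<le> 1 \<and> norm (v i) \<le> 1" if "i \<in> {1..m}" for i
    using P(2)[OF that] by (auto simp: l_def u_def v_def mem_Times_iff)
  have k_eq: "inner F (k i) = c * Re (symbol_form F (l i) (u i) (v i))" if "i \<in> {1..m}" for i F
    unfolding P(1)[OF that] R by (simp add: l_def u_def v_def)
  have q_eq: "inner F q = Re (\<Sum>i = 1..m. of_real (c * w i) * symbol_form F (l i) (u i) (v i))" for F
    unfolding wk(3)[symmetric] inner_sum_right Re_sum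
    by (intro sum.cong) (auto simp: k_eq mult_ac)
  have "sum (\<lambda>i. c * w i) {1..m} = c" by (simp only: wk(2) sum_distrib_left[symmetric] mult_1_right)
  moreover have "l i \<in> disk \<and> norm (u i) \<le> 1 \<and> norm (v i) \<le> 1 \<and> 0 \<le> c * w i" if "i \<in> {1..m}" for i
    using luv[OF that] wk(1)[OF that] c by simp
  ultimately obtain dx dy where D: "dx \<in> bounded_vectors" "dy \<in> bounded_vectors"
    "(norm dx)\<^sup>2 \<le> c + e / 2" "(norm dy)\<^sup>2 \<le> c + e / 2"
    "\<And>F. F \<in> ?B \<Longrightarrow> cmod (matrix_form F (x + dx) (y + dy) - matrix_form F x y -
      (\<Sum>i = 1..m. of_real (c * w i) * symbol_form F (l i) (u i) (v i))) \<le> e / 2"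
    using atoms_step[of "{1..m}" l u v "\<lambda>i. c * w i" "e / 2" x y] e by auto
  have "\<bar>\<psi> F - (Re (matrix_form F (x + dx) (y + dy)) - Re (matrix_form F x y))\<bar> \<le> e" if F: "F \<in> ?B" for F
  proof -
    have "inner (p - q) F \<le> e / 2" "- inner (p - q) F \<le> e / 2"
      using q(2)[OF F] q(2)[OF multiplier_ball_uminus[OF F]] by simp_all
    moreover have "inner (p - q) F = \<psi> F - inner F q"
      unfolding p inner_diff_left by (simp add: inner_commute)
    ultimately have "\<bar>\<psi> F - inner F q\<bar> \<le> e / 2" by linarith
    moreover have "\<bar>Re (matrix_form F (x + dx) (y + dy)) - Re (matrix_form F x y) - inner F q\<bar> \<le> e / 2"
      using order_trans[OF abs_Re_le_cmod D(5)[OF F]] by (simp add: q_eq)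
    ultimately show ?thesis by linarith
  qed
  moreover have "(norm dx)\<^sup>2 \<le> c + e" "(norm dy)\<^sup>2 \<le> c + e" using D(3,4) e by auto
  ultimately show ?thesis using D(1,2) by blast
qed

text \<open>
  The approximation is repeated on the remainder, whose bound on the ball shrinks geometrically. So do
  the increments of \<open>x\<close> and \<open>y\<close>, since their squared norms are controlled by the bound on the remainder.
\<close>

lemma functional_factorization:
  fixes \<psi> :: "bergman ^ 'r::finite ^ 'r \<Rightarrow> real"
  assumes \<psi>: "bounded_linear \<psi>" and c: "0 < c" and le: "\<forall>F\<in>multiplier_ball A. \<psi> F \<le> c"
    and e: "0 < e"
  obtains x y where "norm x \<le> sqrt c + e" "norm y \<le> sqrt c + e"
    "\<And>F. F \<in> multiplier_ball A \<Longrightarrow> \<psi> F = Re (matrix_form F x y)"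
proof -
  let ?B = "multiplier_ball A :: (bergman ^ 'r ^ 'r) set"
  define \<tau> where "\<tau> = e / 3"
  have \<tau>: "0 < \<tau>" using e by (simp add: \<tau>_def)
  \<comment> \<open>\<open>\<rho> n\<close> bounds the increments after stage \<open>n\<close>, and \<open>\<eta> n\<close> the remainder. The increments satisfy
    \<open>\<parallel>dx\<parallel>\<^sup>2 \<le> \<eta> n + \<eta> (Suc n)\<close>, which is at most \<open>(\<rho> n)\<^sup>2\<close>.\<close>
  define \<rho> where "\<rho> = (\<lambda>n::nat. \<tau> * (1 / 2) ^ n)"
  have \<rho>: "0 < \<rho> n" "\<rho> (Suc n) = \<rho> n / 2" "\<rho> 0 = \<tau>" for n
    using \<tau> by (simp_all add: \<rho>_def)
  define \<eta> where "\<eta> = (\<lambda>n::nat. (\<rho> n)\<^sup>2 / 2)"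
  have \<eta>: "0 < \<eta> n" "2 * \<eta> n = (\<rho> n)\<^sup>2" for n
    using \<rho>(1)[of n] by (simp_all add: \<eta>_def)
  have \<eta>_mono: "\<eta> (Suc n) \<le> \<eta> n" for n
    by (simp add: \<eta>_def \<rho>(2) power_divide)
  define P where "P = (\<lambda>n (xy :: (bergman ^ 'r) \<times> (bergman ^ 'r)). fst xy \<in> bounded_vectors \<and> snd xy \<in> bounded_vectors \<and>
      norm (fst xy) \<le> sqrt c + \<tau> + (\<Sum>k<n. \<rho> k) \<and> norm (snd xy) \<le> sqrt c + \<tau> + (\<Sum>k<n. \<rho> k) \<and>
      (\<forall>F\<in>?B. \<bar>\<psi> F - Re (matrix_form F (fst xy) (snd xy))\<bar> \<le> \<eta> n))"
  define Q where "Q = (\<lambda>n (xy :: (bergman ^ 'r) \<times> (bergman ^ 'r)) xy'.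
      norm (fst xy' - fst xy) \<le> \<rho> n \<and> norm (snd xy' - snd xy) \<le> \<rho> n)"
  have base: "\<exists>xy. P 0 xy"
  proof -
    from functional_approximation[OF \<psi> c le \<eta>(1)[of 0], of 0 0] obtain dx dy
      where D: "dx \<in> bounded_vectors" "dy \<in> bounded_vectors"
        "(norm dx)\<^sup>2 \<le> c + \<eta> 0" "(norm dy)\<^sup>2 \<le> c + \<eta> 0"
        "\<forall>F\<in>?B. \<bar>\<psi> F - (Re (matrix_form F (0 + dx) (0 + dy)) - Re (matrix_form F 0 0))\<bar> \<le> \<eta> 0"
      by (elim exE conjE) (rule that)
    have "c + \<eta> 0 \<le> (sqrt c + \<tau>)\<^sup>2"
    proof -
      have "(sqrt c + \<tau>)\<^sup>2 = c + \<tau>\<^sup>2 + 2 * sqrt c * \<tau>"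
        unfolding power2_sum using c by simp
      moreover have "0 \<le> 2 * sqrt c * \<tau>" "0 \<le> \<tau>\<^sup>2" using c \<tau> by auto
      moreover have "\<eta> 0 = \<tau>\<^sup>2 / 2" by (simp only: \<eta>_def \<rho>(3))
      ultimately show ?thesis by linarith
    qed
    then have "(norm dx)\<^sup>2 \<le> (sqrt c + \<tau>)\<^sup>2" "(norm dy)\<^sup>2 \<le> (sqrt c + \<tau>)\<^sup>2"
      using D(3,4) by linarith+
    moreover have "0 \<le> sqrt c + \<tau>" using c \<tau> by simp
    ultimately have "norm dx \<le> sqrt c + \<tau>" "norm dy \<le> sqrt c + \<tau>"
      by (metis power2_le_imp_le)+
    moreover have "Re (matrix_form F 0 0) = 0" for F :: "bergman ^ 'r ^ 'r"
      by (simp add: matrix_form_def)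
    ultimately have "P 0 (dx, dy)" using D by (simp add: P_def)
    then show ?thesis by blast
  qed
  have step: "\<exists>xy'. P (Suc n) xy' \<and> Q n xy xy'" if "P n xy" for n xy
  proof -
    define x y where "x = fst xy" and "y = snd xy"
    have xy: "x \<in> bounded_vectors" "y \<in> bounded_vectors"
      "norm x \<le> sqrt c + \<tau> + (\<Sum>k<n. \<rho> k)" "norm y \<le> sqrt c + \<tau> + (\<Sum>k<n. \<rho> k)"
      "\<forall>F\<in>?B. \<bar>\<psi> F - Re (matrix_form F x y)\<bar> \<le> \<eta> n"
      using that unfolding P_def x_def[symmetric] y_def[symmetric] by blast+
    have bl: "bounded_linear (\<lambda>F. \<psi> F - Re (matrix_form F x y))"
      by (intro bounded_linear_sub \<psi> bounded_linear_matrix_form xy)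
    have le': "\<forall>F\<in>?B. \<psi> F - Re (matrix_form F x y) \<le> \<eta> n"
      using xy(5) abs_le_D1 by blast
    from functional_approximation[OF bl \<eta>(1)[of n] le' \<eta>(1)[of "Suc n"], of x y] obtain dx dy
      where D: "dx \<in> bounded_vectors" "dy \<in> bounded_vectors"
        "(norm dx)\<^sup>2 \<le> \<eta> n + \<eta> (Suc n)" "(norm dy)\<^sup>2 \<le> \<eta> n + \<eta> (Suc n)"
        "\<forall>F\<in>?B. \<bar>\<psi> F - Re (matrix_form F x y) -
          (Re (matrix_form F (x + dx) (y + dy)) - Re (matrix_form F x y))\<bar> \<le> \<eta> (Suc n)"
      by (elim exE conjE) (rule that)
    have "(norm dx)\<^sup>2 \<le> (\<rho> n)\<^sup>2" "(norm dy)\<^sup>2 \<le> (\<rho> n)\<^sup>2"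
      using D(3,4) \<eta>_mono[of n] \<eta>(2)[of n] by linarith+
    then have d: "norm dx \<le> \<rho> n" "norm dy \<le> \<rho> n"
      using less_imp_le[OF \<rho>(1)[of n]] by (metis power2_le_imp_le)+
    have "norm (x + dx) \<le> sqrt c + \<tau> + (\<Sum>k<Suc n. \<rho> k)"
      "norm (y + dy) \<le> sqrt c + \<tau> + (\<Sum>k<Suc n. \<rho> k)"
      using norm_triangle_ineq[of x dx] norm_triangle_ineq[of y dy] xy(3,4) d by simp_all
    moreover have "\<forall>F\<in>?B. \<bar>\<psi> F - Re (matrix_form F (x + dx) (y + dy))\<bar> \<le> \<eta> (Suc n)"
    proof
      fix F assume "F \<in> ?B"
      with D(5) have "\<bar>\<psi> F - Re (matrix_form F x y) -
          (Re (matrix_form F (x + dx) (y + dy)) - Re (matrix_form F x y))\<bar> \<le> \<eta> (Suc n)" by blast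
      then show "\<bar>\<psi> F - Re (matrix_form F (x + dx) (y + dy))\<bar> \<le> \<eta> (Suc n)" by linarith
    qed
    ultimately have "P (Suc n) (x + dx, y + dy)"
      using bounded_vectors_add[OF xy(1) D(1)] bounded_vectors_add[OF xy(2) D(2)]
      unfolding P_def fst_conv snd_conv by blast
    moreover have "Q n xy (x + dx, y + dy)"
      using d by (simp add: Q_def x_def y_def)
    ultimately show ?thesis by blast
  qed
  obtain f where f: "\<And>n. P n (f n)" "\<And>n. Q n (f n) (f (Suc n))"
  proof -
    have "\<exists>f. \<forall>n. P n (f n) \<and> Q n (f n) (f (Suc n))"
      using base step by (rule dependent_nat_choice)
    then show thesis using that by blast
  qed
  have summ: "summable \<rho>" and geo: "(\<Sum>k<n. \<rho> k) \<le> 2 * \<tau>" for n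
  proof -
    show s: "summable \<rho>" unfolding \<rho>_def by (intro summable_mult summable_geometric) simp
    have "(\<Sum>k<n. \<rho> k) \<le> suminf \<rho>" by (rule sum_le_suminf[OF s]) (simp_all add: less_imp_le \<rho>(1))
    also have "suminf \<rho> = 2 * \<tau>"
      unfolding \<rho>_def by (subst suminf_mult) (simp_all add: suminf_geometric)
    finally show "(\<Sum>k<n. \<rho> k) \<le> 2 * \<tau>" .
  qed
  have lim: "\<exists>x. X \<longlonglongrightarrow> x \<and> norm x \<le> sqrt c + e"
    if X: "\<And>n. norm (X (Suc n) - X n) \<le> \<rho> n"
      "\<And>n. norm (X n) \<le> sqrt c + \<tau> + (\<Sum>k<n. \<rho> k)" for X :: "nat \<Rightarrow> bergman ^ 'r"
  proof -
    have "summable (\<lambda>n. X (Suc n) - X n)"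
      by (rule summable_comparison_test'[OF summ X(1)])
    then have "(\<lambda>n. (\<Sum>k<n. X (Suc k) - X k) + X 0) \<longlonglongrightarrow> (\<Sum>n. X (Suc n) - X n) + X 0"
      by (intro tendsto_add summable_LIMSEQ tendsto_const)
    then have "X \<longlonglongrightarrow> (\<Sum>n. X (Suc n) - X n) + X 0"
      by (simp add: sum_lessThan_telescope)
    moreover have "norm (X n) \<le> sqrt c + e" for n
      using X(2)[of n] geo[of n] by (simp add: \<tau>_def)
    ultimately show ?thesis
      by (intro exI conjI Lim_norm_ubound[OF sequentially_bot]) auto
  qed
  obtain x where x: "(\<lambda>n. fst (f n)) \<longlonglongrightarrow> x" "norm x \<le> sqrt c + e"
  proof -
    have "\<exists>x. (\<lambda>n. fst (f n)) \<longlonglongrightarrow> x \<and> norm x \<le> sqrt c + e"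
      by (rule lim) (use f in \<open>simp_all add: P_def Q_def\<close>)
    then show thesis using that by blast
  qed
  obtain y where y: "(\<lambda>n. snd (f n)) \<longlonglongrightarrow> y" "norm y \<le> sqrt c + e"
  proof -
    have "\<exists>x. (\<lambda>n. snd (f n)) \<longlonglongrightarrow> x \<and> norm x \<le> sqrt c + e"
      by (rule lim) (use f in \<open>simp_all add: P_def Q_def\<close>)
    then show thesis using that by blast
  qed
  have "\<psi> F = Re (matrix_form F x y)" if F: "F \<in> ?B" for F
  proof -
    have "(\<lambda>n. matrix_form F (fst (f n)) (snd (f n))) \<longlonglongrightarrow> matrix_form F x y"
      unfolding matrix_form_def
      by (intro tendsto_sum bounded_bilinear.tendsto[OF bounded_bilinear_cinner]
          bounded_linear.tendsto[OF bounded_linear_mult_op[OF multiplier_ballD(2)[OF A F]]]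
          tendsto_vec_nth x y)
    then have "(\<lambda>n. \<psi> F - Re (matrix_form F (fst (f n)) (snd (f n)))) \<longlonglongrightarrow> \<psi> F - Re (matrix_form F x y)"
      by (intro tendsto_intros)
    moreover have "(\<lambda>n. \<psi> F - Re (matrix_form F (fst (f n)) (snd (f n)))) \<longlonglongrightarrow> 0"
    proof (rule Lim_null_comparison)
      show "\<forall>\<^sub>F n in sequentially. norm (\<psi> F - Re (matrix_form F (fst (f n)) (snd (f n)))) \<le> \<eta> n"
        using f(1) F by (simp add: P_def)
      have "(\<lambda>n. (\<rho> n)\<^sup>2 / 2) \<longlonglongrightarrow> 0\<^sup>2 / 2"
        by (intro tendsto_intros summable_LIMSEQ_zero[OF summ]) simp
      then show "\<eta> \<longlonglongrightarrow> 0" by (simp add: \<eta>_def)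
    qed
    ultimately have "\<psi> F - Re (matrix_form F x y) = 0" by (rule LIMSEQ_unique)
    then show ?thesis by simp
  qed
  with x(2) y(2) show thesis by (rule that)
qed

end

section \<open>Interpolation\<close>

lemma dual_subalgebra_zero: "dual_subalgebra A \<Longrightarrow> (\<lambda>_. 0) \<in> A"
  using dual_subalgebraD(5)[OF _ dual_subalgebraD(2), of A 0] by simp

lemma mult_op_zero_fun: "mult_op (\<lambda>_. 0) x = 0"
  by (simp add: mult_op_def zero_bergman_def)

lemma dual_subalgebra_sum:
  assumes A: "dual_subalgebra A" and "\<And>i. i \<in> I \<Longrightarrow> f i \<in> A"
  shows "(\<lambda>z. \<Sum>i\<in>I. f i z) \<in> A"
  using assms(2)
  by (induction I rule: infinite_finite_induct) (simp_all add: dual_subalgebra_zero[OF A] dual_subalgebraD(3)[OF A])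

lemma separating_idempotent:
  assumes A: "dual_subalgebra A" and sep: "separates A E" and E: "E \<subseteq> disk" and p: "p \<in> E"
    and "finite S" "S \<subseteq> E - {p}"
  shows "\<exists>e\<in>A. e p = 1 \<and> (\<forall>q\<in>S. e q = 0)"
  using assms(5,6)
proof (induction S)
  case empty
  have "indicator disk p = (1::complex)" using p E by auto
  then show ?case using dual_subalgebraD(2)[OF A] by blast
next
  case (insert q S)
  then obtain e where e: "e \<in> A" "e p = 1" "\<forall>r\<in>S. e r = 0" by auto
  have "q \<in> E" "q \<noteq> p" using insert.prems by auto
  then obtain f where f: "f \<in> A" "f p \<noteq> f q" using sep p unfolding separates_def by metis
  define k where "k = (\<lambda>z. 1 / (f p - f q) * (f z + (- f q) * indicator disk z))"
  have "k \<in> A"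
    unfolding k_def by (intro dual_subalgebraD(3,5)[OF A] f dual_subalgebraD(2)[OF A])
  then have "(\<lambda>z. e z * k z) \<in> A" by (rule dual_subalgebraD(4)[OF A e(1)])
  moreover have "k p = 1" "k q = 0" using f(2) p \<open>q \<in> E\<close> E by (auto simp: k_def)
  ultimately show ?case using e by (intro bexI[of _ "\<lambda>z. e z * k z"]) auto
qed

text \<open>
  The functions are idempotent modulo the ideal of the points. The points may be repeated, and the sum
  runs over the indices.
\<close>

lemma separating_partition_of_unity:
  fixes z :: "'n::finite \<Rightarrow> complex"
  assumes A: "dual_subalgebra A" and sep: "separates A (range z)" and E: "range z \<subseteq> disk"
  obtains e where "\<And>i. e i \<in> A" "\<And>i j. z j \<noteq> z i \<Longrightarrow> e i (z j) = 0" "\<And>j. (\<Sum>i\<in>UNIV. e i (z j)) = 1"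
proof -
  have "\<exists>f. f \<in> A \<and> f (z i) = 1 \<and> (\<forall>q\<in>range z - {z i}. f q = 0)" for i
    using separating_idempotent[OF A sep E rangeI[of z i], of "range z - {z i}"] by auto
  then have "\<forall>i. \<exists>f. f \<in> A \<and> f (z i) = 1 \<and> (\<forall>q\<in>range z - {z i}. f q = 0)" by blast
  from choice[OF this] obtain f
    where "\<forall>i. f i \<in> A \<and> f i (z i) = 1 \<and> (\<forall>q\<in>range z - {z i}. f i q = 0)" by blast
  then have f: "\<And>i. f i \<in> A" "\<And>i. f i (z i) = 1" "\<And>i j. z j \<noteq> z i \<Longrightarrow> f i (z j) = 0"
    by auto
  \<comment> \<open>Of the indices of one point, only a chosen representative carries the idempotent.\<close>
  define rep where "rep = (\<lambda>i. SOME k. z k = z i)"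
  have rep: "z (rep i) = z i" for i unfolding rep_def by (rule someI[of _ i]) simp
  have rep_eq: "rep i = rep j" if "z i = z j" for i j using that by (simp add: rep_def)
  define e where "e = (\<lambda>i. if rep i = i then f i else (\<lambda>_. 0))"
  show thesis
  proof (rule that[of e])
    show "e i \<in> A" for i by (simp add: e_def f dual_subalgebra_zero[OF A])
    show zero: "e i (z j) = 0" if "z j \<noteq> z i" for i j using f(3)[OF that] by (simp add: e_def)
    fix j
    have "(\<Sum>i\<in>UNIV. e i (z j)) = (\<Sum>i\<in>UNIV. if i = rep j then 1 else 0)"
    proof (rule sum.cong[OF refl])
      fix i
      show "e i (z j) = (if i = rep j then 1 else 0)"
      proof (cases "z j = z i")
        case True
        then have "rep i = rep j" using rep_eq by metis
        then show ?thesis using True f(2)[of i] by (auto simp: e_def)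
      next
        case False
        then have "i \<noteq> rep j" using rep[of j] by metis
        then show ?thesis using zero[OF False] by simp
      qed
    qed
    then show "(\<Sum>i\<in>UNIV. e i (z j)) = 1" by simp
  qed
qed

text \<open>
  The vector is a multiple of the reproducing kernel at \<open>w\<close>: the component of the constant function
  orthogonal to the functions that vanish at \<open>w\<close>.
\<close>

lemma ominus_kernel_vector:
  assumes w: "w \<in> disk" and A: "A \<subseteq> hinf"
  obtains h where "h \<noteq> 0" "h \<in> ominus_ideal UNIV (vanishing_ideal A w)"
proof -
  define M where "M = {f. Rep_bergman f w = 0}"
  have M: "closed M" "bergman.subspace M"
    unfolding M_def
    by (intro closed_Collect_eq bounded_linear.continuous_on[OF bounded_linear_Rep_bergman] continuous_intros,
      simp add: bergman.subspace_def zero_bergman.rep_eq plus_bergman.rep_eq cscale.rep_eq)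
  define u where "u = Abs_bergman (indicator disk)"
  have u: "Rep_bergman u = indicator disk"
    unfolding u_def by (rule Abs_bergman_inverse[OF hinf_bergman_functions[OF indicator_disk_hinf]])
  define h where "h = u - proj M u"
  have "u \<notin> M" using w by (simp add: M_def u)
  then have "h \<noteq> 0" using proj_in[OF M, of u] by (auto simp: h_def)
  moreover have "cinner h (mult_op g x) = 0" if "g \<in> vanishing_ideal A w" for g x
  proof -
    have "g \<in> hinf" "g w = 0" using that A by (auto simp: vanishing_ideal_def)
    then have "mult_op g x \<in> M" by (simp add: M_def Rep_mult_op)
    then show ?thesis using proj_spec[OF M, of u] by (simp add: h_def)
  qed
  then have "h \<in> ominus_ideal UNIV (vanishing_ideal A w)" by (simp add: ominus_ideal_def)
  ultimately show thesis by (rule that)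
qed

lemma UNIV_in_Lat: "UNIV \<in> Lat A"
  by (simp add: Lat_def bergman.subspace_UNIV)

text \<open>
  For the whole space \<open>L\<close>, take the family with \<open>v\<close> at \<open>i\<close> and \<open>-v\<close> at \<open>j\<close>, in the same component of \<open>\<complex>\<^sup>r\<close>, and 0
  elsewhere. Its sum is 0, hence so is the sum of its images under the adjoint matrices.
\<close>

lemma contractive_imp_consistent:
  fixes z :: "'n::finite \<Rightarrow> complex" and W :: "'n \<Rightarrow> complex ^ 'r::finite ^ 'r"
  assumes A: "A \<subseteq> hinf" and z: "z i \<in> disk" and eq: "z i = z j"
    and contr: "adjoint_contractive W (\<lambda>i. ominus_ideal UNIV (vanishing_ideal A (z i)))"
  shows "W i = W j"
proof (cases "i = j")
  case False
  obtain v where v: "v \<noteq> 0" "v \<in> ominus_ideal UNIV (vanishing_ideal A (z i))"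
    using ominus_kernel_vector[OF z A] by blast
  note sub = ominus_ideal_closed(2)[OF closed_UNIV bergman.subspace_UNIV]
  have "W i $ a0 $ c0 = W j $ a0 $ c0" for a0 c0
  proof -
    define h where "h = (\<lambda>k a. if a = a0 then cscale ((if k = i then 1 else 0) - (if k = j then 1 else 0)) v else 0)"
    have hN: "h k a \<in> ominus_ideal UNIV (vanishing_ideal A (z k))" for k a
      using v(2) eq False bergman.subspace_neg[OF sub v(2)] bergman.subspace_0[OF sub]
      by (auto simp: h_def)
    have H0: "(\<Sum>k\<in>UNIV. h k a) = 0" for a
    proof -
      have "(\<Sum>k\<in>UNIV. h k a) = (if a = a0 then cscale (\<Sum>k\<in>UNIV. (if k = i then 1 else 0) - (if k = j then 1 else 0)) v else 0)"
        by (simp add: h_def bergman.scale_sum_left)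
      also have "(\<Sum>k\<in>UNIV. (if k = i then 1 else 0) - (if k = j then 1 else (0::complex))) = 0"
        by (simp add: sum_subtractf)
      finally show ?thesis by simp
    qed
    have K0: "(\<Sum>k\<in>UNIV. \<Sum>a\<in>UNIV. cscale (cnj (W k $ a $ c)) (h k a)) = cscale (cnj (W i $ a0 $ c) - cnj (W j $ a0 $ c)) v" for c
    proof -
      have "(\<Sum>k\<in>UNIV. \<Sum>a\<in>UNIV. cscale (cnj (W k $ a $ c)) (h k a))
          = (\<Sum>k\<in>UNIV. cscale (cnj (W k $ a0 $ c) * ((if k = i then 1 else 0) - (if k = j then 1 else 0))) v)"
        by (simp add: h_def if_distrib[of "cscale _"] cong: if_cong)
      also have "\<dots> = cscale (\<Sum>k\<in>UNIV. cnj (W k $ a0 $ c) * ((if k = i then 1 else 0) - (if k = j then 1 else 0))) v"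
        by (simp add: bergman.scale_sum_left)
      also have "(\<Sum>k\<in>UNIV. cnj (W k $ a0 $ c) * ((if k = i then 1 else 0) - (if k = j then 1 else 0)))
          = cnj (W i $ a0 $ c) - cnj (W j $ a0 $ c)"
      proof -
        have "(\<Sum>k\<in>UNIV. cnj (W k $ a0 $ c) * ((if k = i then 1 else 0) - (if k = j then 1 else 0)))
            = (\<Sum>k\<in>UNIV. (if k = i then cnj (W k $ a0 $ c) else 0) - (if k = j then cnj (W k $ a0 $ c) else 0))"
          by (intro sum.cong) auto
        then show ?thesis by (simp add: sum_subtractf)
      qed
      finally show ?thesis .
    qed
    from contr[unfolded adjoint_contractive_def, rule_format, of h, OF hN] have "(\<Sum>c\<in>UNIV. (norm (cscale (cnj (W i $ a0 $ c) - cnj (W j $ a0 $ c)) v))\<^sup>2) \<le> 0"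
      unfolding H0 K0 by simp
    then have "(\<Sum>c\<in>UNIV. (norm (cscale (cnj (W i $ a0 $ c) - cnj (W j $ a0 $ c)) v))\<^sup>2) = 0"
      by (intro antisym sum_nonneg) auto
    then have "(norm (cscale (cnj (W i $ a0 $ c0) - cnj (W j $ a0 $ c0)) v))\<^sup>2 = 0"
      by (subst (asm) sum_nonneg_eq_0_iff) auto
    then have "cnj (W i $ a0 $ c0 - W j $ a0 $ c0) = 0"
      using v(1) by (simp add: norm_cscale)
    then show ?thesis by simp
  qed
  then show ?thesis by (simp add: vec_eq_iff)
qed simp

definition invariant_span :: "(complex \<Rightarrow> complex) set \<Rightarrow> bergman ^ 'r \<Rightarrow> bergman set"
  where "invariant_span A x = closure {\<Sum>b\<in>UNIV. mult_op (f b) (x $ b) | f. \<forall>b. f b \<in> A}"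

lemma invariant_span_in_Lat:
  fixes x :: "bergman ^ 'r::finite"
  assumes A: "dual_subalgebra A"
  shows "invariant_span A x \<in> Lat A"
proof -
  define L0 where "L0 = {\<Sum>b\<in>UNIV. mult_op (f b) (x $ b) | f. \<forall>b. f b \<in> A}"
  have L: "invariant_span A x = closure L0" by (simp add: invariant_span_def L0_def)
  have hinf: "f \<in> A \<Longrightarrow> f \<in> hinf" for f using dual_subalgebraD(1)[OF A] by blast
  have add: "u + v \<in> L0" if "u \<in> L0" "v \<in> L0" for u v
  proof -
    from that obtain f g where fg: "\<forall>b. f b \<in> A" "\<forall>b. g b \<in> A"
      "u = (\<Sum>b\<in>UNIV. mult_op (f b) (x $ b))" "v = (\<Sum>b\<in>UNIV. mult_op (g b) (x $ b))"
      by (auto simp: L0_def)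
    then have "u + v = (\<Sum>b\<in>UNIV. mult_op (\<lambda>z. f b z + g b z) (x $ b))"
      by (simp add: mult_op_add_fun hinf sum.distrib)
    moreover have "\<forall>b. (\<lambda>z. f b z + g b z) \<in> A" using fg by (simp add: dual_subalgebraD(3)[OF A])
    ultimately show ?thesis
      unfolding L0_def by (intro CollectI exI[of _ "\<lambda>b z. f b z + g b z"] conjI)
  qed
  have scale: "cscale c u \<in> L0" if "u \<in> L0" for c u
  proof -
    from that obtain f where f: "\<forall>b. f b \<in> A" "u = (\<Sum>b\<in>UNIV. mult_op (f b) (x $ b))"
      by (auto simp: L0_def)
    then have "cscale c u = (\<Sum>b\<in>UNIV. mult_op (\<lambda>z. c * f b z) (x $ b))"
      by (simp add: mult_op_cmult_fun hinf bergman.scale_sum_right)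
    moreover have "\<forall>b. (\<lambda>z. c * f b z) \<in> A" using f by (simp add: dual_subalgebraD(5)[OF A])
    ultimately show ?thesis
      unfolding L0_def by (intro CollectI exI[of _ "\<lambda>b z. c * f b z"] conjI)
  qed
  have mult: "mult_op g u \<in> L0" if "u \<in> L0" and g: "g \<in> A" for g u
  proof -
    from that obtain f where f: "\<forall>b. f b \<in> A" "u = (\<Sum>b\<in>UNIV. mult_op (f b) (x $ b))"
      by (auto simp: L0_def)
    have gf: "\<forall>b. (\<lambda>z. g z * f b z) \<in> A" using f g by (simp add: dual_subalgebraD(4)[OF A])
    have "mult_op g u = (\<Sum>b\<in>UNIV. mult_op g (mult_op (f b) (x $ b)))"
      unfolding f(2) by (rule linear_sum[OF bounded_linear.linear[OF bounded_linear_mult_op[OF hinf[OF g]]]])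
    also have "\<dots> = (\<Sum>b\<in>UNIV. mult_op (\<lambda>z. g z * f b z) (x $ b))"
      using f g gf by (simp add: mult_op_mult_fun hinf)
    finally show ?thesis
      using gf unfolding L0_def by (intro CollectI exI[of _ "\<lambda>b z. g z * f b z"] conjI)
  qed
  have "0 \<in> L0"
    unfolding L0_def
    by (intro CollectI exI[of _ "\<lambda>b z. 0"] conjI)
      (simp_all add: dual_subalgebra_zero[OF A] mult_op_zero_fun)
  have image: "T u \<in> closure L0" if T: "bounded_linear T" "\<And>u. u \<in> L0 \<Longrightarrow> T u \<in> L0" and u: "u \<in> closure L0" for T u
  proof -
    have "T ` closure L0 \<subseteq> closure (T ` L0)" by (rule closure_bounded_linear_image_subset[OF T(1)])
    also have "\<dots> \<subseteq> closure L0" using T(2) by (intro closure_mono) blast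
    finally show ?thesis using u by blast
  qed
  have "u + v \<in> closure L0" if uv: "u \<in> closure L0" "v \<in> closure L0" for u v
  proof -
    from uv obtain s t where "\<And>n. s n \<in> L0" "s \<longlonglongrightarrow> u" "\<And>n. t n \<in> L0" "t \<longlonglongrightarrow> v"
      unfolding closure_sequential by blast
    then show ?thesis
      unfolding closure_sequential by (intro exI[of _ "\<lambda>n. s n + t n"]) (auto intro: add tendsto_add)
  qed
  moreover have "cscale c u \<in> closure L0" if "u \<in> closure L0" for c u
    by (rule image[OF bounded_linear_cscale _ that]) (rule scale)
  moreover have "mult_op g u \<in> closure L0" if "u \<in> closure L0" "g \<in> A" for g u
    by (rule image[OF bounded_linear_mult_op[OF hinf[OF that(2)]] _ that(1)]) (rule mult[OF _ that(2)])
  moreover have "0 \<in> closure L0" using \<open>0 \<in> L0\<close> closure_subset by blast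
  ultimately show ?thesis
    unfolding L Lat_def bergman.subspace_def by (simp add: image_subset_iff)
qed

lemma component_in_invariant_span:
  assumes A: "dual_subalgebra A"
  shows "x $ b \<in> invariant_span A x"
proof -
  define f where "f = (\<lambda>c. if c = b then indicator disk else (\<lambda>_. 0 :: complex))"
  have "mult_op (f c) (x $ c) = (if c = b then x $ c else 0)" for c
    by (simp add: f_def mult_op_indicator mult_op_zero_fun)
  then have "x $ b = (\<Sum>c\<in>UNIV. mult_op (f c) (x $ c))"
    by (simp only: sum.delta finite if_True UNIV_I)
  moreover have "\<forall>c. f c \<in> A"
    using dual_subalgebraD(2)[OF A] dual_subalgebra_zero[OF A] by (simp add: f_def)
  ultimately have "x $ b \<in> {\<Sum>b\<in>UNIV. mult_op (f b) (x $ b) | f. \<forall>b. f b \<in> A}"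
    by (intro CollectI exI[of _ f] conjI)
  then show ?thesis unfolding invariant_span_def by (rule subsetD[OF closure_subset])
qed

lemma invariant_span_orthogonal:
  fixes x :: "bergman ^ 'r::finite"
  assumes A: "dual_subalgebra A" and g: "g \<in> hinf" and v: "v \<in> invariant_span A x"
    and orth: "\<And>f b. f \<in> A \<Longrightarrow> cinner (mult_op g (mult_op f (x $ b))) y = 0"
  shows "cinner (mult_op g v) y = 0"
proof -
  have "closed {v. cinner (mult_op g v) y = 0}"
    by (intro closed_Collect_eq continuous_intros bounded_linear.continuous_on[OF
          bounded_linear_compose[OF bounded_linear_cinner_left bounded_linear_mult_op[OF g]]])
  moreover have "{\<Sum>b\<in>UNIV. mult_op (f b) (x $ b) | f. \<forall>b. f b \<in> A} \<subseteq> {v. cinner (mult_op g v) y = 0}"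
    using orth by (auto simp: linear_sum[OF bounded_linear.linear[OF bounded_linear_mult_op[OF g]]] cinner_sum)
  ultimately have "invariant_span A x \<subseteq> {v. cinner (mult_op g v) y = 0}"
    unfolding invariant_span_def by (intro closure_minimal)
  then show ?thesis using v by blast
qed


lemma norm_block_op_multiplier_ball_le:
  fixes F :: "bergman ^ 'r::finite ^ 'r"
  assumes A: "dual_subalgebra A" and F: "F \<in> multiplier_ball A"
  shows "norm (block_op (\<lambda>a b. mult_op (Rep_bergman (F $ a $ b))) x) \<le> norm x"
proof (rule power2_le_imp_le)
  let ?y = "block_op (\<lambda>a b. mult_op (Rep_bergman (F $ a $ b))) x"
  have sq: "(norm v)\<^sup>2 = (LINT w:disk|lborel. (norm (\<chi> a. Rep_bergman (v $ a) w))\<^sup>2)"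
    and int: "set_integrable lborel disk (\<lambda>w. (norm (\<chi> a. Rep_bergman (v $ a) w))\<^sup>2)" for v :: "bergman ^ 'r"
  proof -
    show "(norm v)\<^sup>2 = (LINT w:disk|lborel. (norm (\<chi> a. Rep_bergman (v $ a) w))\<^sup>2)"
      unfolding norm_vec_squared norm_bergman_squared set_lebesgue_integral_def vec_lambda_beta scaleR_sum_right
      using Rep_bergman_square_integrable unfolding set_integrable_def
      by (intro Bochner_Integration.integral_sum[symmetric])
    show "set_integrable lborel disk (\<lambda>w. (norm (\<chi> a. Rep_bergman (v $ a) w))\<^sup>2)"
      unfolding norm_vec_squared vec_lambda_beta set_integrable_def scaleR_sum_right
      using Rep_bergman_square_integrable unfolding set_integrable_def
      by (intro Bochner_Integration.integrable_sum)
  qed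
  show "(norm ?y)\<^sup>2 \<le> (norm x)\<^sup>2"
    unfolding sq
  proof (rule set_integral_mono[OF int int])
    fix w assume w: "w \<in> disk"
    have "(\<chi> a. Rep_bergman (?y $ a) w) = symbol F w *v (\<chi> a. Rep_bergman (x $ a) w)"
      by (simp add: vec_eq_iff block_op_def Rep_bergman_sum Rep_mult_op[OF multiplier_ballD(2)[OF A F]]
          symbol_def matrix_vector_mult_def)
    then show "(norm (\<chi> a. Rep_bergman (?y $ a) w))\<^sup>2 \<le> (norm (\<chi> a. Rep_bergman (x $ a) w))\<^sup>2"
      using multiplier_ballD(4)[OF A F w] by (simp add: power_mono)
  qed
qed simp

lemma multiplier_ball_absorbs:
  fixes F :: "bergman ^ 'r::finite ^ 'r"
  assumes A: "dual_subalgebra A" and F: "\<And>a b. Rep_bergman (F $ a $ b) \<in> A"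
  obtains t where "0 < t" "t *\<^sub>R F \<in> multiplier_ball A"
proof -
  have "\<exists>C\<ge>0. \<forall>z. cmod (Rep_bergman (F $ a $ b) z) \<le> C" for a b
    using hinfD(3) F dual_subalgebraD(1)[OF A] by blast
  then have "\<forall>p. \<exists>C. 0 \<le> C \<and> (\<forall>z. cmod (Rep_bergman (F $ fst p $ snd p) z) \<le> C)" by blast
  from choice[OF this] obtain C where C0: "\<And>p. 0 \<le> C p" and C: "\<And>p z. cmod (Rep_bergman (F $ fst p $ snd p) z) \<le> C p"
    by blast
  define K where "K = 1 + (\<Sum>a\<in>UNIV. \<Sum>b\<in>UNIV. C (a, b))"
  have K: "0 < K" unfolding K_def by (intro add_pos_nonneg sum_nonneg C0) simp
  have bound: "norm (symbol F w *v u) \<le> K * norm u" for w u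
  proof -
    have "norm (symbol F w *v u) \<le> (\<Sum>a\<in>UNIV. cmod ((symbol F w *v u) $ a))"
      unfolding norm_vec_def by (rule L2_set_le_sum) simp
    also have "\<dots> \<le> (\<Sum>a\<in>UNIV. \<Sum>b\<in>UNIV. C (a, b) * norm u)"
    proof (rule sum_mono)
      fix a
      have "cmod ((symbol F w *v u) $ a) \<le> (\<Sum>b\<in>UNIV. cmod (Rep_bergman (F $ a $ b) w * u $ b))"
        by (simp add: symbol_def matrix_vector_mult_def norm_sum)
      also have "\<dots> \<le> (\<Sum>b\<in>UNIV. C (a, b) * norm u)"
        unfolding norm_mult using C[of "(a, _)"] C0
        by (intro sum_mono mult_mono Finite_Cartesian_Product.norm_nth_le) auto
      finally show "cmod ((symbol F w *v u) $ a) \<le> (\<Sum>b\<in>UNIV. C (a, b) * norm u)" .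
    qed
    also have "\<dots> \<le> K * norm u" by (simp add: K_def distrib_right sum_distrib_right)
    finally show ?thesis .
  qed
  show thesis
  proof (rule that[of "1 / K"])
    show "(1 / K) *\<^sub>R F \<in> multiplier_ball A"
    proof (rule multiplier_ball_scaleI[OF A F])
      fix w u
      have "norm (symbol F w *v u) / K \<le> K * norm u / K" using K by (intro divide_right_mono bound) simp
      then show "\<bar>1 / K\<bar> * norm (symbol F w *v u) \<le> norm u" using K by simp
    qed
  qed (use K in simp)
qed

lemma matrix_form_scaleR:
  assumes "\<And>a b. Rep_bergman (F $ a $ b) \<in> hinf"
  shows "matrix_form (t *\<^sub>R F) x y = of_real t * matrix_form F x y"
proof -
  have "Rep_bergman ((t *\<^sub>R F) $ a $ b) = (\<lambda>z. of_real t * Rep_bergman (F $ a $ b) z)" for a b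
    by (simp add: fun_eq_iff Rep_bergman_scaleR)
  then show ?thesis
    using assms by (simp add: matrix_form_def mult_op_cmult_fun cinner_cscale_left sum_distrib_left)
qed

text \<open>
  Let \<open>L\<close> be the invariant subspace generated by the entries of \<open>x\<close>. Only the projection \<open>y'\<close> of \<open>y\<close> to \<open>L\<close>
  matters, and it is orthogonal to the multiples of the functions that vanish at all the points. Applying the
  compressed adjoints of a partition of unity splits \<open>y'\<close> into vectors \<open>h\<^sub>i\<close> of the spaces \<open>L \<ominus> \<JJ>\<^sub>i L\<close>, on which
  the adjoint of \<open>F\<close> acts as \<open>W\<^sub>i\<^sup>*\<close>.
\<close>

lemma matrix_form_le_of_contractive:
  fixes z :: "'n::finite \<Rightarrow> complex" and F :: "bergman ^ 'r::finite ^ 'r" and W :: "'n \<Rightarrow> complex ^ 'r ^ 'r"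
  assumes A: "dual_subalgebra A" and z: "range z \<subseteq> disk"
    and e: "\<And>i. e i \<in> A" "\<And>i j. z j \<noteq> z i \<Longrightarrow> e i (z j) = 0" "\<And>j. (\<Sum>i\<in>UNIV. e i (z j)) = 1"
    and F: "\<And>a b. Rep_bergman (F $ a $ b) \<in> A" "\<And>i. symbol F (z i) = W i"
    and orth: "\<And>g a b. g \<in> A \<Longrightarrow> (\<And>i. g (z i) = 0) \<Longrightarrow> cinner (mult_op g (x $ b)) (y $ a) = 0"
    and contr: "\<And>L. L \<in> Lat A \<Longrightarrow>
      adjoint_contractive W (\<lambda>i. ominus_ideal L (vanishing_ideal A (z i)))"
  shows "cmod (matrix_form F x y) \<le> norm x * norm y"
proof -
  have hinf: "f \<in> A \<Longrightarrow> f \<in> hinf" for f using dual_subalgebraD(1)[OF A] by blast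
  have zi: "z i \<in> disk" for i using z by blast
  define L where "L = invariant_span A x"
  have LA: "L \<in> Lat A" unfolding L_def by (rule invariant_span_in_Lat[OF A])
  note L = Lat_D[OF LA]
  have xL: "x $ b \<in> L" for b unfolding L_def by (rule component_in_invariant_span[OF A])
  define y' where "y' = (\<lambda>a. proj L (y $ a))"
  have y'L: "y' a \<in> L" and y'_eq: "v \<in> L \<Longrightarrow> cinner v (y' a) = cinner v (y $ a)" for v a
    unfolding y'_def using proj_in[OF L(1,2)] cinner_proj_right[OF L(1,2)] by auto
  have orthL: "cinner (mult_op g v) (y' a) = 0" if g: "g \<in> A" "\<And>i. g (z i) = 0" and v: "v \<in> L" for g v a
  proof -
    have "cinner (mult_op g v) (y $ a) = 0"
    proof (rule invariant_span_orthogonal[OF A hinf[OF g(1)] v[unfolded L_def]])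
      fix f b assume f: "f \<in> A"
      have gf: "(\<lambda>z. g z * f z) \<in> A" by (rule dual_subalgebraD(4)[OF A g(1) f])
      have "cinner (mult_op (\<lambda>z. g z * f z) (x $ b)) (y $ a) = 0"
        by (rule orth[OF gf]) (simp add: g(2))
      then show "cinner (mult_op g (mult_op f (x $ b))) (y $ a) = 0"
        by (simp add: mult_op_mult_fun hinf g(1) f gf)
    qed
    then show ?thesis using y'_eq[OF L(3)[OF g(1) v]] by simp
  qed
  have "\<exists>h. \<forall>v. cinner (mult_op (e i) v) (y' a) = cinner v h" for i a
    using mult_op_adjoint[OF hinf[OF e(1)]] by blast
  then have "\<forall>p. \<exists>h. \<forall>v. cinner (mult_op (e (fst p)) v) (y' (snd p)) = cinner v h" by blast
  from choice[OF this] obtain k where k: "\<And>p v. cinner (mult_op (e (fst p)) v) (y' (snd p)) = cinner v (k p)"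
    by blast
  define h where "h = (\<lambda>i a. proj L (k (i, a)))"
  have hL: "h i a \<in> L" for i a unfolding h_def by (rule proj_in[OF L(1,2)])
  have h: "cinner v (h i a) = cinner (mult_op (e i) v) (y' a)" if "v \<in> L" for i a v
    using k[where p = "(i, a)"] by (simp add: h_def cinner_proj_right[OF L(1,2) that])
  have hN: "h i a \<in> ominus_ideal L (vanishing_ideal A (z i))" for i a
  proof -
    have "cinner (h i a) (mult_op g v) = 0" if g: "g \<in> vanishing_ideal A (z i)" and v: "v \<in> L" for g v
    proof -
      have gA: "g \<in> A" "g (z i) = 0" using g by (auto simp: vanishing_ideal_def)
      have eg: "(\<lambda>w. e i w * g w) \<in> A" by (rule dual_subalgebraD(4)[OF A e(1) gA(1)])
      have "cinner (mult_op g v) (h i a) = cinner (mult_op (\<lambda>w. e i w * g w) v) (y' a)"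
        using h[OF L(3)[OF gA(1) v]] by (simp add: mult_op_mult_fun hinf e(1) gA(1) eg)
      also have "\<dots> = 0"
      proof (rule orthL[OF eg _ v])
        show "e i (z j) * g (z j) = 0" for j
          using e(2)[of j i] gA(2) by (cases "z j = z i") auto
      qed
      finally show ?thesis by (subst cinner_commute) simp
    qed
    then show ?thesis using hL by (simp add: ominus_ideal_def)
  qed
  have sum_h: "(\<Sum>i\<in>UNIV. h i a) = y' a" for a
  proof -
    define d where "d = (\<Sum>i\<in>UNIV. h i a) - y' a"
    have dL: "d \<in> L"
      unfolding d_def by (intro bergman.subspace_diff bergman.subspace_sum L(2) hL y'L)
    define s where "s = (\<lambda>w. (\<Sum>i\<in>UNIV. e i w))"
    have sA: "s \<in> A" unfolding s_def by (rule dual_subalgebra_sum[OF A e(1)])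
    define g where "g = (\<lambda>w. s w + (- 1) * indicator disk w)"
    have mA: "(\<lambda>w. (- 1) * indicator disk w :: complex) \<in> A" by (intro dual_subalgebraD(5,2)[OF A])
    have gA: "g \<in> A" unfolding g_def by (rule dual_subalgebraD(3)[OF A sA mA])
    have "mult_op s d = (\<Sum>i\<in>UNIV. mult_op (e i) d)"
      by (rule bergman_eqI) (simp add: Rep_mult_op hinf sA e(1) Rep_bergman_sum, simp add: s_def sum_distrib_right)
    then have "(\<Sum>i\<in>UNIV. cinner d (h i a)) = cinner (mult_op s d) (y' a)"
      by (simp add: h[OF dL] cinner_sum)
    moreover have "mult_op g d = mult_op s d - d"
      unfolding g_def using sA mA
      by (simp only: mult_op_add_fun hinf mult_op_cmult_fun indicator_disk_hinf mult_op_indicator) simp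
    moreover have "cinner (mult_op g d) (y' a) = 0"
      by (rule orthL[OF gA _ dL]) (use zi in \<open>simp add: g_def s_def e(3)\<close>)
    ultimately have "cinner d d = 0"
      by (subst (2) d_def) (simp add: cinner_diff cinner_sum)
    then have "d = 0" by (simp add: cinner_self_norm)
    then show ?thesis by (simp add: d_def)
  qed
  define K where "K = (\<chi> b. \<Sum>i\<in>UNIV. \<Sum>a\<in>UNIV. cscale (cnj (W i $ a $ b)) (h i a))"
  have "matrix_form F x y = (\<Sum>a\<in>UNIV. \<Sum>b\<in>UNIV. \<Sum>i\<in>UNIV. W i $ a $ b * cinner (x $ b) (h i a))"
    unfolding matrix_form_def
  proof (intro sum.cong refl)
    fix a b
    have "cinner (mult_op (Rep_bergman (F $ a $ b)) (x $ b)) (y $ a) = cinner (mult_op (Rep_bergman (F $ a $ b)) (x $ b)) (y' a)"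
      by (rule y'_eq[symmetric]) (rule L(3)[OF F(1) xL])
    also have "\<dots> = (\<Sum>i\<in>UNIV. cinner (mult_op (Rep_bergman (F $ a $ b)) (x $ b)) (h i a))"
      by (simp add: cinner_sum flip: sum_h)
    also have "\<dots> = (\<Sum>i\<in>UNIV. W i $ a $ b * cinner (x $ b) (h i a))"
      by (intro sum.cong refl)
        (simp add: cinner_ominus_vanishing_ideal[OF A LA zi hN F(1) xL] symbol_def flip: F(2))
    finally show "cinner (mult_op (Rep_bergman (F $ a $ b)) (x $ b)) (y $ a) = (\<Sum>i\<in>UNIV. W i $ a $ b * cinner (x $ b) (h i a))" .
  qed
  also have "\<dots> = (\<Sum>b\<in>UNIV. cinner (x $ b) (K $ b))"
    by (subst sum.swap, simp add: K_def cinner_sum cinner_cscale_right, rule sum.cong[OF refl], rule sum.swap)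
  finally have "cmod (matrix_form F x y) \<le> norm x * norm K"
    using cinner_vec_Cauchy_Schwarz[of x K] by simp
  also have "norm K \<le> norm y"
  proof (rule power2_le_imp_le)
    have "(norm K)\<^sup>2 \<le> (\<Sum>a\<in>UNIV. (norm (\<Sum>i\<in>UNIV. h i a))\<^sup>2)"
      using contr[OF LA] hN unfolding adjoint_contractive_def by (simp add: norm_vec_squared K_def)
    also have "\<dots> \<le> (\<Sum>a\<in>UNIV. (norm (y $ a))\<^sup>2)"
      unfolding sum_h y'_def by (intro sum_mono power_mono norm_proj_le L(1,2)) auto
    finally show "(norm K)\<^sup>2 \<le> (norm y)\<^sup>2" by (simp add: norm_vec_squared)
  qed simp
  finally show ?thesis by (simp add: mult_left_mono)
qed


text \<open>
  If the values \<open>W\<close> are not attained on the ball, a functional \<open>\<psi>\<close> of the values separates them from the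
  compact convex set of attained values. Factoring \<open>\<psi>\<close> as \<open>Re \<langle>F x, y\<rangle>\<close> and evaluating it at some matrix over
  \<open>A\<close> with the values \<open>W\<close>, whatever its norm, contradicts the preceding estimate.
\<close>

lemma interpolant_exists:
  fixes z :: "'n::finite \<Rightarrow> complex" and W :: "'n \<Rightarrow> complex ^ 'r::finite ^ 'r"
  assumes A: "dual_subalgebra A" and z: "range z \<subseteq> disk" and sep: "separates A (range z)"
    and contr: "\<And>L. L \<in> Lat A \<Longrightarrow>
      adjoint_contractive W (\<lambda>i. ominus_ideal L (vanishing_ideal A (z i)))"
  shows "\<exists>F\<in>multiplier_ball A. \<forall>i. symbol F (z i) = W i"
proof (rule ccontr)
  assume no: "\<not> ?thesis"
  have hinf: "f \<in> A \<Longrightarrow> f \<in> hinf" for f using dual_subalgebraD(1)[OF A] by blast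
  have zi: "z i \<in> disk" for i using z by blast
  let ?B = "multiplier_ball A :: (bergman ^ 'r ^ 'r) set"
  define ev where "ev = (\<lambda>F :: bergman ^ 'r ^ 'r. \<chi> i. symbol F (z i))"
  have ev: "bounded_linear ev"
    unfolding ev_def symbol_def by (intro bounded_linear_vec_lambda bounded_linear_symbol_entry)
  interpret ev: bounded_linear ev by fact
  have "compact (ev ` ?B)"
    by (intro compact_continuous_image compact_multiplier_ball[OF A] bounded_linear.continuous_on[OF ev] continuous_intros)
  moreover have "convex (ev ` ?B)"
    by (intro convex_linear_image multiplier_ball_convex[OF A] ev.linear)
  moreover have "ev ` ?B \<noteq> {}" using multiplier_ball_zero[OF A] by blast
  moreover have "(\<chi> i. W i) \<notin> ev ` ?B" using no by (auto simp: ev_def vec_eq_iff)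
  ultimately obtain G s where G: "\<And>q. q \<in> ev ` ?B \<Longrightarrow> inner q G \<le> s" "s < inner (\<chi> i. W i) G"
    using separate_point_from_closed_convex compact_imp_closed by blast
  define \<psi> where "\<psi> = (\<lambda>F. inner (ev F) G)"
  define d where "d = inner (\<chi> i. W i) G"
  have \<psi>: "bounded_linear \<psi>"
    unfolding \<psi>_def by (rule bounded_linear_compose[OF bounded_linear_inner_left ev])
  have "0 \<le> s" using G(1)[OF imageI[OF multiplier_ball_zero[OF A]]] by (simp add: ev.zero)
  define c where "c = (s + d) / 2"
  have c: "0 < c" "s \<le> c" "c < d" using \<open>0 \<le> s\<close> G(2) by (auto simp: c_def d_def)
  have le: "\<forall>F\<in>?B. \<psi> F \<le> c" using G(1) c(2) by (fastforce simp: \<psi>_def)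
  define \<epsilon> where "\<epsilon> = (sqrt d - sqrt c) / 2"
  have \<epsilon>: "0 < \<epsilon>" using c by (simp add: \<epsilon>_def)
  obtain x y where xy: "norm x \<le> sqrt c + \<epsilon>" "norm y \<le> sqrt c + \<epsilon>"
    "\<And>F. F \<in> ?B \<Longrightarrow> \<psi> F = Re (matrix_form F x y)"
    using functional_factorization[OF A \<psi> c(1) le \<epsilon>] by blast
  have rep: "\<psi> F = Re (matrix_form F x y)" if F: "\<And>a b. Rep_bergman (F $ a $ b) \<in> A" for F
  proof -
    obtain t where t: "0 < t" "t *\<^sub>R F \<in> ?B" using multiplier_ball_absorbs[OF A F] by blast
    have "t * \<psi> F = \<psi> (t *\<^sub>R F)" by (simp add: \<psi>_def ev.scaleR)
    also have "\<dots> = Re (matrix_form (t *\<^sub>R F) x y)" by (rule xy(3)[OF t(2)])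
    also have "\<dots> = t * Re (matrix_form F x y)" by (simp add: matrix_form_scaleR hinf F)
    finally show ?thesis using t(1) by simp
  qed
  have orth: "cinner (mult_op g (x $ b)) (y $ a) = 0" if g: "g \<in> A" "\<And>i. g (z i) = 0" for g a b
  proof -
    have re: "Re (cinner (mult_op k (x $ b)) (y $ a)) = 0" if k: "k \<in> A" "\<And>i. k (z i) = 0" for k
    proof -
      define f where "f = Abs_bergman k"
      have f: "Rep_bergman f = k"
        unfolding f_def by (rule Abs_bergman_inverse[OF hinf_bergman_functions[OF hinf[OF k(1)]]])
      define F :: "bergman ^ 'r ^ 'r" where "F = (\<chi> a' b'. if a' = a \<and> b' = b then f else 0)"
      have zero: "Rep_bergman 0 = (\<lambda>_. 0)" by (simp add: zero_bergman.rep_eq)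
      have FA: "Rep_bergman (F $ a' $ b') \<in> A" for a' b'
        using k(1) dual_subalgebra_zero[OF A] by (simp add: F_def f zero)
      have "ev F = 0"
        by (simp add: ev_def symbol_def F_def vec_eq_iff f zero k(2))
      then have "Re (matrix_form F x y) = 0" using rep[OF FA] by (simp add: \<psi>_def)
      moreover have "matrix_form F x y = (\<Sum>a'\<in>UNIV. \<Sum>b'\<in>UNIV. if b' = b then (if a' = a then cinner (mult_op k (x $ b)) (y $ a) else 0) else 0)"
        unfolding matrix_form_def
        by (intro sum.cong refl) (auto simp: F_def f zero mult_op_zero_fun)
      ultimately show ?thesis by simp
    qed
    have "(\<lambda>w. \<i> * g w) \<in> A" by (rule dual_subalgebraD(5)[OF A g(1)])
    from re[OF this] have "Im (cinner (mult_op g (x $ b)) (y $ a)) = 0"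
      using g by (simp add: mult_op_cmult_fun hinf cinner_cscale_left)
    with re[OF g] show ?thesis by (simp add: complex_eq_iff)
  qed
  obtain e where e: "\<And>i. e i \<in> A" "\<And>i j. z j \<noteq> z i \<Longrightarrow> e i (z j) = 0" "\<And>j. (\<Sum>i\<in>UNIV. e i (z j)) = 1"
    using separating_partition_of_unity[OF A sep z] by blast
  have W_eq: "W i = W j" if "z i = z j" for i j
    using contractive_imp_consistent[OF dual_subalgebraD(1)[OF A] zi that contr[OF UNIV_in_Lat]] .
  define f where "f = (\<lambda>a b w. \<Sum>i\<in>UNIV. W i $ a $ b * e i w)"
  have fA: "f a b \<in> A" for a b
    unfolding f_def by (intro dual_subalgebra_sum[OF A] dual_subalgebraD(5)[OF A] e)
  define F where "F = (\<chi> a b. Abs_bergman (f a b))"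
  have F: "Rep_bergman (F $ a $ b) = f a b" for a b
    by (simp add: F_def Abs_bergman_inverse[OF hinf_bergman_functions[OF hinf[OF fA]]])
  have FW: "symbol F (z j) = W j" for j
  proof -
    have "f a b (z j) = W j $ a $ b" for a b
    proof -
      have "f a b (z j) = (\<Sum>i\<in>UNIV. W j $ a $ b * e i (z j))"
        unfolding f_def
      proof (rule sum.cong[OF refl])
        fix i
        show "W i $ a $ b * e i (z j) = W j $ a $ b * e i (z j)"
          using W_eq[of i j] e(2)[of j i] by (cases "z j = z i") auto
      qed
      then show ?thesis by (simp add: e(3) flip: sum_distrib_left)
    qed
    then show ?thesis by (simp add: symbol_def F vec_eq_iff)
  qed
  have "cmod (matrix_form F x y) \<le> norm x * norm y"
    by (rule matrix_form_le_of_contractive[OF A z e _ FW orth contr]) (simp_all add: F fA)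
  also have "\<dots> \<le> (sqrt c + \<epsilon>) * (sqrt c + \<epsilon>)"
    using xy(1,2) by (intro mult_mono) (auto intro: order_trans[OF norm_ge_zero])
  also have "\<dots> < sqrt d * sqrt d"
  proof (rule mult_strict_mono)
    show "sqrt c + \<epsilon> < sqrt d" "sqrt c + \<epsilon> < sqrt d" using \<epsilon> by (auto simp: \<epsilon>_def field_simps)
  qed (use c \<epsilon> in auto)
  also have "\<dots> = d" using c by simp
  finally have "cmod (matrix_form F x y) < d" .
  moreover have "d = Re (matrix_form F x y)"
    using rep[of F] by (simp add: F fA \<psi>_def d_def ev_def FW)
  ultimately show False using complex_Re_le_cmod[of "matrix_form F x y"] by linarith
qed

theorem theorem7p3:
  fixes A :: "(complex \<Rightarrow> complex) set"
    and z :: "'n::finite \<Rightarrow> complex"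
    and W :: "'n \<Rightarrow> complex ^ 'r::finite ^ 'r"
  assumes "dual_subalgebra A"
    and "range z \<subseteq> disk"
    and "separates A (range z)"
  shows "(\<exists>F\<in>matrices_over A. (\<forall>i. eval_matrix F (z i) = W i) \<and> mult_norm F \<le> 1) \<longleftrightarrow>
    (\<forall>L\<in>Lat A. let N = (\<lambda>i. ominus_ideal L (vanishing_ideal A (z i))) in
      positive_semidefinite (block_op (\<lambda>i j.
        tensor_op (mat 1 - W i ** conj_transpose (W j)) (proj (N i) \<circ> proj (N j)))))"
proof -
  have psd: "positive_semidefinite (block_op (\<lambda>i j. tensor_op (mat 1 - W i ** conj_transpose (W j))
        (proj (ominus_ideal L (vanishing_ideal A (z i))) \<circ> proj (ominus_ideal L (vanishing_ideal A (z j)))))) \<longleftrightarrow>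
    adjoint_contractive W (\<lambda>i. ominus_ideal L (vanishing_ideal A (z i)))" if "L \<in> Lat A" for L
    by (rule positive_semidefinite_iff_adjoint_contractive; rule ominus_ideal_closed[OF Lat_D(1,2)[OF that]])
  show ?thesis
    unfolding Let_def
  proof (intro iffI ballI)
    fix L assume L: "L \<in> Lat A"
    assume "\<exists>F\<in>matrices_over A. (\<forall>i. eval_matrix F (z i) = W i) \<and> mult_norm F \<le> 1"
    then obtain F where F: "F \<in> matrices_over A" "\<And>i. eval_matrix F (z i) = W i" "mult_norm F \<le> 1" by blast
    show "positive_semidefinite (block_op (\<lambda>i j. tensor_op (mat 1 - W i ** conj_transpose (W j))
        (proj (ominus_ideal L (vanishing_ideal A (z i))) \<circ> proj (ominus_ideal L (vanishing_ideal A (z j))))))"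
      unfolding psd[OF L]
      using interpolant_imp_adjoint_contractive[OF assms(1,2) F(1,3) L] unfolding F(2) .
  next
    assume *: "\<forall>L\<in>Lat A. positive_semidefinite (block_op (\<lambda>i j. tensor_op (mat 1 - W i ** conj_transpose (W j))
        (proj (ominus_ideal L (vanishing_ideal A (z i))) \<circ> proj (ominus_ideal L (vanishing_ideal A (z j))))))"
    obtain F where F: "F \<in> multiplier_ball A" "\<And>i. symbol F (z i) = W i"
      using interpolant_exists[OF assms, of W] * psd by blast
    define F' where "F' = (\<chi> a b. Rep_bergman (F $ a $ b))"
    have "F' \<in> matrices_over A"
      using multiplier_ballD(1)[OF assms(1) F(1)] by (simp add: matrices_over_def F'_def)
    moreover have "eval_matrix F' (z i) = W i" for i
      unfolding F(2)[symmetric] by (simp add: eval_matrix_def map_matrix_def F'_def symbol_def)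
    moreover have "mult_norm F' \<le> 1"
      unfolding mult_norm_def
      by (rule onorm_bound) (simp_all add: F'_def norm_block_op_multiplier_ball_le[OF assms(1) F(1)])
    ultimately show "\<exists>F\<in>matrices_over A. (\<forall>i. eval_matrix F (z i) = W i) \<and> mult_norm F \<le> 1" by blast
  qed
qed

end
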